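(* Let $p\ge 3$ be a prime, let $a\in\mathbb{Z}_p$ satisfy conditions (1) and (2) of the context, let $c\in 1+pW$ and let $\sigma$ be the $p$-th Frobenius on $W[[t]]$ with $\sigma(t)=ct^p$. Then for every integer $n\ge 1$, $$\widehat{\mathscr{F}}^{(\sigma)}_{a,a;2a}(t)\equiv \frac{[\widehat{G}^{(\sigma)}_{a,a;2a}(t)]_{<p^n}}{[F_{a,a;2a}(t)]_{<p^n}} \pmod{p^nW[[t]]}.$$
   Context: $W=W(\overline{\mathbb{F}}_p)$ is the ring of Witt vectors of $\overline{\mathbb{F}}_p$ and $F$ its Frobenius. For $c\in 1+pW$, $\sigma$ with $\sigma(t)=ct^p$ acts by $(\sum a_it^i)^\sigma=\sum a_i^F c^i t^{ip}$. For a power series $f=\sum a_it^i$, $[f]_{<m}=\sum_{i<m}a_it^i$. Every $\alpha\in\mathbb{Z}_p$ is written $\alpha=-[\alpha]_0-[\alpha]_1p-[\alpha]_2p^2-\cdots$ with $[\alpha]_i\in\{0,\dots,p-1\}$. The Dwork prime is $\alpha'=(\alpha+l_\alpha)/p$, where $l_\alpha\in\{0,\dots,p-1\}$ is the unique integer with $\alpha+l_\alpha\equiv0\pmod p$. Conditions on $a$: (1) $a\in N^{-1}\mathbb{Z}$ for some integer $N\ge2$ with $p\nmid N$; (2) for every $i\ge0$, $[a]_i<[2a]_i$, i.e. $0<[a]_i\le (p-1)/2$. Let $l\in\{0,\dots,p-1\}$ be the unique integer with $a+l\equiv0\pmod p$. With $(\alpha)_n=\alpha(\alpha+1)\cdots(\alpha+n-1)$,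 put $F_{\alpha,\beta;\gamma}(t)=\sum_{n\ge0}\frac{(\alpha)_n(\beta)_n}{(1)_n(\gamma)_n}t^n$. Under the conditions above, $F_{a,a;2a}(t)$ and $F_{a',a';(2a)'}(t)$ lie in $\mathbb{Z}_p[[t]]$. Morita's $p$-adic Gamma function is $\Gamma_p(z)=\lim_{n\in\mathbb{Z}_{\ge0},\,n\to z}(-1)^n\prod_{0<i<n,\,p\nmid i}i$ and $B_p(x,y)=\Gamma_p(x)\Gamma_p(y)/\Gamma_p(x+y)\in\mathbb{Z}_p^\times$. Define $$\widehat{G}^{(\sigma)}_{a,a;2a}(t)=t^{-a}\int_0^t\Big(t^aF_{a,a;2a}(t)-(-1)^lB_p(a,a)^{-1}[t^{a'}F_{a',a';(2a)'}(t)]^\sigma\Big)\frac{dt}{t},$$ where $\int_0^t t^\alpha\frac{dt}{t}=t^\alpha/\alpha$ for $\alpha\ne0$. Explicitly, writing $F_{a,a;2a}=\sum A_kt^k$, $F_{a',a';(2a)'}=\sum A^{(1)}_kt^k$, one has $\widehat{G}^{(\sigma)}_{a,a;2a}=\sum_k B_kt^k$ with $B_k=\frac1{k+a}\big(A_k-(-1)^lB_p(a,a)^{-1}A^{(1)}_{(k-l)/p}c^{(k+a)/p}\big)$, where $A^{(1)}_{m/p}=0$ if $p\nmid m$ or $m<0$. Finally $\widehat{\mathscr{F}}^{(\sigma)}_{a,a;2a}(t)=\widehat{G}^{(\sigma)}_{a,a;2a}(t)/F_{a,a;2a}(t)$. *)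

theory Defs
  imports
    "HOL-Computational_Algebra.Computational_Algebra"
    "HOL-Algebra.Algebraic_Closure_Type"
    "HOL-Library.Poly_Mapping"
    "Berlekamp_Zassenhaus.Finite_Field"
begin

section \<open>Integer polynomials in arbitrary many variables\<close>

type_synonym 'v zpoly = "('v \<Rightarrow>\<^sub>0 nat) \<Rightarrow>\<^sub>0 int"

definition zvar :: "'v \<Rightarrow> 'v zpoly"
  where "zvar v = Poly_Mapping.single (Poly_Mapping.single v 1) 1"

definition zeval_monom :: "('v \<Rightarrow> 'a::comm_ring_1) \<Rightarrow> ('v \<Rightarrow>\<^sub>0 nat) \<Rightarrow> 'a"
  where "zeval_monom g m = (\<Prod>v\<in>Poly_Mapping.keys m. g v ^ Poly_Mapping.lookup m v)"

definition zeval :: "('v \<Rightarrow> 'a::comm_ring_1) \<Rightarrow> 'v zpoly \<Rightarrow> 'a"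
  where "zeval g f = (\<Sum>m\<in>Poly_Mapping.keys f. of_int (Poly_Mapping.lookup f m) * zeval_monom g m)"

lemma zeval_monom_superset:
  assumes "finite S" "Poly_Mapping.keys m \<subseteq> S"
  shows "zeval_monom g m = (\<Prod>v\<in>S. g v ^ Poly_Mapping.lookup m v)"
  unfolding zeval_monom_def using assms
  by (intro prod.mono_neutral_left) (auto simp: in_keys_iff)

lemma zeval_monom_0 [simp]: "zeval_monom g 0 = 1"
  by (simp add: zeval_monom_def)

lemma zeval_monom_add: "zeval_monom g (m + m') = zeval_monom g m * zeval_monom g m'"
proof -
  let ?S = "Poly_Mapping.keys m \<union> Poly_Mapping.keys m'"
  have "zeval_monom g (m + m') = (\<Prod>v\<in>?S. g v ^ Poly_Mapping.lookup (m + m') v)"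
    using keys_add[of m m'] by (intro zeval_monom_superset) auto
  also have "\<dots> = (\<Prod>v\<in>?S. g v ^ Poly_Mapping.lookup m v) * (\<Prod>v\<in>?S. g v ^ Poly_Mapping.lookup m' v)"
    by (simp add: lookup_add power_add prod.distrib)
  also have "\<dots> = zeval_monom g m * zeval_monom g m'"
    by (subst (1 2) zeval_monom_superset[where S = ?S]) auto
  finally show ?thesis .
qed

lemma zeval_superset:
  assumes "finite S" "Poly_Mapping.keys f \<subseteq> S"
  shows "zeval g f = (\<Sum>m\<in>S. of_int (Poly_Mapping.lookup f m) * zeval_monom g m)"
  unfolding zeval_def using assms
  by (intro sum.mono_neutral_left) (auto simp: in_keys_iff)

lemma zeval_single [simp]: "zeval g (Poly_Mapping.single m c) = of_int c * zeval_monom g m"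
  by (subst zeval_superset[where S = "{m}"]) auto

lemma zeval_add [simp]: "zeval g (f + h) = zeval g f + zeval g h"
proof -
  let ?S = "Poly_Mapping.keys f \<union> Poly_Mapping.keys h"
  have "zeval g (f + h) = (\<Sum>m\<in>?S. of_int (Poly_Mapping.lookup (f + h) m) * zeval_monom g m)"
    using keys_add[of f h] by (intro zeval_superset) auto
  also have "\<dots> = (\<Sum>m\<in>?S. of_int (Poly_Mapping.lookup f m) * zeval_monom g m)
                 + (\<Sum>m\<in>?S. of_int (Poly_Mapping.lookup h m) * zeval_monom g m)"
    by (simp add: lookup_add sum.distrib algebra_simps)
  also have "\<dots> = zeval g f + zeval g h"
    by (subst (1 2) zeval_superset[where S = ?S]) auto
  finally show ?thesis .
qed

lemma zpoly_induct [case_names single add]: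
  fixes f :: "'v zpoly"
  assumes single: "\<And>m c. P (Poly_Mapping.single m c)"
    and add: "\<And>f g. P f \<Longrightarrow> P g \<Longrightarrow> P (f + g)"
  shows "P f"
proof (induction f rule: update_induct)
  case const
  show ?case using single[of 0 0] by simp
next
  case (update f a b)
  have "Poly_Mapping.update a b f = f + Poly_Mapping.single a b"
    using update.hyps(1)
    by (intro poly_mapping_eqI) (auto simp: lookup_update lookup_add lookup_single in_keys_iff when_def)
  then show ?case using add[OF update.IH single] by simp
qed

lemma zeval_mult [simp]: "zeval g (f * h) = zeval g f * zeval g h"
proof (induction f rule: zpoly_induct)
  case (single m c)
  show ?case
    by (induction h rule: zpoly_induct)
       (simp_all add: mult_single zeval_monom_add algebra_simps)
qed (simp add: algebra_simps)

lemma zeval_0 [simp]: "zeval g 0 = 0"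
  by (simp add: zeval_def)

lemma zeval_1 [simp]: "zeval g 1 = 1"
  using zeval_single[of g 0 1] by (simp del: zeval_single)

lemma zeval_zvar [simp]: "zeval g (zvar v) = g v"
  by (simp add: zvar_def zeval_monom_def)

lemma comm_ring_hom_zeval: "comm_ring_hom (zeval g)"
  by unfold_locales simp_all

lemma zeval_uminus [simp]: "zeval g (- f) = - zeval g f"
proof -
  interpret comm_ring_hom "zeval g" by (rule comm_ring_hom_zeval)
  show ?thesis by (rule hom_uminus)
qed

lemma zeval_hom:
  assumes "comm_ring_hom h"
  shows "h (zeval g f) = zeval (\<lambda>v. h (g v)) f"
proof -
  interpret comm_ring_hom h by fact
  show ?thesis by (simp add: zeval_def zeval_monom_def hom_distribs)
qed

lemma single_power_var:
  "zeval_monom zvar m = Poly_Mapping.single m 1"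
proof -
  have 1: "(zvar v :: 'a zpoly) ^ n = Poly_Mapping.single (Poly_Mapping.single v n) 1" for v n
    by (induction n) (simp_all add: zvar_def mult_single flip: single_add)
  show ?thesis
  proof (induction m rule: update_induct)
    case const
    show ?case by simp
  next
    case (update f a b)
    have "Poly_Mapping.update a b f = f + Poly_Mapping.single a b"
      using update.hyps(1)
      by (intro poly_mapping_eqI) (auto simp: lookup_update lookup_add lookup_single in_keys_iff when_def)
    moreover have "zeval_monom zvar (Poly_Mapping.single a b) = (Poly_Mapping.single (Poly_Mapping.single a b) 1 :: 'a zpoly)"
      using update.hyps(2) by (simp add: zeval_monom_def 1)
    ultimately show ?case
      by (simp add: zeval_monom_add update.IH mult_single)
  qed
qed

lemma zpoly_conv_zvar: "Poly_Mapping.single m c = of_int c * zeval_monom zvar m"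
  by (simp add: single_power_var mult_single flip: single_of_int)

lemma zeval_id: "zeval zvar f = f"
  by (induction f rule: zpoly_induct) (simp_all add: zpoly_conv_zvar[symmetric])

lemma lookup_of_nat_mult: 
  "Poly_Mapping.lookup (of_nat n * f) m = of_nat n * Poly_Mapping.lookup (f :: 'v zpoly) m"
proof (induction f rule: zpoly_induct)
  case (single k c)
  show ?case by (simp add: mult_single lookup_single when_def flip: single_of_nat)
qed (simp add: algebra_simps lookup_add)

section \<open>Witt vectors\<close>

text \<open>The \<open>n\<close>-th Witt polynomial, evaluated at \<open>x\<close>.\<close>

definition ghost :: "nat \<Rightarrow> nat \<Rightarrow> (nat \<Rightarrow> 'a::comm_ring_1) \<Rightarrow> 'a"
  where "ghost p n x = (\<Sum>i\<le>n. of_nat p ^ i * x i ^ (p ^ (n - i)))"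

text \<open>The solution \<open>S\<close> of \<open>ghost p n S = T n\<close> in integer polynomials. The coefficientwise
  division by \<open>p ^ n\<close> is exact in the cases used below, see \<open>ghost_unghost\<close>.\<close>

function unghost :: "nat \<Rightarrow> (nat \<Rightarrow> 'v zpoly) \<Rightarrow> nat \<Rightarrow> 'v zpoly"
  where "unghost p T n = Poly_Mapping.map (\<lambda>c. c div int p ^ n)
           (T n - (\<Sum>i<n. of_nat p ^ i * unghost p T i ^ (p ^ (n - i))))"
  by auto
termination by (relation "measure (\<lambda>(p, T, n). n)") auto

declare unghost.simps [simp del]

definition witt_add_poly :: "nat \<Rightarrow> nat \<Rightarrow> (nat + nat) zpoly"
  where "witt_add_poly p = unghost p (\<lambda>n. ghost p n (\<lambda>i. zvar (Inl i)) + ghost p n (\<lambda>i. zvar (Inr i)))"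

definition witt_mult_poly :: "nat \<Rightarrow> nat \<Rightarrow> (nat + nat) zpoly"
  where "witt_mult_poly p = unghost p (\<lambda>n. ghost p n (\<lambda>i. zvar (Inl i)) * ghost p n (\<lambda>i. zvar (Inr i)))"

definition witt_uminus_poly :: "nat \<Rightarrow> nat \<Rightarrow> nat zpoly"
  where "witt_uminus_poly p = unghost p (\<lambda>n. - ghost p n zvar)"

lemma dvd_power_diff_aux:
  fixes x y :: "'a::comm_ring_1"
  assumes "of_nat p ^ Suc j dvd x - y"
  shows "of_nat p ^ Suc (Suc j) dvd x ^ p - y ^ p"
proof -
  have p: "of_nat p dvd x - y"
    using assms by (metis dvd_mult_left power_Suc)
  have c: "of_nat p dvd x ^ k - y ^ k" for k
    using p by (metis dvd_trans power_diff_sumr2 dvd_triv_left)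
  have eq: "x ^ p - y ^ p = (x - y) * (\<Sum>i<p. y ^ (p - Suc i) * x ^ i)"
    by (rule power_diff_sumr2)
  have s: "of_nat p dvd (\<Sum>i<p. y ^ (p - Suc i) * x ^ i)"
  proof -
    have "(\<Sum>i<p. y ^ (p - Suc i) * x ^ i)
        = (\<Sum>i<p. y ^ (p - Suc i) * (x ^ i - y ^ i)) + (\<Sum>i<p. y ^ (p - Suc i) * y ^ i)"
      by (simp add: algebra_simps flip: sum.distrib)
    also have "(\<Sum>i<p. y ^ (p - Suc i) * y ^ i) = (\<Sum>i<p. y ^ (p - 1))"
      by (intro sum.cong) (auto simp flip: power_add)
    also have "\<dots> = of_nat p * y ^ (p - 1)"
      by simp
    finally show ?thesis
      using c by (auto intro!: dvd_add dvd_sum)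
  qed
  show ?thesis
    unfolding eq power_Suc2[of _ "Suc j"] by (rule mult_dvd_mono[OF assms s])
qed

lemma dvd_power_diff:
  fixes x y :: "'a::comm_ring_1"
  assumes "of_nat p dvd x - y"
  shows "of_nat p ^ Suc k dvd x ^ (p ^ k) - y ^ (p ^ k)"
proof (induction k)
  case (Suc k)
  show ?case
    using dvd_power_diff_aux[OF Suc] by (simp add: power_mult[symmetric] mult.commute)
qed (use assms in simp)

lemma dvd_freshman:
  fixes x y :: "'a::comm_ring_1"
  assumes "prime p"
  shows "of_nat p dvd (x + y) ^ p - x ^ p - y ^ p"
proof -
  have "p > 0" using assms by (simp add: prime_gt_0_nat)
  have "(x + y) ^ p = (\<Sum>k\<le>p. of_nat (p choose k) * x ^ k * y ^ (p - k))"
    by (rule binomial_ring)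
  also have "\<dots> = (\<Sum>k\<in>{..p} - {0, p}. of_nat (p choose k) * x ^ k * y ^ (p - k))
     + (\<Sum>k\<in>{0, p}. of_nat (p choose k) * x ^ k * y ^ (p - k))"
    by (rule sum.subset_diff) auto
  also have "(\<Sum>k\<in>{0, p}. of_nat (p choose k) * x ^ k * y ^ (p - k)) = x ^ p + y ^ p"
    using \<open>p > 0\<close> by (simp add: add_ac)
  finally have eq: "(x + y) ^ p - x ^ p - y ^ p
      = (\<Sum>k\<in>{..p} - {0, p}. of_nat (p choose k) * x ^ k * y ^ (p - k))"
    by simp
  show ?thesis unfolding eq
  proof (rule dvd_sum)
    fix k assume "k \<in> {..p} - {0, p}"
    then have "p dvd (p choose k)"
      using assms by (intro dvd_choose_prime) auto
    then obtain q where "p choose k = p * q" ..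
    then show "of_nat p dvd of_nat (p choose k) * x ^ k * y ^ (p - k)"
      by (simp add: mult.assoc)
  qed
qed

text \<open>The lift of Frobenius on integer polynomials.\<close>

definition zfrob :: "nat \<Rightarrow> 'v zpoly \<Rightarrow> 'v zpoly"
  where "zfrob p = zeval (\<lambda>v. zvar v ^ p)"

lemma comm_ring_hom_zfrob: "comm_ring_hom (zfrob p)"
  unfolding zfrob_def by (rule comm_ring_hom_zeval)

lemma zfrob_cong:
  assumes "prime p"
  shows "of_nat p dvd zfrob p f - f ^ p"
proof (induction f rule: zpoly_induct)
  case (single m c)
  have 1: "zfrob p (Poly_Mapping.single m c) = of_int c * zeval_monom zvar m ^ p"
    by (simp add: zfrob_def zeval_monom_def power_mult[symmetric] mult.commute prod_power_distrib)
  have 2: "Poly_Mapping.single m c ^ p = of_int (c ^ p) * zeval_monom zvar m ^ p"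
    by (subst zpoly_conv_zvar) (simp add: power_mult_distrib)
  have "int p dvd c - c ^ p"
  proof -
    have "[c ^ p = c] (mod int p)"
    proof (cases "int p dvd c")
      case True
      moreover have "int p dvd c ^ p"
        using True assms by (metis dvd_power dvd_trans prime_gt_0_nat)
      ultimately show ?thesis
        by (simp add: cong_iff_dvd_diff)
    next
      case False
      have "[c ^ (p - 1) = 1] (mod int p)"
      proof -
        define d where "d = nat (c mod int p)"
        have d: "[c = int d] (mod int p)"
          using assms by (simp add: d_def cong_def prime_gt_0_nat)
        have "\<not> p dvd d"
          using d False by (metis cong_dvd_iff int_dvd_int_iff cong_sym cong_iff_dvd_diff dvd_diff_commute zdvd_zdiffD)
        then have "[d ^ (p - 1) = 1] (mod p)"
          by (rule fermat_theorem[OF assms])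
        then have "[int d ^ (p - 1) = 1] (mod int p)"
          by (metis cong_int_iff of_nat_1 of_nat_power)
        then show ?thesis using d by (meson cong_pow cong_trans)
      qed
      then have "[c ^ (p - 1) * c = 1 * c] (mod int p)"
        by (rule cong_scalar_right)
      moreover have "c ^ (p - 1) * c = c ^ p"
        using assms by (metis power_minus_mult prime_gt_0_nat)
      ultimately show ?thesis by simp
    qed
    then show ?thesis by (simp add: cong_iff_dvd_diff dvd_diff_commute)
  qed
  then obtain q where q: "c - c ^ p = int p * q" ..
  have "zfrob p (Poly_Mapping.single m c) - Poly_Mapping.single m c ^ p
      = of_int (c - c ^ p) * zeval_monom zvar m ^ p"
    unfolding 1 2 by (simp add: algebra_simps)
  also have "of_nat p dvd \<dots>"
    unfolding q by (simp add: mult.assoc)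
  finally show ?case .
next
  case (add f g)
  interpret comm_ring_hom "zfrob p" by (rule comm_ring_hom_zfrob)
  have "zfrob p (f + g) - (f + g) ^ p
      = (zfrob p f - f ^ p) + (zfrob p g - g ^ p) - ((f + g) ^ p - f ^ p - g ^ p)"
    by (simp add: hom_add)
  also have "of_nat p dvd \<dots>"
    by (rule dvd_diff[OF dvd_add[OF add] dvd_freshman[OF assms]])
  finally show ?case .
qed

definition dwork_seq :: "nat \<Rightarrow> (nat \<Rightarrow> 'v zpoly) \<Rightarrow> bool"
  where "dwork_seq p T \<longleftrightarrow> (\<forall>n. of_nat p ^ Suc n dvd T (Suc n) - zfrob p (T n))"

lemma zpoly_map_div:
  fixes f :: "'v zpoly"
  assumes "of_nat k dvd f" "k > 0"
  shows "of_nat k * Poly_Mapping.map (\<lambda>c. c div int k) f = f"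
proof -
  obtain g where g: "f = of_nat k * g" using assms by auto
  have "Poly_Mapping.map (\<lambda>c. c div int k) f = g"
    using assms(2)
    by (intro poly_mapping_eqI) (auto simp: g map.rep_eq lookup_of_nat_mult when_def)
  then show ?thesis by (simp add: g)
qed

lemma ghost_unghost:
  assumes "prime p" "dwork_seq p T"
  shows "ghost p n (unghost p T) = T n"
proof (induction n rule: less_induct)
  case (less n)
  interpret comm_ring_hom "zfrob p" by (rule comm_ring_hom_zfrob)
  let ?S = "unghost p T"
  have "of_nat p ^ n dvd T n - (\<Sum>i<n. of_nat p ^ i * ?S i ^ (p ^ (n - i)))"
  proof (cases n)
    case (Suc m)
    have "zfrob p (T m) = zfrob p (ghost p m ?S)"
      using less[of m] Suc by simp
    also have "\<dots> = (\<Sum>i\<le>m. of_nat p ^ i * zfrob p (?S i) ^ (p ^ (m - i)))"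
      by (simp add: ghost_def hom_distribs)
    finally have 1: "zfrob p (T m) = \<dots>" .
    have 2: "(\<Sum>i<n. of_nat p ^ i * ?S i ^ (p ^ (n - i)))
        = (\<Sum>i\<le>m. of_nat p ^ i * (?S i ^ p) ^ (p ^ (m - i)))"
      by (intro sum.cong) (auto simp: Suc Suc_diff_le simp flip: power_mult)
    have 3: "of_nat p ^ n dvd (\<Sum>i\<le>m. of_nat p ^ i *
        (zfrob p (?S i) ^ (p ^ (m - i)) - (?S i ^ p) ^ (p ^ (m - i))))"
    proof (rule dvd_sum)
      fix i assume "i \<in> {..m}"
      then have "(of_nat p :: 'a zpoly) ^ n = of_nat p ^ i * of_nat p ^ Suc (m - i)"
        by (simp add: Suc Suc_diff_le flip: power_add power_Suc)
      then show "of_nat p ^ n dvd of_nat p ^ i *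
          (zfrob p (?S i) ^ (p ^ (m - i)) - (?S i ^ p) ^ (p ^ (m - i)))"
        using dvd_power_diff[OF zfrob_cong[OF assms(1)], of "m - i" "?S i"]
        by (simp only: mult_dvd_mono dvd_refl)
    qed
    have 4: "of_nat p ^ n dvd T n - zfrob p (T m)"
      using assms(2) unfolding dwork_seq_def Suc by blast
    have 5: "T n - (\<Sum>i<n. of_nat p ^ i * ?S i ^ (p ^ (n - i)))
        = (T n - zfrob p (T m)) + (\<Sum>i\<le>m. of_nat p ^ i *
        (zfrob p (?S i) ^ (p ^ (m - i)) - (?S i ^ p) ^ (p ^ (m - i))))"
      unfolding 1 2 by (simp add: algebra_simps sum_subtractf)
    show ?thesis unfolding 5 by (rule dvd_add[OF 4 3])
  qed simp
  then have "of_nat (p ^ n) dvd T n - (\<Sum>i<n. of_nat p ^ i * ?S i ^ (p ^ (n - i)))"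
    by simp
  then have "of_nat (p ^ n) * ?S n = T n - (\<Sum>i<n. of_nat p ^ i * ?S i ^ (p ^ (n - i)))"
    using zpoly_map_div[of "p ^ n"] assms(1)
    by (subst unghost.simps) (simp add: prime_gt_0_nat)
  then show ?case
    by (simp add: ghost_def lessThan_Suc_atMost[symmetric])
qed

lemma dwork_seq_ghost:
  fixes f :: "nat \<Rightarrow> 'b"
  shows "dwork_seq p (\<lambda>n. ghost p n (\<lambda>i. zvar (f i)))"
  unfolding dwork_seq_def
proof
  fix n
  interpret comm_ring_hom "zfrob p :: 'b zpoly \<Rightarrow> _" by (rule comm_ring_hom_zfrob)
  have v: "zfrob p (zvar v) = zvar v ^ p" for v :: 'b by (simp add: zfrob_def)
  have "zfrob p (ghost p n (\<lambda>i. zvar (f i)))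
      = (\<Sum>i\<le>n. of_nat p ^ i * (zvar (f i) ^ p) ^ (p ^ (n - i)))"
    by (simp add: ghost_def hom_distribs v)
  also have "\<dots> = (\<Sum>i\<le>n. of_nat p ^ i * zvar (f i) ^ (p ^ (Suc n - i)))"
    by (intro sum.cong) (auto simp: Suc_diff_le simp flip: power_mult)
  finally show "of_nat p ^ Suc n dvd ghost p (Suc n) (\<lambda>i. zvar (f i))
      - zfrob p (ghost p n (\<lambda>i. zvar (f i)))"
    by (simp add: ghost_def)
qed

lemma dwork_seq_add:
  assumes "dwork_seq p S" "dwork_seq p T" shows "dwork_seq p (\<lambda>n. S n + T n)"
  unfolding dwork_seq_def
proof
  fix n
  interpret comm_ring_hom "zfrob p" by (rule comm_ring_hom_zfrob)
  have "S (Suc n) + T (Suc n) - zfrob p (S n + T n)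
     = (S (Suc n) - zfrob p (S n)) + (T (Suc n) - zfrob p (T n))"
    by (simp add: hom_add)
  then show "of_nat p ^ Suc n dvd S (Suc n) + T (Suc n) - zfrob p (S n + T n)"
    using assms unfolding dwork_seq_def by (simp only: dvd_add)
qed

lemma dwork_seq_mult:
  assumes "dwork_seq p S" "dwork_seq p T" shows "dwork_seq p (\<lambda>n. S n * T n)"
  unfolding dwork_seq_def
proof
  fix n
  interpret comm_ring_hom "zfrob p" by (rule comm_ring_hom_zfrob)
  have "S (Suc n) * T (Suc n) - zfrob p (S n * T n)
     = (S (Suc n) - zfrob p (S n)) * T (Suc n) + zfrob p (S n) * (T (Suc n) - zfrob p (T n))"
    by (simp add: hom_mult algebra_simps)
  then show "of_nat p ^ Suc n dvd S (Suc n) * T (Suc n) - zfrob p (S n * T n)"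
    using assms unfolding dwork_seq_def by (simp only: dvd_add dvd_mult dvd_mult2)
qed

lemma dwork_seq_uminus:
  assumes "dwork_seq p S" shows "dwork_seq p (\<lambda>n. - S n)"
  unfolding dwork_seq_def
proof
  fix n
  interpret comm_ring_hom "zfrob p" by (rule comm_ring_hom_zfrob)
  have "- S (Suc n) - zfrob p (- S n) = - (S (Suc n) - zfrob p (S n))"
    by (simp add: hom_uminus)
  then show "of_nat p ^ Suc n dvd - S (Suc n) - zfrob p (- S n)"
    using assms unfolding dwork_seq_def by (simp only: dvd_minus_iff)
qed

definition wadd :: "nat \<Rightarrow> (nat \<Rightarrow> 'a::comm_ring_1) \<Rightarrow> (nat \<Rightarrow> 'a) \<Rightarrow> nat \<Rightarrow> 'a"
  where "wadd p x y n = zeval (case_sum x y) (witt_add_poly p n)"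

definition wmult :: "nat \<Rightarrow> (nat \<Rightarrow> 'a::comm_ring_1) \<Rightarrow> (nat \<Rightarrow> 'a) \<Rightarrow> nat \<Rightarrow> 'a"
  where "wmult p x y n = zeval (case_sum x y) (witt_mult_poly p n)"

definition wuminus :: "nat \<Rightarrow> (nat \<Rightarrow> 'a::comm_ring_1) \<Rightarrow> nat \<Rightarrow> 'a"
  where "wuminus p x n = zeval x (witt_uminus_poly p n)"

definition wone :: "nat \<Rightarrow> 'a::comm_ring_1"
  where "wone n = (if n = 0 then 1 else 0)"

lemma ghost_hom:
  assumes "comm_ring_hom h"
  shows "h (ghost p n x) = ghost p n (\<lambda>i. h (x i))"
proof -
  interpret comm_ring_hom h by fact
  show ?thesis by (simp add: ghost_def hom_distribs)
qed

lemma ghost_wadd: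
  assumes "prime p"
  shows "ghost p n (wadd p x y) = ghost p n x + ghost p n y"
proof -
  let ?X = "\<lambda>n. ghost p n (\<lambda>i. zvar (Inl i)) + ghost p n (\<lambda>i. zvar (Inr i)) :: (nat + nat) zpoly"
  have "ghost p n (witt_add_poly p) = ?X n"
    unfolding witt_add_poly_def
    by (rule ghost_unghost[OF assms]) (intro dwork_seq_add dwork_seq_ghost)
  then have "zeval (case_sum x y) (ghost p n (witt_add_poly p)) = zeval (case_sum x y) (?X n)"
    by simp
  then show ?thesis
    by (simp add: ghost_hom[OF comm_ring_hom_zeval] wadd_def[abs_def])
qed

lemma ghost_wmult:
  assumes "prime p"
  shows "ghost p n (wmult p x y) = ghost p n x * ghost p n y"
proof -
  let ?X = "\<lambda>n. ghost p n (\<lambda>i. zvar (Inl i)) * ghost p n (\<lambda>i. zvar (Inr i)) :: (nat + nat) zpoly"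
  have "ghost p n (witt_mult_poly p) = ?X n"
    unfolding witt_mult_poly_def
    by (rule ghost_unghost[OF assms]) (intro dwork_seq_mult dwork_seq_ghost)
  then have "zeval (case_sum x y) (ghost p n (witt_mult_poly p)) = zeval (case_sum x y) (?X n)"
    by simp
  then show ?thesis
    by (simp add: ghost_hom[OF comm_ring_hom_zeval] wmult_def[abs_def])
qed

lemma ghost_wuminus:
  assumes "prime p"
  shows "ghost p n (wuminus p x) = - ghost p n x"
proof -
  have "ghost p n (witt_uminus_poly p) = - ghost p n zvar"
    unfolding witt_uminus_poly_def
    by (rule ghost_unghost[OF assms]) (intro dwork_seq_uminus dwork_seq_ghost[of p "\<lambda>i. i"])
  then have "zeval x (ghost p n (witt_uminus_poly p)) = zeval x (- ghost p n zvar)"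
    by simp
  then show ?thesis
    by (simp add: ghost_hom[OF comm_ring_hom_zeval] wuminus_def[abs_def])
qed

lemma ghost_0:
  assumes "p > 0" shows "ghost p n (\<lambda>_. 0) = 0"
  using assms by (simp add: ghost_def power_0_left)

lemma ghost_wone:
  assumes "p > 0" shows "ghost p n wone = 1"
proof -
  have "ghost p n (wone :: nat \<Rightarrow> 'a) = (\<Sum>i\<in>{0}. of_nat p ^ i * wone i ^ (p ^ (n - i)))"
    unfolding ghost_def using assms by (intro sum.mono_neutral_right) (auto simp: wone_def power_0_left)
  then show ?thesis by (simp add: wone_def)
qed

lemma zpoly_mult_cancel:
  assumes "of_nat k * f = of_nat k * (g :: 'v zpoly)" "k > 0"
  shows "f = g"
proof (rule poly_mapping_eqI)
  fix m
  have "Poly_Mapping.lookup (of_nat k * f) m = Poly_Mapping.lookup (of_nat k * g) m"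
    using assms(1) by simp
  then show "Poly_Mapping.lookup f m = Poly_Mapping.lookup g m"
    using assms(2) by (simp add: lookup_of_nat_mult)
qed

lemma ghost_inj:
  fixes x y :: "nat \<Rightarrow> 'v zpoly"
  assumes "p > 0" "\<And>n. ghost p n x = ghost p n y"
  shows "x = y"
proof
  fix n
  show "x n = y n"
  proof (induction n rule: less_induct)
    case (less n)
    have "ghost p n x = ghost p n y" by fact
    moreover have "(\<Sum>i<n. of_nat p ^ i * x i ^ (p ^ (n - i))) = (\<Sum>i<n. of_nat p ^ i * y i ^ (p ^ (n - i)))"
      using less by (intro sum.cong) auto
    ultimately have "of_nat (p ^ n) * x n = of_nat (p ^ n) * y n"
      by (simp add: ghost_def lessThan_Suc_atMost[symmetric])
    then show ?case using assms(1) zpoly_mult_cancel[of "p ^ n" "x n" "y n"] by simp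
  qed
qed

lemma wadd_hom:
  assumes "comm_ring_hom h"
  shows "wadd p (\<lambda>i. h (x i)) (\<lambda>i. h (y i)) = (\<lambda>i. h (wadd p x y i))"
proof
  fix n
  have "case_sum (\<lambda>i. h (x i)) (\<lambda>i. h (y i)) = (\<lambda>v. h (case_sum x y v))"
    by (auto split: sum.splits)
  then show "wadd p (\<lambda>i. h (x i)) (\<lambda>i. h (y i)) n = h (wadd p x y n)"
    by (simp add: wadd_def zeval_hom[OF assms])
qed

lemma wmult_hom:
  assumes "comm_ring_hom h"
  shows "wmult p (\<lambda>i. h (x i)) (\<lambda>i. h (y i)) = (\<lambda>i. h (wmult p x y i))"
proof
  fix n
  have "case_sum (\<lambda>i. h (x i)) (\<lambda>i. h (y i)) = (\<lambda>v. h (case_sum x y v))"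
    by (auto split: sum.splits)
  then show "wmult p (\<lambda>i. h (x i)) (\<lambda>i. h (y i)) n = h (wmult p x y n)"
    by (simp add: wmult_def zeval_hom[OF assms])
qed

lemma wuminus_hom:
  assumes "comm_ring_hom h"
  shows "wuminus p (\<lambda>i. h (x i)) = (\<lambda>i. h (wuminus p x i))"
  by (auto simp: wuminus_def zeval_hom[OF assms])

text \<open>Every ring is a quotient of the \<open>p\<close>-torsion free ring of integer polynomials in its
  elements, where identities can be checked on ghost components.\<close>

abbreviation zquot :: "'a::comm_ring_1 zpoly \<Rightarrow> 'a" where "zquot \<equiv> zeval (\<lambda>a. a)"

lemma zquot_lift: obtains u where "x = (\<lambda>i. zquot (u i))"
  by (rule that[of "\<lambda>i. zvar (x i)"]) simp

lemmas zquot_homs = comm_ring_hom_zeval[where g = "\<lambda>a. a"]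

lemma wadd_assoc:
  assumes "prime p" shows "wadd p (wadd p x y) z = wadd p x (wadd p y z)"
proof -
  obtain u v w where [simp]: "x = (\<lambda>i. zquot (u i))" "y = (\<lambda>i. zquot (v i))" "z = (\<lambda>i. zquot (w i))"
    by (metis zquot_lift)
  have "wadd p (wadd p u v) w = wadd p u (wadd p v w)"
    using assms by (intro ghost_inj[of p]) (auto simp: ghost_wadd prime_gt_0_nat algebra_simps)
  then show ?thesis by (simp add: wadd_hom[OF zquot_homs])
qed

lemma wadd_commute:
  assumes "prime p" shows "wadd p x y = wadd p y x"
proof -
  obtain u v where [simp]: "x = (\<lambda>i. zquot (u i))" "y = (\<lambda>i. zquot (v i))"
    by (metis zquot_lift)
  have "wadd p u v = wadd p v u"
    using assms by (intro ghost_inj[of p]) (auto simp: ghost_wadd prime_gt_0_nat algebra_simps)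
  then show ?thesis by (simp add: wadd_hom[OF zquot_homs])
qed

lemma wmult_assoc:
  assumes "prime p" shows "wmult p (wmult p x y) z = wmult p x (wmult p y z)"
proof -
  obtain u v w where [simp]: "x = (\<lambda>i. zquot (u i))" "y = (\<lambda>i. zquot (v i))" "z = (\<lambda>i. zquot (w i))"
    by (metis zquot_lift)
  have "wmult p (wmult p u v) w = wmult p u (wmult p v w)"
    using assms by (intro ghost_inj[of p]) (auto simp: ghost_wmult prime_gt_0_nat algebra_simps)
  then show ?thesis by (simp add: wmult_hom[OF zquot_homs])
qed

lemma wmult_commute:
  assumes "prime p" shows "wmult p x y = wmult p y x"
proof -
  obtain u v where [simp]: "x = (\<lambda>i. zquot (u i))" "y = (\<lambda>i. zquot (v i))"
    by (metis zquot_lift)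
  have "wmult p u v = wmult p v u"
    using assms by (intro ghost_inj[of p]) (auto simp: ghost_wmult prime_gt_0_nat algebra_simps)
  then show ?thesis by (simp add: wmult_hom[OF zquot_homs])
qed

lemma wmult_wadd_distrib:
  assumes "prime p" shows "wmult p (wadd p x y) z = wadd p (wmult p x z) (wmult p y z)"
proof -
  obtain u v w where [simp]: "x = (\<lambda>i. zquot (u i))" "y = (\<lambda>i. zquot (v i))" "z = (\<lambda>i. zquot (w i))"
    by (metis zquot_lift)
  have "wmult p (wadd p u v) w = wadd p (wmult p u w) (wmult p v w)"
    using assms by (intro ghost_inj[of p]) (auto simp: ghost_wmult ghost_wadd prime_gt_0_nat algebra_simps)
  then show ?thesis by (simp add: wmult_hom[OF zquot_homs] wadd_hom[OF zquot_homs])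
qed

lemma wadd_0:
  assumes "prime p" shows "wadd p (\<lambda>_. 0) x = x"
proof -
  obtain u where [simp]: "x = (\<lambda>i. zquot (u i))" by (metis zquot_lift)
  have 0: "(\<lambda>_. 0 :: 'a) = (\<lambda>i. zquot ((\<lambda>_. 0) i))" by simp
  have "wadd p (\<lambda>_. 0) u = u"
    using assms by (intro ghost_inj[of p]) (auto simp: ghost_wadd ghost_0 prime_gt_0_nat)
  then show ?thesis
    by (subst 0) (simp only: wadd_hom[OF zquot_homs] \<open>x = _\<close>)
qed

lemma wmult_1:
  assumes "prime p" shows "wmult p wone x = x"
proof -
  obtain u where [simp]: "x = (\<lambda>i. zquot (u i))" by (metis zquot_lift)
  have 1: "(wone :: nat \<Rightarrow> 'a) = (\<lambda>i. zquot (wone i))" by (auto simp: wone_def)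
  have "wmult p wone u = u"
    using assms by (intro ghost_inj[of p]) (auto simp: ghost_wmult ghost_wone prime_gt_0_nat)
  then show ?thesis
    by (subst 1) (simp only: wmult_hom[OF zquot_homs] \<open>x = _\<close>)
qed

lemma wadd_wuminus:
  assumes "prime p" shows "wadd p (wuminus p x) x = (\<lambda>_. 0)"
proof -
  obtain u where [simp]: "x = (\<lambda>i. zquot (u i))" by (metis zquot_lift)
  have "wadd p (wuminus p u) u = (\<lambda>_. 0)"
    using assms by (intro ghost_inj[of p]) (auto simp: ghost_wadd ghost_wuminus ghost_0 prime_gt_0_nat)
  then show ?thesis by (simp add: wadd_hom[OF zquot_homs] wuminus_hom[OF zquot_homs])
qed


lemma ghost_dvd:
  assumes "\<And>i. i < a \<Longrightarrow> x i = 0" "p > 0"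
  shows "of_nat p ^ a dvd ghost p n x"
  unfolding ghost_def
proof (rule dvd_sum)
  fix i
  show "of_nat p ^ a dvd of_nat p ^ i * x i ^ p ^ (n - i)"
    using assms by (cases "i < a") (auto simp: power_0_left intro!: dvd_mult2 le_imp_power_dvd)
qed

lemma ghost_lead:
  fixes x :: "nat \<Rightarrow> 'a::comm_ring_1"
  assumes "\<And>i. i < a \<Longrightarrow> x i = 0" "p > 0" "a \<le> n"
  shows "of_nat p ^ Suc a dvd ghost p n x - of_nat p ^ a * x a ^ p ^ (n - a)"
proof -
  have "ghost p n x = (\<Sum>i\<in>{..n} - {a}. of_nat p ^ i * x i ^ p ^ (n - i))
      + (\<Sum>i\<in>{a}. of_nat p ^ i * x i ^ p ^ (n - i))"
    unfolding ghost_def using assms(3) by (intro sum.subset_diff) auto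
  then have eq: "ghost p n x - of_nat p ^ a * x a ^ p ^ (n - a)
      = (\<Sum>i\<in>{..n} - {a}. of_nat p ^ i * x i ^ p ^ (n - i))"
    by simp
  show ?thesis unfolding eq
  proof (rule dvd_sum)
    fix i assume i: "i \<in> {..n} - {a}"
    show "of_nat p ^ Suc a dvd of_nat p ^ i * x i ^ p ^ (n - i)"
    proof (cases "i < a")
      case True
      then show ?thesis using assms by (simp add: power_0_left)
    next
      case False
      then show ?thesis using i by (intro dvd_mult2 le_imp_power_dvd) auto
    qed
  qed
qed

lemma zpoly_dvd_cancel:
  assumes "of_nat p ^ Suc m dvd of_nat p ^ m * (f :: 'v zpoly)" "p > 0"
  shows "of_nat p dvd f"
proof -
  obtain g where "of_nat p ^ m * f = of_nat p ^ Suc m * g"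
    using assms(1) by (elim dvdE)
  then have "of_nat (p ^ m) * f = of_nat (p ^ m) * (of_nat p * g)"
    by (simp add: mult_ac)
  then have "f = of_nat p * g"
    using assms(2) zpoly_mult_cancel[of "p ^ m"] by (metis zero_less_power)
  then show ?thesis by simp
qed

lemma dvd_ghost_tail:
  fixes x :: "nat \<Rightarrow> 'a::comm_ring_1"
  assumes "\<And>i. i < m \<Longrightarrow> of_nat p dvd x i" "p > 1"
  shows "of_nat p ^ Suc m dvd ghost p m x - of_nat p ^ m * x m"
proof -
  have eq: "ghost p m x - of_nat p ^ m * x m = (\<Sum>i<m. of_nat p ^ i * x i ^ p ^ (m - i))"
    by (simp add: ghost_def lessThan_Suc_atMost[symmetric])
  show ?thesis unfolding eq
  proof (rule dvd_sum)
    fix i assume i: "i \<in> {..<m}"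
    have "m - i < p ^ (m - i)"
      using assms(2) by (intro power_gt_expt) simp
    then have "of_nat p ^ Suc (m - i) dvd (of_nat p :: 'a) ^ p ^ (m - i)"
      by (intro le_imp_power_dvd) simp
    also have "\<dots> dvd x i ^ p ^ (m - i)"
      using assms(1) i by (intro dvd_power_same) auto
    finally have "of_nat p ^ i * of_nat p ^ Suc (m - i) dvd of_nat p ^ i * x i ^ p ^ (m - i)"
      by (intro mult_dvd_mono dvd_refl)
    then show "of_nat p ^ Suc m dvd of_nat p ^ i * x i ^ p ^ (m - i)"
      using i by (simp flip: power_add power_Suc)
  qed
qed

lemma wmult_lead:
  fixes x y :: "nat \<Rightarrow> 'v zpoly"
  assumes p: "prime p" and x: "\<And>i. i < a \<Longrightarrow> x i = 0" and y: "\<And>i. i < b \<Longrightarrow> y i = 0"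
  shows "of_nat p dvd wmult p x y (a + b) - x a ^ p ^ b * y b ^ p ^ a"
proof -
  have p1: "p > 1" using p by (rule prime_gt_1_nat)
  then have p0: "p > 0" by simp
  let ?z = "wmult p x y"
  have d: "of_nat p ^ (a + b) dvd ghost p n ?z" for n
    unfolding ghost_wmult[OF p] power_add by (intro mult_dvd_mono ghost_dvd x y p0)
  have z: "of_nat p dvd ?z m" if "m < a + b" for m
    using that
  proof (induction m rule: less_induct)
    case (less m)
    have 1: "of_nat p ^ Suc m dvd ghost p m ?z - of_nat p ^ m * ?z m"
      using less p1 by (intro dvd_ghost_tail) auto
    have 2: "of_nat p ^ Suc m dvd ghost p m ?z"
      using less.prems by (intro dvd_trans[OF le_imp_power_dvd d]) simp
    have "ghost p m ?z - (ghost p m ?z - of_nat p ^ m * ?z m) = of_nat p ^ m * ?z m"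
      by simp
    with dvd_diff[OF 2 1] have "of_nat p ^ Suc m dvd of_nat p ^ m * ?z m"
      by (simp only:)
    then show ?case using p0 by (rule zpoly_dvd_cancel)
  qed
  let ?m = "a + b"
  obtain r where r: "ghost p ?m x - of_nat p ^ a * x a ^ p ^ b = of_nat p ^ Suc a * r"
    using ghost_lead[of a x p ?m] x p0 by auto
  obtain s where s: "ghost p ?m y - of_nat p ^ b * y b ^ p ^ a = of_nat p ^ Suc b * s"
    using ghost_lead[of b y p ?m] y p0 by auto
  have r': "ghost p ?m x = of_nat p ^ a * (x a ^ p ^ b + of_nat p * r)"
    using r by (simp add: algebra_simps)
  have s': "ghost p ?m y = of_nat p ^ b * (y b ^ p ^ a + of_nat p * s)"
    using s by (simp add: algebra_simps)
  have "ghost p ?m ?z - of_nat p ^ ?m * (x a ^ p ^ b * y b ^ p ^ a)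
      = of_nat p ^ Suc ?m * (x a ^ p ^ b * s + r * y b ^ p ^ a + of_nat p * r * s)"
    unfolding ghost_wmult[OF p] r' s' by (simp add: algebra_simps power_add)
  then have 1: "of_nat p ^ Suc ?m dvd ghost p ?m ?z - of_nat p ^ ?m * (x a ^ p ^ b * y b ^ p ^ a)"
    by (simp only: dvd_triv_left)
  have 2: "of_nat p ^ Suc ?m dvd ghost p ?m ?z - of_nat p ^ ?m * ?z ?m"
    using z p1 by (intro dvd_ghost_tail) auto
  have "of_nat p ^ ?m * (?z ?m - x a ^ p ^ b * y b ^ p ^ a)
      = (ghost p ?m ?z - of_nat p ^ ?m * (x a ^ p ^ b * y b ^ p ^ a))
        - (ghost p ?m ?z - of_nat p ^ ?m * ?z ?m)"
    by (simp add: algebra_simps)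
  then have "of_nat p ^ Suc ?m dvd of_nat p ^ ?m * (?z ?m - x a ^ p ^ b * y b ^ p ^ a)"
    using dvd_diff[OF 1 2] by simp
  then show ?thesis using p0 by (rule zpoly_dvd_cancel)
qed

lemma wmult_nonzero:
  fixes x y :: "nat \<Rightarrow> 'a::idom"
  assumes p: "prime p" "of_nat p = (0 :: 'a)" and "x \<noteq> (\<lambda>_. 0)" "y \<noteq> (\<lambda>_. 0)"
  shows "wmult p x y \<noteq> (\<lambda>_. 0)"
proof -
  define a where "a = (LEAST i. x i \<noteq> 0)"
  define b where "b = (LEAST i. y i \<noteq> 0)"
  have "\<exists>i. x i \<noteq> 0"
    using assms(3) by auto
  then have a: "x a \<noteq> 0" "\<And>i. i < a \<Longrightarrow> x i = 0"
    unfolding a_def by (rule LeastI_ex, use not_less_Least[of _ "\<lambda>i. x i \<noteq> 0"] in blast)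
  have "\<exists>i. y i \<noteq> 0"
    using assms(4) by auto
  then have b: "y b \<noteq> 0" "\<And>i. i < b \<Longrightarrow> y i = 0"
    unfolding b_def by (rule LeastI_ex, use not_less_Least[of _ "\<lambda>i. y i \<noteq> 0"] in blast)
  define u where "u i = (if x i = 0 then 0 else zvar (x i))" for i
  define v where "v i = (if y i = 0 then 0 else zvar (y i))" for i
  have u: "x = (\<lambda>i. zquot (u i))" and v: "y = (\<lambda>i. zquot (v i))"
    by (auto simp: u_def v_def)
  obtain q where q: "wmult p u v (a + b) - u a ^ p ^ b * v b ^ p ^ a = of_nat p * q"
    using wmult_lead[OF p(1), of a u b v] a b by (auto simp: u_def v_def)
  interpret h: comm_ring_hom "zquot :: 'a zpoly \<Rightarrow> 'a" by (rule zquot_homs)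
  have "zquot (wmult p u v (a + b) - u a ^ p ^ b * v b ^ p ^ a) = 0"
    unfolding q by (simp add: h.hom_of_nat p(2))
  then have "zquot (wmult p u v (a + b)) = x a ^ p ^ b * y b ^ p ^ a"
    using fun_cong[OF u, of a] fun_cong[OF v, of b]
    by (simp only: h.hom_minus h.hom_mult h.hom_power right_minus_eq)
  moreover have "wmult p x y = (\<lambda>i. zquot (wmult p u v i))"
    using wmult_hom[OF zquot_homs, of p u v] by (simp only: u[symmetric] v[symmetric])
  ultimately have "wmult p x y (a + b) \<noteq> 0"
    using a(1) b(1) by simp
  then show ?thesis by auto
qed

text \<open>The ring of \<open>p\<close>-typical Witt vectors of a ring \<open>'k\<close> of prime characteristic \<open>p\<close>.\<close>

typedef 'k witt = "UNIV :: (nat \<Rightarrow> 'k) set"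
  morphisms witt_nth Abs_witt by auto

setup_lifting type_definition_witt

instantiation witt :: (comm_ring_prime_char) comm_ring_1
begin

lift_definition zero_witt :: "'a witt" is "\<lambda>_. 0" .
lift_definition one_witt :: "'a witt" is "wone" .
lift_definition plus_witt :: "'a witt \<Rightarrow> 'a witt \<Rightarrow> 'a witt" is "wadd CHAR('a)" .
lift_definition times_witt :: "'a witt \<Rightarrow> 'a witt \<Rightarrow> 'a witt" is "wmult CHAR('a)" .
lift_definition uminus_witt :: "'a witt \<Rightarrow> 'a witt" is "wuminus CHAR('a)" .
definition minus_witt :: "'a witt \<Rightarrow> 'a witt \<Rightarrow> 'a witt" where "minus_witt x y = x + - y"

instance
proof
  fix x y z :: "'a witt"
  show "x + y + z = x + (y + z)" by transfer (simp add: wadd_assoc)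
  show "x + y = y + x" by transfer (simp add: wadd_commute)
  show "0 + x = x" by transfer (simp add: wadd_0)
  show "- x + x = 0" by transfer (simp add: wadd_wuminus)
  show "x - y = x + - y" by (fact minus_witt_def)
  show "x * y * z = x * (y * z)" by transfer (simp add: wmult_assoc)
  show "x * y = y * x" by transfer (simp add: wmult_commute)
  show "1 * x = x" by transfer (simp add: wmult_1)
  show "(x + y) * z = x * z + y * z" by transfer (simp add: wmult_wadd_distrib)
  show "(0 :: 'a witt) \<noteq> 1" by transfer (auto simp: wone_def fun_eq_iff)
qed

end

instance witt :: (idom_prime_char) idom
proof
  fix x y :: "'a witt"
  assume "x \<noteq> 0" "y \<noteq> 0"
  then show "x * y \<noteq> 0"
    by transfer (simp add: wmult_nonzero)
qed

text \<open>The Frobenius \<open>F\<close>, on Witt vectors over a ring of characteristic \<open>p\<close> and on their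
  fraction field.\<close>

lift_definition witt_frob :: "'k::comm_ring_prime_char witt \<Rightarrow> 'k witt"
  is "\<lambda>x n. x n ^ CHAR('k)" .

lemma comm_ring_hom_frob: "comm_ring_hom (\<lambda>x::'k::comm_ring_prime_char. x ^ CHAR('k))"
  by unfold_locales (auto simp: freshmans_dream power_mult_distrib power_0_left)

lemma witt_frob_add: "witt_frob (x + y) = witt_frob x + witt_frob y"
  by transfer (simp add: wadd_hom[OF comm_ring_hom_frob])

lemma witt_frob_mult: "witt_frob (x * y) = witt_frob x * witt_frob y"
  by transfer (simp add: wmult_hom[OF comm_ring_hom_frob])

lemma witt_frob_eq_0_iff [simp]: "witt_frob x = 0 \<longleftrightarrow> (x :: 'k::idom_prime_char witt) = 0"
  by transfer (simp add: fun_eq_iff)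

definition fract_frob :: "'k::idom_prime_char witt fract \<Rightarrow> 'k witt fract"
  where "fract_frob q = (THE r. \<exists>x y. y \<noteq> 0 \<and> q = Fraction_Field.Fract x y
    \<and> r = Fraction_Field.Fract (witt_frob x) (witt_frob y))"

lemma fract_frob_Fract:
  assumes "y \<noteq> 0"
  shows "fract_frob (Fraction_Field.Fract x y) = Fraction_Field.Fract (witt_frob x) (witt_frob y)"
  unfolding fract_frob_def
proof (rule the_equality)
  fix r
  assume "\<exists>u v. v \<noteq> 0 \<and> Fraction_Field.Fract x y = Fraction_Field.Fract u v
    \<and> r = Fraction_Field.Fract (witt_frob u) (witt_frob v)"
  then obtain u v where "v \<noteq> 0" "x * v = u * y"
    and r: "r = Fraction_Field.Fract (witt_frob u) (witt_frob v)"
    using assms by (auto simp: eq_fract)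
  then show "r = Fraction_Field.Fract (witt_frob x) (witt_frob y)"
    using assms by (simp add: eq_fract flip: witt_frob_mult)
qed (use assms in blast)


instance alg_closure :: (field_prime_char) field_prime_char
  by (rule field_prime_charI') simp

section \<open>The ring \<open>W\<close>, its fraction field \<open>K\<close>, and \<open>p\<close>-adic integers\<close>

text \<open>Everything below lives in the fraction field \<open>K\<close> of \<open>W = W(\<F>\<^sub>p-bar)\<close>, where \<open>p = CARD('p)\<close>.\<close>

type_synonym 'p W = "'p mod_ring alg_closure witt"
type_synonym 'p K = "'p W fract"

text \<open>\<open>p ^ n W\<close> as a subset of \<open>K\<close>; in particular \<open>pow_ideal 0\<close> is \<open>W\<close> itself.\<close>

definition pow_ideal :: "nat \<Rightarrow> 'p::prime_card K set"
  where "pow_ideal n = range (\<lambda>w :: 'p W. of_nat CARD('p) ^ n * to_fract w)"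

text \<open>\<open>\<int>\<^sub>p\<close> is the \<open>p\<close>-adic closure of \<open>\<int>\<close> in \<open>W\<close>.\<close>

definition Zp :: "'p::prime_card K set"
  where "Zp = {x \<in> pow_ideal 0. \<forall>n. \<exists>j::int. x - of_int j \<in> pow_ideal n}"

text \<open>The \<open>p\<close>-adic limit of \<open>f n\<close> as the natural number \<open>n\<close> tends \<open>p\<close>-adically to \<open>z \<in> \<int>\<^sub>p\<close>.\<close>

definition padic_lim :: "(nat \<Rightarrow> 'p::prime_card K) \<Rightarrow> 'p K \<Rightarrow> 'p K"
  where "padic_lim f z = (THE L. \<forall>m. \<exists>r. \<forall>n. of_nat n - z \<in> pow_ideal r \<longrightarrow> f n - L \<in> pow_ideal m)"

text \<open>\<open>c ^ z\<close> for \<open>c \<in> 1 + p W\<close> and \<open>z \<in> \<int>\<^sub>p\<close>, by continuity of \<open>n \<mapsto> c ^ n\<close>.\<close>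

definition padic_power :: "'p::prime_card K \<Rightarrow> 'p K \<Rightarrow> 'p K"
  where "padic_power c z = padic_lim (\<lambda>n. c ^ n) z"

definition morita_Gamma :: "'p::prime_card K \<Rightarrow> 'p K"
  where "morita_Gamma z =
    padic_lim (\<lambda>n. (-1) ^ n * of_nat (\<Prod>i | 0 < i \<and> i < n \<and> \<not> CARD('p) dvd i. i)) z"

definition padic_Beta :: "'p::prime_card K \<Rightarrow> 'p K \<Rightarrow> 'p K"
  where "padic_Beta x y = morita_Gamma x * morita_Gamma y / morita_Gamma (x + y)"

text \<open>The digits \<open>[\<alpha>]\<^sub>i\<close> in \<open>\<alpha> = - [\<alpha>]\<^sub>0 - [\<alpha>]\<^sub>1 p - [\<alpha>]\<^sub>2 p\<^sup>2 - \<dots>\<close>.\<close>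

definition neg_digit :: "'p::prime_card K \<Rightarrow> nat \<Rightarrow> nat"
  where "neg_digit \<alpha> = (THE d. (\<forall>i. d i < CARD('p)) \<and>
    (\<forall>m. \<alpha> + (\<Sum>i<m. of_nat (d i) * of_nat CARD('p) ^ i) \<in> pow_ideal m))"

definition neg_residue :: "'p::prime_card K \<Rightarrow> nat"
  where "neg_residue \<alpha> = (THE l. l < CARD('p) \<and> \<alpha> + of_nat l \<in> pow_ideal 1)"

definition dwork_prime :: "'p::prime_card K \<Rightarrow> 'p K"
  where "dwork_prime \<alpha> = (\<alpha> + of_nat (neg_residue \<alpha>)) / of_nat CARD('p)"

section \<open>Hypergeometric series of logarithmic type\<close>

definition hypergeom :: "'p::prime_card K \<Rightarrow> 'p K \<Rightarrow> 'p K \<Rightarrow> 'p K fps"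
  where "hypergeom \<alpha> \<beta> \<gamma> =
    Abs_fps (\<lambda>n. pochhammer \<alpha> n * pochhammer \<beta> n / (pochhammer 1 n * pochhammer \<gamma> n))"

text \<open>The \<open>p\<close>-th Frobenius \<open>\<sigma>\<close> with \<open>\<sigma>(t) = c t\<^sup>p\<close>, extended coefficientwise to series over \<open>K\<close>.\<close>

definition sigma :: "'p::prime_card K \<Rightarrow> 'p K fps \<Rightarrow> 'p K fps"
  where "sigma c f = Abs_fps (\<lambda>k. if CARD('p) dvd k
    then fract_frob (fps_nth f (k div CARD('p))) * c ^ (k div CARD('p)) else 0)"

text \<open>For \<open>a' = dwork_prime a\<close> and \<open>l = neg_residue a\<close> we have \<open>p a' = a + l\<close>, hence
  \<open>[t\<^sup>a\<^sup>' f]\<^sup>\<sigma> = c\<^sup>a\<^sup>' t\<^sup>a\<^sup>+\<^sup>l f\<^sup>\<sigma>\<close>. The series below is \<open>t\<^sup>-\<^sup>a [t\<^sup>a\<^sup>' f]\<^sup>\<sigma>\<close>.\<close>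

definition sigma_twist :: "'p::prime_card K \<Rightarrow> 'p K \<Rightarrow> 'p K fps \<Rightarrow> 'p K fps"
  where "sigma_twist c a f =
    fps_const (padic_power c (dwork_prime a)) * fps_X ^ neg_residue a * sigma c f"

text \<open>\<open>t\<^sup>-\<^sup>a \<integral>\<^sub>0\<^sup>t t\<^sup>a H(t) dt/t\<close>, where \<open>\<integral>\<^sub>0\<^sup>t t\<^sup>\<alpha> dt/t = t\<^sup>\<alpha>/\<alpha>\<close>.\<close>

definition twisted_integral :: "'p::prime_card K \<Rightarrow> 'p K fps \<Rightarrow> 'p K fps"
  where "twisted_integral a H = Abs_fps (\<lambda>k. fps_nth H k / (of_nat k + a))"

definition G_hat :: "'p::prime_card K \<Rightarrow> 'p K \<Rightarrow> 'p K fps"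
  where "G_hat c a = twisted_integral a (hypergeom a a (2 * a)
    - fps_const ((-1) ^ neg_residue a * inverse (padic_Beta a a))
      * sigma_twist c a (hypergeom (dwork_prime a) (dwork_prime a) (dwork_prime (2 * a))))"

definition F_hat :: "'p::prime_card K \<Rightarrow> 'p K \<Rightarrow> 'p K fps"
  where "F_hat c a = G_hat c a / hypergeom a a (2 * a)"

text \<open>Congruence modulo \<open>p ^ n W[[t]]\<close>.\<close>

definition fps_pcong :: "nat \<Rightarrow> 'p::prime_card K fps \<Rightarrow> 'p K fps \<Rightarrow> bool"
  where "fps_pcong n f g \<longleftrightarrow> (\<forall>k. fps_nth (f - g) k \<in> pow_ideal n)"

end

theory Submission
  imports Defs "HOL-Number_Theory.Residues"
begin

text \<open>
  Let \<open>A\<close> and \<open>B\<close> be the coefficient sequences of \<open>F = F\<^bsub>a,a;2a\<^esub>\<close> and of the logarithmic companion \<open>G\<close>.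
  Since \<open>F\<close> and its truncation have coefficients in \<open>W\<close> and constant term 1, they are invertible over
  \<open>W\<close>, and the claim says that the alternating bilinear expression
  \<open>bracket N f g = [f]\<^bsub><N\<^esub> g - f [g]\<^bsub><N\<^esub>\<close> vanishes modulo \<open>p ^ n\<close> at \<open>f = F\<close>, \<open>g = G\<close>, \<open>N = p ^ n\<close>.

  Brackets are computed by induction on \<open>n\<close>, after sorting indices modulo \<open>p\<close>: the bracket for
  \<open>p ^ (n + 1)\<close> is assembled from the brackets for \<open>p ^ n\<close> of the subsequences \<open>i \<mapsto> Z (\<rho> + p i)\<close>
  (\<open>bracket_parts\<close>). Suppose each of these subsequences has the form \<open>\<kappa> A' + p Z'\<close>, where \<open>A'\<close> is
  the coefficient sequence for the Dwork prime \<open>a'\<close> and \<open>Z'\<close> is a sequence of the same kind as \<open>Z\<close>,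
  one Dwork step later. As the bracket of \<open>A'\<close> with itself is 0, every remaining term carries a
  factor \<open>p\<close>, and one more power of \<open>p\<close> is gained at each step (\<open>bracket_congruence\<close>). What makes this
  work is the choice of a class of sequences that is stable under the splitting:
  \<open>Z i = A i * \<xi> i / (2 a + i)\<close> with \<open>\<xi>\<close> 1-Lipschitz for the \<open>p\<close>-adic metric. Indeed
  \<open>A (\<rho> + p i) / A' i\<close> is a unit that varies slowly with \<open>i\<close>, times a factor that is 1 for
  \<open>\<rho> \<le> [a]\<^sub>0\<close>, is \<open>(p (a' + i))\<^sup>2\<close> for \<open>[a]\<^sub>0 < \<rho> \<le> 2 [a]\<^sub>0\<close>, and is \<open>p (a' + i)\<^sup>2 / (2 a' + i)\<close> beyond
  (\<open>hyp_split\<close>); the denominator allowed in the class absorbs the one that appears here and the one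
  that arises from \<open>2 a + \<rho> + p i = p (2 a' + i)\<close> at \<open>\<rho> = 2 [a]\<^sub>0\<close> (\<open>splits_at_hyp_times\<close>).

  It remains to split \<open>B\<close>. Off the residue class \<open>l = [a]\<^sub>0\<close> one has \<open>B k = A k / (k + a)\<close> with a unit
  denominator. On it, \<open>B (l + p i) = A (l + p i) (1 - f i) / (p (a' + i))\<close>, where \<open>f\<close> is the product
  of \<open>c ^ i\<close>, the inverse of the unit \<open>A (l + p i) / A' i\<close>, and a constant. The constant is such that
  \<open>f\<close> tends to 1 at \<open>- a'\<close>: this is the reflection formula for Morita's Gamma function, proved here on
  natural numbers (\<open>Gam_reflection\<close>, \<open>unit_ratio_limit\<close>). Hence \<open>B\<close> involves a difference quotient of \<open>f\<close>,
  and one has to know that it is again Lipschitz, although its denominator may be highly divisible by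
  \<open>p\<close>. For this \<open>f\<close> is expanded in a Newton series \<open>\<Sum>\<^sub>j (i choose j) p ^ j g\<^sub>j\<close> with integral \<open>g\<^sub>j\<close>;
  such functions are called \<open>smooth\<close> below, and their difference quotients are controlled by
  \<open>smooth_secant\<close>, which uses \<open>p \<ge> 3\<close>.

  All this takes place in a field that is complete for a discrete valuation with uniformiser \<open>p\<close>
  (locale \<open>padic_field\<close>). The fraction field of \<open>W\<close> is one because the residue field is perfect, so
  that \<open>p ^ n W\<close> consists of the Witt vectors whose first \<open>n\<close> components are 0 (\<open>p_power_dvd_iff\<close>).
\<close>

section \<open>Fields complete for a valuation with uniformiser p\<close>

text \<open>The valuation is given by its ring of integers \<open>R\<close>. Everything is phrased in terms of \<open>R\<close> and
  powers of \<open>p\<close>, so that no absolute value has to be constructed. Completeness is only stated for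
  sequences that converge at a prescribed rate, which is what the applications produce.\<close>

locale padic_field =
  fixes p :: nat and R :: "'k::field set"
  assumes prime_p: "prime p"
    and p_nonzero: "of_nat p \<noteq> (0 :: 'k)"
    and one_R: "1 \<in> R"
    and diff_R: "\<And>x y. x \<in> R \<Longrightarrow> y \<in> R \<Longrightarrow> x - y \<in> R"
    and mult_R: "\<And>x y. x \<in> R \<Longrightarrow> y \<in> R \<Longrightarrow> x * y \<in> R"
    and inverse_R: "\<And>x. x \<in> R \<Longrightarrow> x / of_nat p \<notin> R \<Longrightarrow> inverse x \<in> R"
    and separated: "\<And>x. (\<And>n. x / of_nat p ^ n \<in> R) \<Longrightarrow> x = 0"
    and complete: "\<And>w. (\<And>n. (w (Suc n) - w n) / of_nat p ^ n \<in> R)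
      \<Longrightarrow> \<exists>L. \<forall>n. (w n - L) / of_nat p ^ n \<in> R"
begin

abbreviation \<pi> :: 'k where "\<pi> \<equiv> of_nat p"

text \<open>The fractional ideal \<open>p ^ n R\<close>; congruences modulo \<open>p ^ n\<close> are written \<open>x - y \<in> I n\<close>.\<close>

definition I :: "nat \<Rightarrow> 'k set" where "I n = {x. x / \<pi> ^ n \<in> R}"

lemma p_gt_1: "p > 1" using prime_p by (rule prime_gt_1_nat)
lemma p_gt_0: "p > 0" using p_gt_1 by simp

lemma zero_R: "0 \<in> R" using diff_R[OF one_R one_R] by simp
lemma uminus_R: "x \<in> R \<Longrightarrow> - x \<in> R" using diff_R[OF zero_R] by simp
lemma add_R: "x \<in> R \<Longrightarrow> y \<in> R \<Longrightarrow> x + y \<in> R"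
  using diff_R[OF _ uminus_R, of x y] by simp
lemma of_nat_R: "of_nat n \<in> R"
  by (induction n) (auto intro: zero_R one_R add_R)
lemma of_int_R: "of_int n \<in> R"
  by (cases n rule: int_cases2) (auto intro: of_nat_R uminus_R)
lemma power_R: "x \<in> R \<Longrightarrow> x ^ n \<in> R"
  by (induction n) (auto intro: one_R mult_R)
lemma prod_R: "(\<And>i. i \<in> A \<Longrightarrow> f i \<in> R) \<Longrightarrow> prod f A \<in> R"
  by (induction A rule: infinite_finite_induct) (auto intro: one_R mult_R)

lemma I_0: "I 0 = R" by (simp add: I_def)

lemma I_zero: "0 \<in> I n" by (simp add: I_def zero_R)
lemma I_uminus: "x \<in> I n \<Longrightarrow> - x \<in> I n"
  by (auto simp: I_def intro: uminus_R)
lemma I_add: "x \<in> I n \<Longrightarrow> y \<in> I n \<Longrightarrow> x + y \<in> I n"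
  by (auto simp: I_def add_divide_distrib intro: add_R)
lemma I_diff: "x \<in> I n \<Longrightarrow> y \<in> I n \<Longrightarrow> x - y \<in> I n"
  by (auto simp: I_def diff_divide_distrib intro: diff_R)
lemma I_sum: "(\<And>i. i \<in> A \<Longrightarrow> f i \<in> I n) \<Longrightarrow> sum f A \<in> I n"
  by (induction A rule: infinite_finite_induct) (auto intro: I_zero I_add)
lemma I_mult: "x \<in> I m \<Longrightarrow> y \<in> I n \<Longrightarrow> x * y \<in> I (m + n)"
  using mult_R[of "x / \<pi> ^ m" "y / \<pi> ^ n"] by (simp add: I_def power_add)
lemma I_mult_left: "x \<in> R \<Longrightarrow> y \<in> I n \<Longrightarrow> x * y \<in> I n"
  using I_mult[of x 0 y n] by (simp add: I_0)
lemma I_mult_right: "x \<in> I n \<Longrightarrow> y \<in> R \<Longrightarrow> x * y \<in> I n"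
  using I_mult[of x n y 0] by (simp add: I_0)
lemma p_power_mult_I: "\<pi> ^ m * x \<in> I (m + n) \<longleftrightarrow> x \<in> I n"
  using p_nonzero by (simp add: I_def power_add)
lemma p_mult_I: "\<pi> * x \<in> I (Suc n) \<longleftrightarrow> x \<in> I n"
  using p_power_mult_I[of 1 x n] by simp
lemma p_power_I: "\<pi> ^ n \<in> I n"
  using p_power_mult_I[of n 1 0] by (simp add: I_0 one_R)
lemma I_Suc_E:
  assumes "x \<in> I (Suc n)" obtains y where "x = \<pi> * y" "y \<in> I n"
  using that[of "x / \<pi>"] assms p_nonzero by (simp add: I_def mult.commute)
lemma I_anti_mono: "m \<le> n \<Longrightarrow> x \<in> I n \<Longrightarrow> x \<in> I m"
proof (induction n rule: dec_induct)
  case (step n)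
  from step.prems obtain y where "x = \<pi> * y" "y \<in> I n" by (rule I_Suc_E)
  then show ?case using step.IH by (auto intro: I_mult_left of_nat_R)
qed
lemma I_R: "x \<in> I n \<Longrightarrow> x \<in> R"
  using I_anti_mono[of 0 n x] by (simp add: I_0)

lemma I_sym: "x - y \<in> I n \<Longrightarrow> y - x \<in> I n"
  using I_uminus[of "x - y"] by simp
lemma I_trans: "x - y \<in> I n \<Longrightarrow> y - z \<in> I n \<Longrightarrow> x - z \<in> I n"
  using I_add[of "x - y" n "y - z"] by simp
lemma cong_mult_I:
  assumes "x - y \<in> I n" "x' - y' \<in> I n" "x' \<in> R" "y \<in> R"
  shows "x * x' - y * y' \<in> I n"
proof -
  have "x * x' - y * y' = (x - y) * x' + y * (x' - y')" by (simp add: algebra_simps)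
  then show ?thesis using assms by (simp add: I_add I_mult_left I_mult_right)
qed

lemma eqI_cong: "(\<And>n. x - y \<in> I n) \<Longrightarrow> x = y"
  using separated[of "x - y"] by (simp add: I_def)

lemma one_notin_I1: "1 \<notin> I (Suc 0)"
proof
  assume 1: "1 \<in> I (Suc 0)"
  have "1 \<in> I n" for n
  proof (induction n)
    case (Suc n)
    then show ?case using I_mult[OF 1 Suc] by simp
  qed (simp add: I_0 one_R)
  then show False using eqI_cong[of 1 0] by simp
qed

definition unit :: "'k \<Rightarrow> bool" where "unit x \<longleftrightarrow> x \<in> R \<and> x \<notin> I 1"

lemma unit_R: "unit x \<Longrightarrow> x \<in> R" by (simp add: unit_def)
lemma unit_nonzero: "unit x \<Longrightarrow> x \<noteq> 0" using I_zero by (auto simp: unit_def)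
lemma unit_inverse_R: "unit x \<Longrightarrow> inverse x \<in> R"
  using inverse_R[of x] by (auto simp: unit_def I_def)
lemma unit_iff: "unit x \<longleftrightarrow> x \<in> R \<and> inverse x \<in> R \<and> x \<noteq> 0"
proof
  assume *: "x \<in> R \<and> inverse x \<in> R \<and> x \<noteq> 0"
  then have "x \<notin> I 1" using I_mult_right[of x 1 "inverse x"] one_notin_I1 by auto
  with * show "unit x" by (simp add: unit_def)
qed (auto simp: unit_R unit_inverse_R unit_nonzero)
lemma unit_1: "unit 1" by (simp add: unit_iff one_R)
lemma unit_mult: "unit x \<Longrightarrow> unit y \<Longrightarrow> unit (x * y)" by (simp add: unit_iff mult_R)
lemma unit_inverse: "unit x \<Longrightarrow> unit (inverse x)" by (simp add: unit_iff)
lemma unit_divide: "unit x \<Longrightarrow> unit y \<Longrightarrow> unit (x / y)"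
  by (simp add: divide_inverse unit_mult unit_inverse)
lemma unit_uminus: "unit x \<Longrightarrow> unit (- x)"
  using I_uminus[of "- x"] by (auto simp: unit_def intro: uminus_R)
lemma unit_power: "unit x \<Longrightarrow> unit (x ^ n)"
  by (induction n) (auto intro: unit_1 unit_mult)
lemma unit_prod: "(\<And>i. i \<in> A \<Longrightarrow> unit (f i)) \<Longrightarrow> unit (prod f A)"
  by (induction A rule: infinite_finite_induct) (auto intro: unit_1 unit_mult)
lemma unit_cong: "unit x \<Longrightarrow> x - y \<in> I (Suc n) \<Longrightarrow> unit y"
proof -
  assume x: "unit x" and xy: "x - y \<in> I (Suc n)"
  have d: "x - y \<in> I 1" using I_anti_mono[OF _ xy] by simp
  have "y \<in> R" using diff_R[OF unit_R[OF x] I_R[OF d]] by simp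
  moreover have "y \<notin> I 1" using I_add[OF d, of y] x by (auto simp: unit_def)
  ultimately show "unit y" by (simp add: unit_def)
qed
lemma unit_mult_I: "unit u \<Longrightarrow> u * x \<in> I n \<longleftrightarrow> x \<in> I n"
  using I_mult_left[of u x n] I_mult_left[of "inverse u" "u * x" n]
  by (auto simp: unit_iff mult.assoc[symmetric])
lemma divide_unit_I: "unit u \<Longrightarrow> x \<in> I n \<Longrightarrow> x / u \<in> I n"
  by (simp add: divide_inverse I_mult_right unit_inverse_R)
lemma divide_unit_R: "unit u \<Longrightarrow> x \<in> R \<Longrightarrow> x / u \<in> R"
  using divide_unit_I[of u x 0] by (simp add: I_0)

lemma cong_divide_I:
  assumes "x - y \<in> I n" "x' - y' \<in> I n" "unit x'" "unit y'" "y \<in> R"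
  shows "x / x' - y / y' \<in> I n"
proof -
  have "x / x' - y / y' = ((x - y) * y' - y * (x' - y')) / (x' * y')"
    using assms(3,4)[THEN unit_nonzero] by (simp add: field_simps)
  then show ?thesis using assms
    by (simp add: divide_unit_I unit_mult I_diff I_mult_left I_mult_right unit_R)
qed

lemma of_int_in_I1: "of_int j \<in> I 1 \<longleftrightarrow> int p dvd j"
proof
  assume j: "of_int j \<in> I 1"
  show "int p dvd j"
  proof (rule ccontr)
    assume "\<not> int p dvd j"
    then have "coprime (int p) j"
      using prime_p by (simp add: prime_imp_coprime)
    then obtain u v where "u * int p + v * j = 1"
      using bezout_int[of "int p" j] by auto
    then have "of_int (u * int p + v * j) = (1 :: 'k)" by simp
    then have eq: "of_int u * \<pi> + of_int v * of_int j = 1" by simp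
    have "\<pi> \<in> I 1" using p_power_I[of 1] by simp
    then have "of_int u * \<pi> + of_int v * of_int j \<in> I 1"
      using j by (auto intro!: I_add I_mult_left of_int_R)
    then show False using one_notin_I1 by (simp add: eq)
  qed
next
  assume "int p dvd j"
  then obtain q where "j = int p * q" ..
  then show "of_int j \<in> I 1" using p_power_I[of 1] by (auto intro!: I_mult_right of_int_R)
qed

text \<open>Rational integers meet \<open>p ^ n R\<close> in \<open>p ^ n \<int>\<close>, because an integer prime to \<open>p\<close> is a unit by
  Bezout. In particular the field has characteristic 0 (\<open>of_nat_nonzero\<close> below).\<close>

lemma of_int_I: "of_int j \<in> I n \<longleftrightarrow> int p ^ n dvd j"
proof (induction n arbitrary: j)
  case (Suc n)
  show ?case
  proof (cases "int p dvd j")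
    case True
    then obtain q where q: "j = int p * q" ..
    have "of_int j = \<pi> * of_int q" by (simp add: q)
    then show ?thesis using Suc[of q] p_mult_I[of "of_int q" n] p_gt_0 by (simp add: q)
  next
    case False
    then have "of_int j \<notin> I 1" using of_int_in_I1 by simp
    then show ?thesis using False I_anti_mono[of 1 "Suc n" "of_int j"]
      by (auto dest: dvd_mult_left)
  qed
qed (simp add: I_0 of_int_R)

lemma of_nat_I: "of_nat j \<in> I n \<longleftrightarrow> p ^ n dvd j"
  using of_int_I[of "int j" n] by (simp flip: of_nat_power)

lemma of_nat_diff_I: "of_nat i - of_nat j \<in> I n \<longleftrightarrow> [i = j] (mod p ^ n)"
  using of_int_I[of "int i - int j" n] by (simp add: cong_iff_dvd_diff flip: cong_int_iff)

lemma unit_of_nat: "unit (of_nat j) \<longleftrightarrow> \<not> p dvd j"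
  by (simp add: unit_def of_nat_R of_nat_I)

lemma of_nat_nonzero: "k > 0 \<Longrightarrow> of_nat k \<noteq> (0 :: 'k)"
proof
  assume k: "k > 0" and "of_nat k = (0 :: 'k)"
  then have "p ^ k dvd k" using of_nat_I[of k k] I_zero by simp
  then have "p ^ k \<le> k" using k by (simp add: dvd_imp_le)
  moreover have "k < p ^ k" using p_gt_1 by (intro power_gt_expt) simp
  ultimately show False by simp
qed

text \<open>Division by \<open>s\<close> costs as many powers of \<open>p\<close> as divide \<open>s\<close>.\<close>

lemma I_divide_of_nat:
  assumes "x \<in> I m" "s > 0" "multiplicity p s + n \<le> m"
  shows "x / of_nat s \<in> I n"
proof -
  define v where "v = multiplicity p s"
  obtain q where q: "s = p ^ v * q" "\<not> p dvd q"
    using multiplicity_decompose'[of s p] assms(2) prime_p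
    by (metis v_def not_prime_unit gr_implies_not0 mult.commute)
  have "x \<in> I (v + n)" using assms I_anti_mono by (auto simp: v_def)
  then have "\<pi> ^ v * (x / \<pi> ^ v) \<in> I (v + n)" using p_nonzero by simp
  then have "x / \<pi> ^ v \<in> I n" by (simp only: p_power_mult_I)
  then have "x / \<pi> ^ v / of_nat q \<in> I n"
    using q(2) by (intro divide_unit_I[of "of_nat q"]) (simp add: unit_of_nat)
  then show ?thesis by (simp add: q(1))
qed

end

section \<open>Lipschitz functions and Newton series\<close>

text \<open>The Newton series \<open>\<Sum>\<^sub>i (e choose i) w\<^sub>i\<close>, see \<open>newton_eq_sum\<close>. The recursion says that increasing
  \<open>e\<close> by 1 adds the series of the shifted coefficients; it makes re-expansion at another point
  (\<open>newton_add\<close>) immediate.\<close>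

primrec newton :: "nat \<Rightarrow> (nat \<Rightarrow> 'a::comm_ring_1) \<Rightarrow> 'a" where
  "newton 0 w = w 0"
| "newton (Suc e) w = newton e w + newton e (\<lambda>i. w (Suc i))"

lemma newton_eq_sum: "newton e w = (\<Sum>i\<le>e. of_nat (e choose i) * w i)"
proof (induction e arbitrary: w)
  case (Suc e)
  have "(\<Sum>i\<le>Suc e. of_nat (Suc e choose i) * w i)
      = w 0 + (\<Sum>i\<le>e. of_nat (e choose i) * w (Suc i)) + (\<Sum>i\<le>e. of_nat (e choose Suc i) * w (Suc i))"
    by (subst sum.atMost_Suc_shift) (simp add: algebra_simps sum.distrib)
  also have "w 0 + (\<Sum>i\<le>e. of_nat (e choose i) * w (Suc i)) + (\<Sum>i\<le>e. of_nat (e choose Suc i) * w (Suc i))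
      = (\<Sum>i\<le>Suc e. of_nat (e choose i) * w i) + (\<Sum>i\<le>e. of_nat (e choose i) * w (Suc i))"
    by (subst sum.atMost_Suc_shift) simp
  also have "(\<Sum>i\<le>Suc e. of_nat (e choose i) * w i) = (\<Sum>i\<le>e. of_nat (e choose i) * w i)"
    by (simp add: binomial_eq_0)
  finally show ?case by (simp add: Suc)
qed simp

lemma newton_mult: "newton e (\<lambda>i. c * w i) = c * newton e w"
  by (induction e arbitrary: w) (simp_all add: algebra_simps)

lemma newton_add: "newton (y + x) w = newton x (\<lambda>s. newton y (\<lambda>i. w (i + s)))"
proof (induction x arbitrary: w)
  case (Suc x)
  show ?case unfolding newton.simps add_Suc_right by (simp only: Suc add_Suc)
qed simp

text \<open>This bounds \<open>u\<close> by about \<open>s / 2\<close> when \<open>p ^ u\<close> divides \<open>s\<close> and \<open>p \<ge> 3\<close>.\<close>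

lemma three_power_ge: "2 * u + 1 \<le> (3::nat) ^ u"
  by (induction u) auto

context padic_field
begin

lemma newton_I: "(\<And>i. w i \<in> I n) \<Longrightarrow> newton e w \<in> I n"
  by (induction e arbitrary: w) (auto intro: I_add)

text \<open>This is \<open>(i + 1) (e + 1 choose i + 1) = (e + 1) (e choose i)\<close>: a difference of values of a Newton
  series is the difference of arguments times another Newton series.\<close>

lemma newton_absorb:
  fixes w :: "nat \<Rightarrow> 'k"
  shows "of_nat (Suc e) * newton e (\<lambda>i. w (Suc i) / of_nat (Suc i)) = newton (Suc e) w - w 0"
proof -
  have cancel: "x * c * (v / x) = c * v" if "x \<noteq> 0" for x c v :: 'k
    using that by simp
  have "of_nat (Suc e) * (of_nat (e choose i) * (w (Suc i) / of_nat (Suc i)))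
      = of_nat (Suc e choose Suc i) * w (Suc i)" for i
  proof -
    have "of_nat (Suc e) * of_nat (e choose i) = (of_nat (Suc i) * of_nat (Suc e choose Suc i) :: 'k)"
      by (simp only: of_nat_mult[symmetric] Suc_times_binomial)
    then have "of_nat (Suc e) * (of_nat (e choose i) * (w (Suc i) / of_nat (Suc i)))
        = of_nat (Suc i) * of_nat (Suc e choose Suc i) * (w (Suc i) / of_nat (Suc i))"
      by (simp only: mult.assoc[symmetric])
    also have "\<dots> = of_nat (Suc e choose Suc i) * w (Suc i)"
      by (rule cancel) (rule of_nat_nonzero, simp)
    finally show ?thesis .
  qed
  then have "of_nat (Suc e) * newton e (\<lambda>i. w (Suc i) / of_nat (Suc i))
      = (\<Sum>i\<le>e. of_nat (Suc e choose Suc i) * w (Suc i))"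
    by (simp only: newton_eq_sum sum_distrib_left)
  moreover have "newton (Suc e) w = w 0 + (\<Sum>i\<le>e. of_nat (Suc e choose Suc i) * w (Suc i))"
    unfolding newton_eq_sum by (subst sum.atMost_Suc_shift) (simp only: binomial_n_0 of_nat_1 mult_1)
  ultimately show ?thesis by (simp only: add_diff_cancel_left')
qed

text \<open>Re-expanding at \<open>y\<close> and extracting the factor \<open>x\<close> by \<open>newton_absorb\<close> leaves a series with
  coefficients \<open>w (i + s) / s\<close>, so integrality of these is enough for a Lipschitz estimate.\<close>

lemma newton_lipschitz:
  assumes w: "\<And>i s. s \<ge> 1 \<Longrightarrow> w (i + s) / of_nat s \<in> I n" and x: "p ^ r dvd x"
  shows "newton (y + x) w - newton y w \<in> I (r + n)"
proof (cases x)
  case 0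
  then show ?thesis by (simp add: I_zero)
next
  case (Suc e)
  define W where "W s = newton y (\<lambda>i. w (i + s))" for s
  have "newton (y + x) w - newton y w = newton (Suc e) W - W 0"
    unfolding newton_add Suc by (simp add: W_def[abs_def])
  also have "\<dots> = of_nat x * newton e (\<lambda>s. W (Suc s) / of_nat (Suc s))"
    unfolding newton_absorb Suc ..
  also have "\<dots> \<in> I (r + n)"
  proof (rule I_mult)
    show "of_nat x \<in> I r" using x by (simp add: of_nat_I)
    show "newton e (\<lambda>s. W (Suc s) / of_nat (Suc s)) \<in> I n"
    proof (rule newton_I)
      fix s
      have "W (Suc s) / of_nat (Suc s) = newton y (\<lambda>i. w (i + Suc s) / of_nat (Suc s))"
        using newton_mult[of y "1 / of_nat (Suc s)" "\<lambda>i. w (i + Suc s)"]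
        by (simp add: W_def)
      also have "\<dots> \<in> I n" by (rule newton_I, rule w) simp
      finally show "W (Suc s) / of_nat (Suc s) \<in> I n" .
    qed
  qed
  finally show ?thesis .
qed

text \<open>\<open>|f i - f j| \<le> p ^ (- n) |i - j|\<close> for the \<open>p\<close>-adic absolute value, and \<open>f\<close> integral. Restricting to a
  residue class, \<open>i \<mapsto> \<rho> + p * i\<close>, raises \<open>n\<close> by 1 (\<open>lip_stretch\<close>).\<close>

definition lip :: "nat \<Rightarrow> (nat \<Rightarrow> 'k) \<Rightarrow> bool"
  where "lip n f \<longleftrightarrow> (\<forall>i. f i \<in> R) \<and> (\<forall>r i j. [i = j] (mod p ^ r) \<longrightarrow> f i - f j \<in> I (r + n))"

lemma lipI:
  assumes "\<And>i. f i \<in> R" "\<And>r x y. p ^ r dvd x \<Longrightarrow> f (y + x) - f y \<in> I (r + n)"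
  shows "lip n f"
  unfolding lip_def
proof (intro conjI allI impI)
  fix r i j
  have *: "f i - f j \<in> I (r + n)" if "[i = j] (mod p ^ r)" "j \<le> i" for i j
    using assms(2)[of r "i - j" j] that by (simp add: cong_altdef_nat)
  assume "[i = j] (mod p ^ r)"
  then show "f i - f j \<in> I (r + n)"
    using *[of i j] *[of j i] I_sym[of "f j" "f i"] by (cases "j \<le> i") (auto simp: cong_sym)
qed (rule assms)

lemma lip_R: "lip n f \<Longrightarrow> f i \<in> R"
  and lip_cong: "lip n f \<Longrightarrow> [i = j] (mod p ^ r) \<Longrightarrow> f i - f j \<in> I (r + n)"
  by (auto simp: lip_def)

lemma lip_mono: "lip n f \<Longrightarrow> m \<le> n \<Longrightarrow> lip m f"
  unfolding lip_def by (meson I_anti_mono add_left_mono)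

lemma lip_const: "c \<in> R \<Longrightarrow> lip n (\<lambda>_. c)"
  by (simp add: lip_def I_zero)

lemma lip_mult: "lip n f \<Longrightarrow> lip n g \<Longrightarrow> lip n (\<lambda>i. f i * g i)"
  unfolding lip_def by (simp add: mult_R cong_mult_I)

lemma lip_divide:
  assumes "lip n f" "lip n g" "\<And>i. unit (g i)"
  shows "lip n (\<lambda>i. f i / g i)"
  using assms unfolding lip_def by (simp add: cong_divide_I divide_unit_R)

lemma lip_of_nat: "x \<in> R \<Longrightarrow> lip 0 (\<lambda>i. x + of_nat i)"
  unfolding lip_def by (auto intro!: add_R of_nat_R simp: of_nat_diff_I)

lemma lip_stretch: "lip n f \<Longrightarrow> lip (Suc n) (\<lambda>i. f (\<rho> + p * i))"
  unfolding lip_def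
proof (intro conjI allI impI; elim conjE)
  fix r i j assume f: "\<forall>r i j. [i = j] (mod p ^ r) \<longrightarrow> f i - f j \<in> I (r + n)" and "[i = j] (mod p ^ r)"
  then have "[p * i = p * j] (mod p * p ^ r)" by (simp add: cong_def mod_mult_mult1)
  then have "[\<rho> + p * i = \<rho> + p * j] (mod p ^ Suc r)" by (simp add: cong_add_lcancel_nat)
  then have "f (\<rho> + p * i) - f (\<rho> + p * j) \<in> I (Suc r + n)" using f by blast
  then show "f (\<rho> + p * i) - f (\<rho> + p * j) \<in> I (r + Suc n)" by simp
qed auto

text \<open>Constant plus \<open>p\<close> times Lipschitz: this is the shape that feeds the splitting of sequences.\<close>

lemma lip_Suc_E:
  assumes "lip (Suc n) f"
  obtains c g where "c \<in> R" "lip n g" "\<And>i. f i = c + \<pi> * g i"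
proof
  define g where "g i = (f i - f 0) / \<pi>" for i
  have eq: "\<pi> * (g i - g j) = f i - f j" for i j
    using p_nonzero by (simp add: g_def field_simps)
  show "f 0 \<in> R" using assms by (rule lip_R)
  show "f i = f 0 + \<pi> * g i" for i using p_nonzero by (simp add: g_def)
  have "g i \<in> R" for i
  proof -
    have "f i - f 0 \<in> I (Suc n)" using lip_cong[OF assms, of i 0 0] by simp
    then show ?thesis using I_anti_mono[of 1 "Suc n"] by (simp add: I_def g_def)
  qed
  moreover have "g i - g j \<in> I (r + n)" if "[i = j] (mod p ^ r)" for i j r
    using lip_cong[OF assms that] eq[of i j] p_mult_I[of "g i - g j" "r + n"] by simp
  ultimately show "lip n g" by (simp add: lip_def)
qed

text \<open>The operator \<open>\<Delta> / p\<close>. A function is smooth if all iterates of this operator keep it integral, that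
  is, if its \<open>j\<close>-th differences are divisible by \<open>p ^ j\<close>. Polynomials in \<open>p * i\<close> and the powers \<open>c ^ i\<close>
  with \<open>c\<close> congruent to 1 have this property. The bounded version \<open>smooth_upto\<close> makes the closure
  properties provable by induction on the number of differences taken.\<close>

definition fdiff :: "(nat \<Rightarrow> 'k) \<Rightarrow> nat \<Rightarrow> 'k"
  where "fdiff f i = (f (Suc i) - f i) / \<pi>"

primrec smooth_upto :: "nat \<Rightarrow> (nat \<Rightarrow> 'k) \<Rightarrow> bool" where
  "smooth_upto 0 f \<longleftrightarrow> (\<forall>i. f i \<in> R)"
| "smooth_upto (Suc k) f \<longleftrightarrow> (\<forall>i. f i \<in> R) \<and> smooth_upto k (fdiff f)"

definition smooth :: "(nat \<Rightarrow> 'k) \<Rightarrow> bool" where "smooth f \<longleftrightarrow> (\<forall>k. smooth_upto k f)"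

lemma fdiff_p: "f (Suc i) = f i + \<pi> * fdiff f i"
  using p_nonzero by (simp add: fdiff_def)

lemma smooth_upto_R: "smooth_upto k f \<Longrightarrow> f i \<in> R"
  by (cases k) auto
lemma smooth_R: "smooth f \<Longrightarrow> f i \<in> R"
  by (auto simp: smooth_def smooth_upto_R)
lemma smooth_upto_SucD: "smooth_upto (Suc k) f \<Longrightarrow> smooth_upto k f"
  by (induction k arbitrary: f) auto
lemma smooth_fdiff: "smooth f \<Longrightarrow> smooth (fdiff f)"
  unfolding smooth_def using smooth_upto.simps(2) by blast

lemma smooth_upto_shift: "smooth_upto k f \<Longrightarrow> smooth_upto k (\<lambda>i. f (i + m))"
proof (induction k arbitrary: f)
  case (Suc k)
  have "fdiff (\<lambda>i. f (i + m)) = (\<lambda>i. fdiff f (i + m))" by (auto simp: fdiff_def)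
  moreover have "smooth_upto k (\<lambda>i. fdiff f (i + m))"
    using Suc.prems by (intro Suc.IH) simp
  ultimately show ?case using Suc.prems by simp
qed simp

lemma smooth_upto_const: "c \<in> R \<Longrightarrow> smooth_upto k (\<lambda>_. c)"
proof (induction k arbitrary: c)
  case (Suc k)
  have "fdiff (\<lambda>_. c) = (\<lambda>_. 0)" by (auto simp: fdiff_def)
  then show ?case using Suc zero_R by auto
qed simp

lemma smooth_upto_add: "smooth_upto k f \<Longrightarrow> smooth_upto k g \<Longrightarrow> smooth_upto k (\<lambda>i. f i + g i)"
proof (induction k arbitrary: f g)
  case (Suc k)
  have "fdiff (\<lambda>i. f i + g i) = (\<lambda>i. fdiff f i + fdiff g i)"
    by (auto simp: fdiff_def add_divide_distrib[symmetric] algebra_simps)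
  moreover have "smooth_upto k (\<lambda>i. fdiff f i + fdiff g i)"
    using Suc.prems by (intro Suc.IH) simp_all
  ultimately show ?case using Suc.prems by (simp add: add_R)
qed (auto intro: add_R)

lemma smooth_upto_mult: "smooth_upto k f \<Longrightarrow> smooth_upto k g \<Longrightarrow> smooth_upto k (\<lambda>i. f i * g i)"
proof (induction k arbitrary: f g)
  case (Suc k)
  have eq: "fdiff (\<lambda>i. f i * g i) = (\<lambda>i. fdiff f i * g i + fdiff g i * f (i + 1))"
    using p_nonzero by (auto simp: fdiff_def field_simps)
  show ?case
    using Suc.prems smooth_upto_SucD[OF Suc.prems(1)] smooth_upto_SucD[OF Suc.prems(2)]
    unfolding smooth_upto.simps(2) eq
    by (intro conjI allI mult_R smooth_upto_add Suc.IH smooth_upto_shift) blast+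
qed (auto intro: mult_R)

lemma smooth_const: "c \<in> R \<Longrightarrow> smooth (\<lambda>_. c)"
  and smooth_add: "smooth f \<Longrightarrow> smooth g \<Longrightarrow> smooth (\<lambda>i. f i + g i)"
  and smooth_mult: "smooth f \<Longrightarrow> smooth g \<Longrightarrow> smooth (\<lambda>i. f i * g i)"
  unfolding smooth_def by (auto intro: smooth_upto_const smooth_upto_add smooth_upto_mult)

lemma smooth_linear: "x \<in> R \<Longrightarrow> smooth (\<lambda>i. x + \<pi> * of_nat i)"
  unfolding smooth_def
proof
  fix k assume x: "x \<in> R"
  have "fdiff (\<lambda>i. x + \<pi> * of_nat i) = (\<lambda>i. 1)"
    using p_nonzero by (auto simp: fdiff_def algebra_simps)
  then show "smooth_upto k (\<lambda>i. x + \<pi> * of_nat i)"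
    using x by (cases k) (auto intro!: add_R mult_R of_nat_R smooth_upto_const one_R)
qed

text \<open>The difference of \<open>1 / f\<close> at level \<open>k + 1\<close> is a product of the difference of \<open>f\<close> and of values of
  \<open>1 / f\<close> itself, to which the hypothesis at level \<open>k\<close> applies.\<close>

lemma smooth_inverse:
  assumes "smooth f" "\<And>i. unit (f i)"
  shows "smooth (\<lambda>i. inverse (f i))"
  unfolding smooth_def
proof
  fix k
  show "smooth_upto k (\<lambda>i. inverse (f i))"
  proof (induction k)
    case 0
    then show ?case using assms(2) unit_inverse_R by simp
  next
    case (Suc k)
    have eq: "fdiff (\<lambda>i. inverse (f i)) = (\<lambda>i. - 1 * (fdiff f i * (inverse (f i) * inverse (f (i + 1)))))"
      using assms(2) p_nonzero by (auto simp: fdiff_def field_simps unit_nonzero)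
    have "smooth_upto k (fdiff f)"
      using assms(1) smooth_def smooth_fdiff by blast
    then have "smooth_upto k (fdiff (\<lambda>i. inverse (f i)))"
      unfolding eq
      by (intro smooth_upto_mult Suc smooth_upto_shift[OF Suc] smooth_upto_const uminus_R one_R)
    then show ?case using assms(2) by (simp add: unit_inverse_R)
  qed
qed

text \<open>Here \<open>\<Delta> f / p = f * u\<close>, so smoothness of \<open>f\<close> up to level \<open>k\<close> gives level \<open>k + 1\<close>. The powers
  \<open>c ^ i\<close> and the quotients of Pochhammer products below are recognised as smooth in this way.\<close>

lemma smooth_recursion:
  assumes f: "\<And>i. f i \<in> R" "\<And>i. f (Suc i) = f i * (1 + \<pi> * u i)" and u: "smooth u"
  shows "smooth f"
  unfolding smooth_def
proof
  fix k
  have eq: "fdiff f = (\<lambda>i. f i * u i)"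
    using p_nonzero by (auto simp: fdiff_def f(2) field_simps)
  show "smooth_upto k f"
  proof (induction k)
    case (Suc k)
    moreover have "smooth_upto k u" using u by (simp add: smooth_def)
    ultimately show ?case using f(1) by (simp add: eq smooth_upto_mult)
  qed (simp add: f)
qed

lemma smooth_newton:
  "f (M + e) = newton e (\<lambda>i. \<pi> ^ i * (fdiff ^^ i) f M)"
proof (induction e arbitrary: f)
  case (Suc e)
  have "f (M + Suc e) = f (M + e) + \<pi> * fdiff f (M + e)" by (simp add: fdiff_p)
  also have "\<dots> = newton e (\<lambda>i. \<pi> ^ i * (fdiff ^^ i) f M)
      + \<pi> * newton e (\<lambda>i. \<pi> ^ i * (fdiff ^^ i) (fdiff f) M)"
    by (simp only: Suc[of f] Suc[of "fdiff f"])
  also have "\<pi> * newton e (\<lambda>i. \<pi> ^ i * (fdiff ^^ i) (fdiff f) M)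
      = newton e (\<lambda>i. \<pi> ^ Suc i * (fdiff ^^ Suc i) f M)"
    by (simp only: newton_mult[symmetric] funpow_Suc_right power_Suc o_apply mult.assoc)
  finally show ?case unfolding newton.simps .
qed simp

lemma smooth_funpow: "smooth f \<Longrightarrow> smooth ((fdiff ^^ i) f)"
  by (induction i) (auto intro: smooth_fdiff)

lemma smooth_term_I: "smooth f \<Longrightarrow> \<pi> ^ i * (fdiff ^^ j) f M \<in> I i"
  by (intro I_mult_right p_power_I smooth_R smooth_funpow)

lemma multiplicity_less: "s > 0 \<Longrightarrow> multiplicity p s < s"
proof -
  assume s: "s > 0"
  have "p ^ multiplicity p s \<le> s" using s by (intro dvd_imp_le multiplicity_dvd)
  moreover have "multiplicity p s < p ^ multiplicity p s" using p_gt_1 by (intro power_gt_expt) simp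
  ultimately show ?thesis by simp
qed

text \<open>Newton coefficients divisible by \<open>p ^ j\<close> beat the denominators \<open>j\<close> of \<open>newton_lipschitz\<close> with a
  factor \<open>p\<close> to spare.\<close>

lemma smooth_lip:
  assumes "smooth f" shows "lip 1 f"
proof (rule lipI)
  fix r x y assume x: "p ^ r dvd x"
  define w where "w i = \<pi> ^ i * (fdiff ^^ i) f 0" for i
  have f: "f e = newton e w" for e
    using smooth_newton[of f 0 e] by (simp add: w_def[abs_def])
  show "f (y + x) - f y \<in> I (r + 1)"
    unfolding f
  proof (rule newton_lipschitz[OF _ x])
    fix i s :: nat assume s: "s \<ge> 1"
    have le: "multiplicity p s + 1 \<le> i + s" using multiplicity_less[of s] s by simp
    show "w (i + s) / of_nat s \<in> I 1"
      using I_divide_of_nat[OF smooth_term_I[OF assms] _ le] s by (simp add: w_def)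
  qed
qed (rule smooth_R[OF assms])

end

locale odd_padic_field = padic_field p R for p :: nat and R :: "'k::field set" +
  assumes p_gt_2: "p > 2"
begin

lemma multiplicity_bound: "s > 0 \<Longrightarrow> 2 * multiplicity p s + 1 \<le> s"
proof -
  assume s: "s > 0"
  have "p ^ multiplicity p s \<le> s" using s by (intro dvd_imp_le multiplicity_dvd)
  moreover have "3 ^ multiplicity p s \<le> p ^ multiplicity p s"
    using p_gt_2 by (intro power_mono) auto
  ultimately show ?thesis using three_power_ge[of "multiplicity p s"] by linarith
qed

text \<open>Difference quotients of smooth functions satisfy the same Lipschitz estimate, uniformly in the base
  point. The quotient has Newton coefficients \<open>p ^ j g / (j + 1)\<close>, and \<open>newton_lipschitz\<close> divides by a
  further \<open>s \<le> j\<close>. Both \<open>j + 1\<close> and \<open>s\<close> can be divisible by \<open>p\<close>, but as \<open>p \<ge> 3\<close> the two valuations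
  add up to less than \<open>j\<close>.\<close>

lemma smooth_secant:
  assumes f: "smooth f"
  shows "lip 1 (\<lambda>e. (f (M + Suc e) - f M) / (\<pi> * of_nat (Suc e)))"
proof -
  define w where "w i = \<pi> ^ i * (fdiff ^^ Suc i) f M / of_nat (Suc i)" for i
  have eq: "(f (M + Suc e) - f M) / (\<pi> * of_nat (Suc e)) = newton e w" for e
  proof -
    let ?v = "\<lambda>i. \<pi> ^ i * (fdiff ^^ i) f M"
    have "f (M + Suc e) - f M = newton (Suc e) ?v - ?v 0"
      by (subst smooth_newton) simp
    also have "\<dots> = of_nat (Suc e) * newton e (\<lambda>i. ?v (Suc i) / of_nat (Suc i))"
      by (rule newton_absorb[symmetric])
    also have "(\<lambda>i. ?v (Suc i) / of_nat (Suc i)) = (\<lambda>i. \<pi> * w i)"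
      by (auto simp: w_def)
    finally show ?thesis
      using p_nonzero of_nat_nonzero[of "Suc e"] by (simp add: newton_mult del: of_nat_Suc)
  qed
  show ?thesis unfolding eq
  proof (rule lipI)
    fix e
    have "w i \<in> I 0" for i
    proof -
      have "multiplicity p (Suc i) + 0 \<le> i" using multiplicity_less[of "Suc i"] by simp
      from I_divide_of_nat[OF smooth_term_I[OF f, of i "Suc i" M] _ this] show ?thesis
        unfolding w_def by (simp del: funpow.simps of_nat_Suc)
    qed
    then show "newton e w \<in> R" using newton_I[of w 0 e] by (simp add: I_0)
  next
    fix r x y assume x: "p ^ r dvd x"
    show "newton (y + x) w - newton y w \<in> I (r + 1)"
    proof (rule newton_lipschitz[OF _ x])
      fix i s :: nat assume s: "s \<ge> 1"
      let ?j = "i + s"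
      have "multiplicity p (Suc ?j * s) = multiplicity p (Suc ?j) + multiplicity p s"
        using s prime_p by (intro prime_elem_multiplicity_mult_distrib) auto
      then have "multiplicity p (Suc ?j * s) + 1 \<le> ?j"
        using multiplicity_bound[of s] multiplicity_bound[of "Suc ?j"] s by linarith
      from I_divide_of_nat[OF smooth_term_I[OF f, of ?j "Suc ?j" M] _ this]
      have "\<pi> ^ ?j * (fdiff ^^ Suc ?j) f M / of_nat (Suc ?j * s) \<in> I 1"
        using s by (simp del: funpow.simps of_nat_Suc of_nat_mult mult_Suc)
      then show "w ?j / of_nat s \<in> I 1"
        unfolding w_def of_nat_mult by (simp only: divide_divide_eq_left)
    qed
  qed
qed

end

section \<open>Products over the integers prime to p\<close>

context odd_padic_field
begin

lemma p_odd: "odd p" using prime_p p_gt_2 by (simp add: prime_odd_nat)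

lemma cong_prod_I:
  assumes "\<And>i. i \<in> A \<Longrightarrow> f i - g i \<in> I n" "\<And>i. i \<in> A \<Longrightarrow> f i \<in> R" "\<And>i. i \<in> A \<Longrightarrow> g i \<in> R"
  shows "prod f A - prod g A \<in> I n"
  using assms
proof (induction A rule: infinite_finite_induct)
  case (insert x A)
  then show ?case by (auto intro!: cong_mult_I prod_R)
qed (simp_all add: I_zero)

lemma smooth_prod: "(\<And>y. y \<in> A \<Longrightarrow> smooth (f y)) \<Longrightarrow> smooth (\<lambda>i. \<Prod>y\<in>A. f y i)"
  by (induction A rule: infinite_finite_induct) (auto intro: smooth_const one_R smooth_mult)

text \<open>Changing each factor of a product by a constant multiple of \<open>p\<close> changes the product by \<open>p\<close> times a
  smooth function.\<close>

lemma prod_smooth_linear: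
  assumes "finite A" "\<And>y. y \<in> A \<Longrightarrow> smooth (F y)" "\<And>y. y \<in> A \<Longrightarrow> c y \<in> R"
  shows "\<exists>h. smooth h \<and> (\<forall>i. (\<Prod>y\<in>A. F y i + \<pi> * c y) = (\<Prod>y\<in>A. F y i) + \<pi> * h i)"
  using assms
proof (induction A rule: finite_induct)
  case empty
  show ?case by (rule exI[of _ "\<lambda>_. 0"]) (simp add: smooth_const zero_R)
next
  case (insert y A)
  then obtain h where h: "smooth h" "\<And>i. (\<Prod>y\<in>A. F y i + \<pi> * c y) = (\<Prod>y\<in>A. F y i) + \<pi> * h i"
    by auto
  define h' where "h' i = F y i * h i + (c y * (\<Prod>y\<in>A. F y i) + (\<pi> * c y) * h i)" for i
  have "smooth h'" unfolding h'_def
    using insert.prems h(1) by (intro smooth_add smooth_mult smooth_const smooth_prod of_nat_R mult_R) auto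
  moreover have "(\<Prod>y\<in>insert y A. F y i + \<pi> * c y) = (\<Prod>y\<in>insert y A. F y i) + \<pi> * h' i" for i
    using insert.hyps by (simp add: h(2) h'_def algebra_simps)
  ultimately show ?case by blast
qed

text \<open>\<open>l\<close> is the digit \<open>[x]\<^sub>0\<close>: the index of the residue class on which \<open>x + of_nat y\<close> fails to be a unit.\<close>

definition residue :: "'k \<Rightarrow> nat \<Rightarrow> bool"
  where "residue x l \<longleftrightarrow> x \<in> R \<and> l < p \<and> x + of_nat l \<in> I 1"

lemma residue_unit:
  assumes "residue x l" "y mod p \<noteq> l"
  shows "unit (x + of_nat y)"
proof -
  have "x + of_nat y \<in> R" using assms by (auto simp: residue_def intro: add_R of_nat_R)
  moreover have "x + of_nat y \<notin> I 1"
  proof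
    assume "x + of_nat y \<in> I 1"
    then have "(x + of_nat y) - (x + of_nat l) \<in> I 1"
      using assms by (intro I_diff) (auto simp: residue_def)
    then have "of_nat y - of_nat l \<in> I 1" by simp
    then have "[y = l] (mod p)" unfolding of_nat_diff_I by simp
    then show False using assms by (simp add: cong_def residue_def)
  qed
  ultimately show ?thesis by (simp add: unit_def)
qed

text \<open>The Pochhammer product with its non-unit factors removed.\<close>

definition coprime_poch :: "'k \<Rightarrow> nat \<Rightarrow> nat \<Rightarrow> 'k"
  where "coprime_poch x l k = (\<Prod>y<k. if y mod p = l then 1 else x + of_nat y)"

lemma coprime_poch_Suc:
  "coprime_poch x l (Suc k) = coprime_poch x l k * (if k mod p = l then 1 else x + of_nat k)"
  by (simp add: coprime_poch_def)

lemma coprime_poch_unit: "residue x l \<Longrightarrow> unit (coprime_poch x l k)"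
  unfolding coprime_poch_def by (intro unit_prod) (auto simp: unit_1 residue_unit)

lemma coprime_poch_add:
  "coprime_poch x l (k + m) = coprime_poch x l k *
     (\<Prod>y<m. if (k + y) mod p = l then 1 else x + of_nat (k + y))"
  by (induction m) (simp_all add: coprime_poch_Suc coprime_poch_def)

text \<open>The factor by which \<open>coprime_poch\<close> grows from \<open>k\<close> to \<open>k + m\<close>. For \<open>m = p\<close> it runs through all nonzero
  residues once, like \<open>base_window\<close>, which is the case \<open>x = 0\<close>, \<open>k = p * i\<close>.\<close>

definition window :: "'k \<Rightarrow> nat \<Rightarrow> nat \<Rightarrow> nat \<Rightarrow> 'k"
  where "window x l m k = (\<Prod>y<m. if (k + y) mod p = l then 1 else x + of_nat (k + y))"

lemma window_unit: "residue x l \<Longrightarrow> unit (window x l m k)"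
  unfolding window_def by (intro unit_prod) (auto simp: unit_1 residue_unit simp del: of_nat_add)

definition base_window :: "nat \<Rightarrow> 'k"
  where "base_window i = (\<Prod>s<p. if s = 0 then 1 else of_nat s + \<pi> * of_nat i)"

lemma smooth_base_window: "smooth base_window"
proof -
  have "smooth (\<lambda>i. if s = 0 then 1 else of_nat s + \<pi> * of_nat i)" for s
    by (cases "s = 0") (auto intro: smooth_const one_R smooth_linear of_nat_R)
  then show ?thesis unfolding base_window_def[abs_def] by (intro smooth_prod)
qed

text \<open>Sorting the factors by their residue \<open>\<sigma> y\<close> modulo \<open>p\<close> identifies each of them with a factor of
  \<open>base_window\<close> up to a constant multiple of \<open>p\<close>.\<close>

lemma window_smooth:
  assumes x: "residue x l"
  shows "\<exists>h. smooth h \<and> (\<forall>i. window x l p (\<rho> + p * i) = base_window i + \<pi> * h i)"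
proof -
  have l: "l < p" and xR: "x \<in> R" using x by (auto simp: residue_def)
  define \<sigma> where "\<sigma> y = (\<rho> + y + (p - l)) mod p" for y
  have inj: "inj_on \<sigma> {..<p}"
  proof (rule inj_onI)
    fix y z assume yz: "y \<in> {..<p}" "z \<in> {..<p}" "\<sigma> y = \<sigma> z"
    then have "[\<rho> + y + (p - l) = \<rho> + z + (p - l)] (mod p)" by (simp add: cong_def \<sigma>_def)
    then have "[y = z] (mod p)" by (simp add: cong_add_rcancel_nat cong_add_lcancel_nat)
    then show "y = z" using yz by (simp add: cong_def)
  qed
  have "\<sigma> ` {..<p} \<subseteq> {..<p}" using p_gt_0 by (auto simp: \<sigma>_def)
  then have img: "\<sigma> ` {..<p} = {..<p}" using inj by (simp add: endo_inj_surj)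
  have s0: "\<sigma> y = 0 \<longleftrightarrow> (\<rho> + y) mod p = l" for y
  proof -
    have "\<sigma> y = 0 \<longleftrightarrow> [\<rho> + y + (p - l) = l + (p - l)] (mod p)" using l by (simp add: \<sigma>_def cong_def)
    also have "\<dots> \<longleftrightarrow> [\<rho> + y = l] (mod p)" by (rule cong_add_rcancel_nat)
    finally show ?thesis using l by (simp add: cong_def)
  qed
  define F where "F y i = (if \<sigma> y = 0 then 1 else of_nat (\<sigma> y) + \<pi> * of_nat i)" for y i
  define c where "c y = (if \<sigma> y = 0 then 0 else (x + of_nat (\<rho> + y) - of_nat (\<sigma> y)) / \<pi>)" for y
  have F: "smooth (F y)" for y
    unfolding F_def[abs_def] by (cases "\<sigma> y = 0") (auto intro: smooth_const one_R smooth_linear of_nat_R)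
  have c: "c y \<in> R" for y
  proof -
    have "of_nat (\<rho> + y + (p - l)) - of_nat (\<sigma> y) \<in> I 1"
      unfolding of_nat_diff_I by (simp add: \<sigma>_def cong_def)
    moreover have "x + of_nat l - \<pi> \<in> I 1"
      using x p_power_I[of 1] by (intro I_diff) (auto simp: residue_def)
    ultimately have "(of_nat (\<rho> + y + (p - l)) - of_nat (\<sigma> y)) + (x + of_nat l - \<pi>) \<in> I 1"
      by (rule I_add)
    then have "x + of_nat (\<rho> + y) - of_nat (\<sigma> y) \<in> I 1"
      using l by (simp add: of_nat_diff algebra_simps)
    then show ?thesis by (simp add: c_def I_def zero_R)
  qed
  have \<pi>c: "\<pi> * c y = x + of_nat (\<rho> + y) - of_nat (\<sigma> y)" if "\<sigma> y \<noteq> 0" for y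
    using p_nonzero that by (simp add: c_def)
  have W: "window x l p (\<rho> + p * i) = (\<Prod>y<p. F y i + \<pi> * c y)" for i
    unfolding window_def
  proof (rule prod.cong)
    fix y
    have "\<rho> + p * i + y = \<rho> + y + p * i" by simp
    then have m: "(\<rho> + p * i + y) mod p = (\<rho> + y) mod p" by (simp only: mod_mult_self2)
    show "(if (\<rho> + p * i + y) mod p = l then 1 else x + of_nat (\<rho> + p * i + y)) = F y i + \<pi> * c y"
      using s0[of y] \<pi>c[of y] unfolding m F_def by (cases "\<sigma> y = 0") (simp_all add: c_def algebra_simps)
  qed simp
  have "(\<Prod>y<p. F y i) = base_window i" for i
    using prod.reindex[OF inj, of "\<lambda>s. if s = 0 then 1 else of_nat s + \<pi> * of_nat i"]
    by (simp add: img base_window_def F_def)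
  then show ?thesis using prod_smooth_linear[of "{..<p}" F c] F c by (simp add: W)
qed

text \<open>Consecutive values have ratio \<open>W\<^sub>x\<^sup>2 / (W\<^sub>y W\<^sub>z)\<close>, where each window \<open>W\<close> is \<open>base_window\<close> plus \<open>p\<close> times a
  smooth function. The common part \<open>base_window\<close> cancels between the two factors above and the two
  below, and the ratio is 1 plus \<open>p\<close> times a smooth function, as \<open>smooth_recursion\<close> requires. The
  cancellation is essential: \<open>base_window\<close> by itself is constant modulo \<open>p\<close>, but its deviation
  from a constant, divided by \<open>p\<close>, need not be smooth.\<close>

lemma smooth_poch_ratio:
  assumes "residue x l" "residue y m" "residue z n"
  shows "smooth (\<lambda>i. (coprime_poch x l (\<rho> + p * i))^2
    / (coprime_poch y m (\<rho> + p * i) * coprime_poch z n (\<rho> + p * i)))" (is "smooth ?f")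
proof -
  obtain g h k where s: "smooth g" "smooth h" "smooth k"
    and w: "\<And>i. window x l p (\<rho> + p * i) = base_window i + \<pi> * g i"
      "\<And>i. window y m p (\<rho> + p * i) = base_window i + \<pi> * h i"
      "\<And>i. window z n p (\<rho> + p * i) = base_window i + \<pi> * k i"
    using window_smooth[OF assms(1)] window_smooth[OF assms(2)] window_smooth[OF assms(3)] by blast
  define Y where "Y i = window y m p (\<rho> + p * i)" for i
  define Z where "Z i = window z n p (\<rho> + p * i)" for i
  define v where "v i = base_window i * (g i + g i + (- 1 * h i + - 1 * k i))
    + \<pi> * (g i * g i + - 1 * (h i * k i))" for i
  define u where "u i = v i * (inverse (Y i) * inverse (Z i))" for i
  have units: "unit (Y i)" "unit (Z i)" "unit (coprime_poch x l i)" "unit (coprime_poch y m i)"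
      "unit (coprime_poch z n i)" for i
    unfolding Y_def Z_def using assms by (auto intro: window_unit coprime_poch_unit)
  have "smooth Y" "smooth Z"
    unfolding Y_def[abs_def] Z_def[abs_def] w
    by (intro smooth_add smooth_mult smooth_base_window smooth_const of_nat_R s)+
  then have u: "smooth u" unfolding u_def[abs_def] v_def[abs_def]
    by (intro smooth_add smooth_mult smooth_base_window smooth_const of_nat_R s smooth_inverse
        units uminus_R one_R)
  show ?thesis
  proof (rule smooth_recursion[OF _ _ u])
    fix i
    show "?f i \<in> R" by (intro unit_R unit_divide unit_mult unit_power units)
    have st: "coprime_poch x l (\<rho> + p * Suc i) = coprime_poch x l (\<rho> + p * i) * window x l p (\<rho> + p * i)"
      for x l
    proof -
      have "\<rho> + p * Suc i = \<rho> + p * i + p" by simp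
      then show ?thesis by (simp only: coprime_poch_add window_def)
    qed
    have "(window x l p (\<rho> + p * i))^2 = Y i * Z i + \<pi> * v i"
      unfolding Y_def Z_def w v_def by (simp add: algebra_simps power2_eq_square)
    then have W2: "(window x l p (\<rho> + p * i))^2 / (Y i * Z i) = 1 + \<pi> * u i"
      using units(1,2)[THEN unit_nonzero] by (simp add: u_def field_simps)
    have "?f (Suc i) = ?f i * ((window x l p (\<rho> + p * i))^2 / (Y i * Z i))"
      unfolding st Y_def[symmetric] Z_def[symmetric] by (simp add: power_mult_distrib mult_ac)
    then show "?f (Suc i) = ?f i * (1 + \<pi> * u i)" unfolding W2 .
  qed
qed

end

section \<open>Hypergeometric coefficients and the Dwork prime\<close>

definition hyp_coeff :: "'a::field \<Rightarrow> nat \<Rightarrow> 'a"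
  where "hyp_coeff a k = pochhammer a k * pochhammer a k / (pochhammer 1 k * pochhammer (2 * a) k)"

lemma hyp_coeff_0 [simp]: "hyp_coeff a 0 = 1" by (simp add: hyp_coeff_def)

context odd_padic_field
begin

text \<open>The factors \<open>x + l + p j = p (x' + j)\<close> of the Pochhammer symbol make up the one for the Dwork prime
  \<open>x'\<close>; there are \<open>i\<close> or \<open>i + 1\<close> of them according to whether the last incomplete block has passed \<open>l\<close>.\<close>

lemma pochhammer_split:
  assumes l: "l < p" and x': "x + of_nat l = \<pi> * x'" and "\<rho> \<le> p"
  shows "pochhammer x (\<rho> + p * i) = coprime_poch x l (\<rho> + p * i) *
    (\<pi> ^ (if \<rho> > l then Suc i else i) * pochhammer x' (if \<rho> > l then Suc i else i))"
proof -
  define P where "P \<rho> i \<longleftrightarrow> pochhammer x (\<rho> + p * i) = coprime_poch x l (\<rho> + p * i) *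
    (\<pi> ^ (if \<rho> > l then Suc i else i) * pochhammer x' (if \<rho> > l then Suc i else i))" for \<rho> i
  have step: "P (Suc \<rho>) i" if "P \<rho> i" "\<rho> < p" for \<rho> i
  proof -
    have m: "(\<rho> + p * i) mod p = \<rho>" using that by simp
    have poch: "pochhammer x (Suc \<rho> + p * i) = pochhammer x (\<rho> + p * i) * (x + of_nat (\<rho> + p * i))"
      by (simp add: pochhammer_Suc)
    have cop: "coprime_poch x l (Suc \<rho> + p * i)
        = coprime_poch x l (\<rho> + p * i) * (if \<rho> = l then 1 else x + of_nat (\<rho> + p * i))"
      using m by (simp add: coprime_poch_Suc)
    show ?thesis
    proof (cases "\<rho> = l")
      case True
      have "x + of_nat (\<rho> + p * i) = (x + of_nat l) + \<pi> * of_nat i" using True by simp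
      also have "\<dots> = \<pi> * (x' + of_nat i)" unfolding x' by (simp add: algebra_simps)
      finally have e: "x + of_nat (\<rho> + p * i) = \<pi> * (x' + of_nat i)" .
      show ?thesis using that(1) True unfolding P_def poch cop e by (simp add: pochhammer_Suc)
    next
      case False
      then have "(Suc \<rho> > l) = (\<rho> > l)" by auto
      then show ?thesis using that(1) False unfolding P_def poch cop by (simp only: if_False mult_ac)
    qed
  qed
  have col: "P \<rho> i" if "P 0 i" "\<rho> \<le> p" for \<rho> i
    using that(2) by (induction \<rho>) (auto intro: that(1) step)
  have "P 0 i" for i
  proof (induction i)
    case 0
    show ?case by (simp add: P_def coprime_poch_def)
  next
    case (Suc i)
    from col[OF Suc order.refl] show ?case using l by (simp add: P_def add.commute)
  qed
  then show ?thesis using col assms(3) by (simp add: P_def)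
qed

lemma residue_1: "residue 1 (p - 1)"
  using p_gt_0 p_power_I[of 1] by (auto simp: residue_def one_R of_nat_diff)

text \<open>The contribution to \<open>hyp_coeff a k\<close> of the unit factors in its Pochhammer symbols. The non-unit
  factors of \<open>k!\<close> are those with index \<open>p - 1\<close> modulo \<open>p\<close>, since the product starts at 1; the Dwork
  prime of 1 is again 1.\<close>

definition unit_ratio :: "'k \<Rightarrow> nat \<Rightarrow> nat \<Rightarrow> 'k" where
  "unit_ratio a l k = (coprime_poch a l k)^2
     / (coprime_poch 1 (p - 1) k * coprime_poch (2 * a) (2 * l) k)"

text \<open>The three cases record which of the Pochhammer symbols of \<open>a\<close> and \<open>2 a\<close> contain one more multiple
  of \<open>p\<close>. That \<open>[2a]\<^sub>0 = 2 [a]\<^sub>0\<close>, without carry, makes the symbol of \<open>a\<close> come first.\<close>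

lemma hyp_split:
  assumes l: "2 * l < p" and a': "a + of_nat l = \<pi> * a'" and \<rho>: "\<rho> < p"
  shows "hyp_coeff a (\<rho> + p * i) = unit_ratio a l (\<rho> + p * i) * hyp_coeff a' i *
    (if \<rho> \<le> l then 1 else if \<rho> \<le> 2 * l then (\<pi> * (a' + of_nat i))^2
     else \<pi> * (a' + of_nat i)^2 / (2 * a' + of_nat i))"
proof -
  have "2 * a + of_nat (2 * l) = \<pi> * (2 * a')"
    using arg_cong[OF a', of "\<lambda>x. 2 * x"] by (simp add: algebra_simps)
  note b = pochhammer_split[OF l this, of \<rho> i]
  have o1: "1 + of_nat (p - 1) = \<pi> * (1 :: 'k)" using p_gt_0 by (simp add: of_nat_diff)
  have o: "pochhammer 1 (\<rho> + p * i) = coprime_poch 1 (p - 1) (\<rho> + p * i) * (\<pi> ^ i * pochhammer 1 i)"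
  proof -
    have "\<not> p - 1 < \<rho>" "p - 1 < p" "\<rho> \<le> p" using \<rho> by auto
    with pochhammer_split[OF _ o1, of \<rho> i] show ?thesis by (simp only: if_False)
  qed
  have a: "pochhammer a (\<rho> + p * i) = coprime_poch a l (\<rho> + p * i) *
    (\<pi> ^ (if \<rho> > l then Suc i else i) * pochhammer a' (if \<rho> > l then Suc i else i))"
    by (rule pochhammer_split[OF _ a']) (use l \<rho> in auto)
  have canc: "(u * (P * (x * e))) * (u * (P * (x * e))) / ((v * (P * y)) * (w * (P * (z * d))))
      = u^2 / (v * w) * (x * x / (y * z)) * (e^2 / d)" if "P \<noteq> 0" for u P x e v y w z d :: 'k
  proof -
    have "(u * (P * (x * e))) * (u * (P * (x * e))) / ((v * (P * y)) * (w * (P * (z * d))))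
        = (P * P) * (u * u * (x * x) * (e * e)) / ((P * P) * (v * w * (y * z) * d))"
      by (simp only: mult_ac)
    also have "\<dots> = (u * u * (x * x) * (e * e)) / (v * w * (y * z) * d)"
      using that by (intro nonzero_mult_divide_mult_cancel_left) simp
    also have "\<dots> = u^2 / (v * w) * (x * x / (y * z)) * (e^2 / d)"
      by (simp add: power2_eq_square)
    finally show ?thesis .
  qed
  define P where "P = \<pi> ^ i"
  have P: "P \<noteq> 0" using p_nonzero by (simp add: P_def)
  consider "\<rho> \<le> l" | "l < \<rho>" "\<rho> \<le> 2 * l" | "2 * l < \<rho>" by linarith
  then show ?thesis
  proof cases
    case 1
    have "hyp_coeff a (\<rho> + p * i) = unit_ratio a l (\<rho> + p * i) * hyp_coeff a' i * (1^2 / 1)"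
      unfolding hyp_coeff_def a b[OF less_imp_le[OF \<rho>]] o unit_ratio_def canc[OF P, symmetric]
      using 1 by (simp add: P_def)
    then show ?thesis using 1 by simp
  next
    case 2
    have "hyp_coeff a (\<rho> + p * i) = unit_ratio a l (\<rho> + p * i) * hyp_coeff a' i * ((\<pi> * (a' + of_nat i))^2 / 1)"
      unfolding hyp_coeff_def a b[OF less_imp_le[OF \<rho>]] o unit_ratio_def canc[OF P, symmetric]
      using 2 by (simp add: P_def pochhammer_Suc mult_ac)
    then show ?thesis using 2 by simp
  next
    case 3
    have "hyp_coeff a (\<rho> + p * i) = unit_ratio a l (\<rho> + p * i) * hyp_coeff a' i
       * ((\<pi> * (a' + of_nat i))^2 / (\<pi> * (2 * a' + of_nat i)))"
      unfolding hyp_coeff_def a b[OF less_imp_le[OF \<rho>]] o unit_ratio_def canc[OF P, symmetric]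
      using 3 by (simp add: P_def pochhammer_Suc mult_ac)
    also have "(\<pi> * (a' + of_nat i))^2 / (\<pi> * (2 * a' + of_nat i)) = \<pi> * (a' + of_nat i)^2 / (2 * a' + of_nat i)"
      using p_nonzero by (simp add: power2_eq_square)
    finally show ?thesis using 3 by simp
  qed
qed

end

text \<open>\<open>al s\<close> is the \<open>s\<close>-th iterated Dwork prime of \<open>al 0\<close>, and \<open>dig\<close> is the sequence of its digits. The
  bound on the digits means that \<open>2 * al s\<close> has the digits \<open>2 * dig s\<close>.\<close>

locale digit_chain = odd_padic_field p R for p :: nat and R :: "'k::field set" +
  fixes al :: "nat \<Rightarrow> 'k" and dig :: "nat \<Rightarrow> nat"
  assumes al_R: "\<And>s. al s \<in> R"
    and al_Suc: "\<And>s. al s + of_nat (dig s) = \<pi> * al (Suc s)"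
    and dig_pos: "\<And>s. 0 < dig s"
    and dig_less: "\<And>s. 2 * dig s < p"
begin

lemma p_mult_I1: "x \<in> R \<Longrightarrow> \<pi> * x \<in> I (Suc 0)"
  using p_mult_I[of x 0] by (simp add: I_0)

lemma residue_al: "residue (al s) (dig s)"
  using al_R[of s] al_R[of "Suc s"] dig_less[of s] by (auto simp: residue_def al_Suc intro: p_mult_I1)

lemma al2_Suc: "2 * al s + of_nat (2 * dig s) = \<pi> * (2 * al (Suc s))"
  using arg_cong[OF al_Suc[of s], of "\<lambda>x. 2 * x"] by (simp add: algebra_simps)

lemma al2_R: "2 * al s \<in> R"
  using add_R[OF al_R al_R, of s s] by (simp only: mult_2)

lemma residue_al2: "residue (2 * al s) (2 * dig s)"
  using al2_R[of s] al2_R[of "Suc s"] dig_less[of s]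
  by (auto simp: residue_def al2_Suc simp del: of_nat_mult intro: p_mult_I1)

text \<open>If \<open>x\<^sub>s = - k\<close>, then \<open>d\<^sub>s\<close> is the last digit of \<open>k\<close> to base \<open>p\<close> and \<open>x\<^sub>s\<^sub>+\<^sub>1 = - (k div p)\<close>. This cannot go
  on for ever with positive digits.\<close>

lemma nonzero_descent:
  assumes "\<And>s. x s \<in> R" "\<And>s. x s + of_nat (d s) = \<pi> * x (Suc s)" "\<And>s. 0 < d s" "\<And>s. d s < p"
  shows "x s + of_nat k \<noteq> 0"
proof (induction k arbitrary: s rule: less_induct)
  case (less k)
  show ?case
  proof
    assume z: "x s + of_nat k = 0"
    have "of_nat k - of_nat (d s) = - (\<pi> * x (Suc s))"
      using z assms(2)[of s] by (simp add: algebra_simps add_eq_0_iff2)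
    then have "of_nat k - of_nat (d s) \<in> I 1" using assms(1)[of "Suc s"] by (auto intro: I_uminus p_mult_I1)
    then have "[k = d s] (mod p)" by (simp add: of_nat_diff_I)
    then have "k mod p = d s" using assms(4)[of s] by (simp add: cong_def)
    then have k: "k = d s + p * (k div p)" by (metis mult_div_mod_eq add.commute)
    then have "k div p < k" using assms(3)[of s] p_gt_1 by (intro div_less_dividend) auto
    have "of_nat k = of_nat (d s) + \<pi> * of_nat (k div p)"
      using arg_cong[OF k, of "of_nat :: nat \<Rightarrow> 'k"] by (simp only: of_nat_add of_nat_mult)
    then have "x s + of_nat k = (x s + of_nat (d s)) + \<pi> * of_nat (k div p)" by simp
    also have "\<dots> = \<pi> * (x (Suc s) + of_nat (k div p))"
      unfolding assms(2) by (simp add: distrib_left)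
    finally have "x s + of_nat k = \<pi> * (x (Suc s) + of_nat (k div p))" .
    then show False using z p_nonzero less[OF \<open>k div p < k\<close>, of "Suc s"] by simp
  qed
qed

lemma al_nonzero: "al s + of_nat k \<noteq> 0"
proof (rule nonzero_descent[of al dig])
  show "dig s < p" for s using dig_less[of s] by simp
qed (rule al_R al_Suc dig_pos)+

lemma al2_nonzero: "2 * al s + of_nat k \<noteq> 0"
  by (rule nonzero_descent[of "\<lambda>s. 2 * al s" "\<lambda>s. 2 * dig s"]) (use al2_R al2_Suc dig_pos dig_less in auto)

lemma al_approx: "\<exists>M. al s + of_nat M \<in> I n"
proof (induction n arbitrary: s)
  case 0
  show ?case using al_R[of s] by (auto simp: I_0 intro: add_R of_nat_R)
next
  case (Suc n)
  obtain M where M: "al (Suc s) + of_nat M \<in> I n" using Suc by blast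
  have "al s + of_nat (dig s + p * M) = (al s + of_nat (dig s)) + \<pi> * of_nat M" by simp
  also have "\<dots> = \<pi> * (al (Suc s) + of_nat M)" unfolding al_Suc by (simp add: distrib_left)
  finally have "al s + of_nat (dig s + p * M) = \<pi> * (al (Suc s) + of_nat M)" .
  then have "al s + of_nat (dig s + p * M) \<in> I (Suc n)" using M by (simp only: p_mult_I)
  then show ?case by blast
qed

abbreviation A :: "nat \<Rightarrow> nat \<Rightarrow> 'k" where "A s \<equiv> hyp_coeff (al s)"
abbreviation \<gamma> :: "nat \<Rightarrow> nat \<Rightarrow> 'k" where "\<gamma> s \<equiv> unit_ratio (al s) (dig s)"

lemma smooth_\<gamma>: "smooth (\<lambda>i. \<gamma> s (\<rho> + p * i))"
  unfolding unit_ratio_def by (rule smooth_poch_ratio[OF residue_al residue_1 residue_al2])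

lemma unit_\<gamma>: "unit (\<gamma> s k)"
  unfolding unit_ratio_def
  by (intro unit_divide unit_mult unit_power coprime_poch_unit residue_al residue_1 residue_al2)

section \<open>Sequences that split modulo p\<close>

text \<open>The denominator \<open>2 * al s + i\<close> is what makes the class stable under splitting, see
  \<open>splits_at_hyp_times\<close>. It does no harm: although it can be highly divisible by \<open>p\<close>, admissible
  sequences are integral (\<open>admissible_R\<close>).\<close>

definition admissible :: "nat \<Rightarrow> (nat \<Rightarrow> 'k) \<Rightarrow> bool" where
  "admissible s Z \<longleftrightarrow> (\<exists>\<xi>. lip 0 \<xi> \<and> (\<forall>i. Z i = A s i * \<xi> i / (2 * al s + of_nat i)))"

text \<open>The multiple \<open>\<kappa>\<close> of \<open>A (Suc s)\<close> is kept apart because its bracket with itself vanishes; everything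
  else carries a factor \<open>p\<close>.\<close>

definition splits_at :: "nat \<Rightarrow> nat \<Rightarrow> (nat \<Rightarrow> 'k) \<Rightarrow> bool" where
  "splits_at s \<rho> Z \<longleftrightarrow> (\<exists>\<kappa> Z'. \<kappa> \<in> R \<and> admissible (Suc s) Z' \<and>
     (\<forall>i. Z (\<rho> + p * i) = \<kappa> * A (Suc s) i + \<pi> * Z' i))"

text \<open>The heart of the induction. With \<open>v = a' + i\<close>, \<open>w = 2 a' + i\<close> and \<open>d = 2 a + \<rho> + p i\<close>, the values of
  \<open>hyp_split\<close> leave: for \<open>\<rho> \<le> l\<close> a quotient by the unit \<open>d\<close>, whose constant term gives \<open>\<kappa>\<close>; in all other
  cases \<open>\<kappa> = 0\<close>, and the explicit powers of \<open>p\<close> leave at least one of them after dividing by \<open>d\<close>,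
  which is \<open>p w\<close> at \<open>\<rho> = 2 l\<close> and a unit otherwise. The only denominator that survives is \<open>w\<close>.\<close>

lemma splits_at_hyp_times:
  assumes \<rho>: "\<rho> < p" and \<psi>: "lip 1 \<psi>"
    and Z: "\<And>i. Z (\<rho> + p * i) = A s (\<rho> + p * i) * \<psi> i / (2 * al s + of_nat (\<rho> + p * i))"
  shows "splits_at s \<rho> Z"
proof -
  define v where "v i = al (Suc s) + of_nat i" for i
  define w where "w i = 2 * al (Suc s) + of_nat i" for i
  define g where "g i = \<gamma> s (\<rho> + p * i)" for i
  define d where "d i = 2 * al s + of_nat (\<rho> + p * i)" for i
  have w0: "w i \<noteq> 0" for i unfolding w_def by (rule al2_nonzero)
  have lv: "lip 0 v" and lw: "lip 0 w" unfolding v_def[abs_def] w_def[abs_def]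
    by (intro lip_of_nat al_R al2_R)+
  have lg: "lip 1 g" unfolding g_def[abs_def] by (rule smooth_lip[OF smooth_\<gamma>])
  have l0: "lip 0 f" if "lip 1 f" for f using lip_mono[OF that] by simp
  have lp: "lip n (\<lambda>_. \<pi>)" for n by (intro lip_const of_nat_R)
  have ld: "lip 1 d"
  proof -
    have "d = (\<lambda>i. (2 * al s + of_nat \<rho>) + \<pi> * of_nat i)" by (auto simp: d_def algebra_simps)
    then show ?thesis by (simp only:) (intro smooth_lip smooth_linear add_R al2_R of_nat_R)
  qed
  have dunit: "unit (d i)" if "\<rho> \<noteq> 2 * dig s" for i
    unfolding d_def by (rule residue_unit[OF residue_al2]) (use that \<rho> in simp)
  have split: "A s (\<rho> + p * i) = g i * A (Suc s) i * (if \<rho> \<le> dig s then 1 else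
      if \<rho> \<le> 2 * dig s then (\<pi> * v i)^2 else \<pi> * (v i)^2 / w i)" for i
    unfolding g_def v_def w_def by (rule hyp_split[OF dig_less al_Suc \<rho>])
  have adm: "admissible (Suc s) (\<lambda>i. A (Suc s) i * \<xi> i / w i)" if "lip 0 \<xi>" for \<xi>
    using that unfolding admissible_def w_def by blast
  have zero: "splits_at s \<rho> Z" if "lip 0 \<xi>" "\<And>i. Z (\<rho> + p * i) = \<pi> * (A (Suc s) i * \<xi> i / w i)" for \<xi>
    unfolding splits_at_def
    by (rule exI[of _ 0], rule exI[of _ "\<lambda>i. A (Suc s) i * \<xi> i / w i"]) (use adm[OF that(1)] that(2) zero_R in auto)
  consider "\<rho> \<le> dig s" | "dig s < \<rho>" "\<rho> < 2 * dig s" | "\<rho> = 2 * dig s" | "2 * dig s < \<rho>" by linarith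
  then show ?thesis
  proof cases
    case 1
    then have ne: "\<rho> \<noteq> 2 * dig s" using dig_pos[of s] by linarith
    have "lip 1 (\<lambda>i. g i * \<psi> i / d i)" by (intro lip_divide lip_mult lg \<psi> ld dunit ne)
    then have "lip (Suc 0) (\<lambda>i. g i * \<psi> i / d i)" by simp
    then obtain c h where c: "c \<in> R" "lip 0 h" "\<And>i. g i * \<psi> i / d i = c + \<pi> * h i"
      by (rule lip_Suc_E) blast
    have "Z (\<rho> + p * i) = A (Suc s) i * (g i * \<psi> i / d i)" for i
      unfolding Z split d_def[symmetric] using 1 by (simp add: mult_ac)
    then have "Z (\<rho> + p * i) = c * A (Suc s) i + \<pi> * (A (Suc s) i * (h i * w i) / w i)" for i
      unfolding c(3) using w0[of i] by (simp add: algebra_simps)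
    moreover have "admissible (Suc s) (\<lambda>i. A (Suc s) i * (h i * w i) / w i)"
      by (intro adm lip_mult c lw)
    ultimately show ?thesis unfolding splits_at_def using c(1)
      by (intro exI[of _ c] exI[of _ "\<lambda>i. A (Suc s) i * (h i * w i) / w i"]) auto
  next
    case 2
    then have ne: "\<rho> \<noteq> 2 * dig s" by simp
    show ?thesis
    proof (rule zero)
      show "lip 0 (\<lambda>i. \<pi> * (g i * (v i * v i) * (\<psi> i / d i)) * w i)"
        by (intro lip_divide lip_mult lp l0[OF lg] l0[OF \<psi>] l0[OF ld] lv lw dunit ne)
      show "Z (\<rho> + p * i) = \<pi> * (A (Suc s) i * (\<pi> * (g i * (v i * v i) * (\<psi> i / d i)) * w i) / w i)" for i
        unfolding Z split d_def[symmetric] using 2 w0[of i] by (simp add: power2_eq_square mult_ac)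
    qed
  next
    case 3
    have d: "d i = \<pi> * w i" for i
    proof -
      have "d i = (2 * al s + of_nat (2 * dig s)) + \<pi> * of_nat i" using 3 by (simp add: d_def)
      then show ?thesis unfolding al2_Suc by (simp add: w_def distrib_left)
    qed
    show ?thesis
    proof (rule zero)
      show "lip 0 (\<lambda>i. g i * (v i * v i) * \<psi> i)"
        by (intro lip_mult l0[OF lg] l0[OF \<psi>] lv)
      show "Z (\<rho> + p * i) = \<pi> * (A (Suc s) i * (g i * (v i * v i) * \<psi> i) / w i)" for i
        unfolding Z split d_def[symmetric] d
        using 3 dig_pos[of s] w0[of i] p_nonzero by (simp add: power2_eq_square mult_ac)
    qed
  next
    case 4
    then have ne: "\<rho> \<noteq> 2 * dig s" by simp
    show ?thesis
    proof (rule zero)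
      show "lip 0 (\<lambda>i. g i * (v i * v i) * (\<psi> i / d i))"
        by (intro lip_divide lip_mult lp l0[OF lg] l0[OF \<psi>] l0[OF ld] lv lw dunit ne)
      show "Z (\<rho> + p * i) = \<pi> * (A (Suc s) i * (g i * (v i * v i) * (\<psi> i / d i)) / w i)" for i
        unfolding Z split d_def[symmetric] using 4 by (simp add: power2_eq_square mult_ac)
    qed
  qed
qed

lemma admissible_splits: "admissible s Z \<Longrightarrow> \<rho> < p \<Longrightarrow> splits_at s \<rho> Z"
  unfolding admissible_def
  by (auto intro!: splits_at_hyp_times lip_stretch[of 0, simplified] simp del: of_nat_add)

lemma admissible_hyp: "admissible s (A s)"
  unfolding admissible_def
  by (rule exI[of _ "\<lambda>i. 2 * al s + of_nat i"]) (use al2_nonzero al2_R lip_of_nat in auto)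

text \<open>Splitting reduces the value at \<open>k\<close> to values at \<open>k div p\<close>. At \<open>k = 0\<close> the denominator \<open>2 * al s\<close> is a
  unit, since its digit is nonzero.\<close>

lemma admissible_R: "admissible s Z \<Longrightarrow> Z k \<in> R"
proof (induction k arbitrary: s Z rule: less_induct)
  case (less k)
  show ?case
  proof (cases "k = 0")
    case True
    obtain \<xi> where \<xi>: "lip 0 \<xi>" "Z 0 = A s 0 * \<xi> 0 / (2 * al s + of_nat 0)"
      using less.prems unfolding admissible_def by blast
    have "unit (2 * al s + of_nat 0)"
      by (rule residue_unit[OF residue_al2]) (use dig_pos[of s] in simp)
    then show ?thesis using \<xi>(2) lip_R[OF \<xi>(1), of 0] True by (simp add: divide_unit_R)
  next
    case False
    obtain \<kappa> Z' where Z: "\<kappa> \<in> R" "admissible (Suc s) Z'"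
        "\<And>i. Z (k mod p + p * i) = \<kappa> * A (Suc s) i + \<pi> * Z' i"
      using admissible_splits[OF less.prems, of "k mod p"] p_gt_0 unfolding splits_at_def by auto
    have Xk: "Z k = \<kappa> * A (Suc s) (k div p) + \<pi> * Z' (k div p)"
      using Z(3)[of "k div p"] by simp
    have lt: "k div p < k" using False p_gt_1 by simp
    show ?thesis unfolding Xk
      by (intro add_R mult_R of_nat_R Z less.IH[OF lt admissible_hyp] less.IH[OF lt Z(2)])
  qed
qed

lemma splits_R:
  assumes "\<And>\<rho>. \<rho> < p \<Longrightarrow> splits_at s \<rho> Z"
  shows "Z k \<in> R"
proof -
  obtain \<kappa> Z' where Z: "\<kappa> \<in> R" "admissible (Suc s) Z'"
      "\<And>i. Z (k mod p + p * i) = \<kappa> * A (Suc s) i + \<pi> * Z' i"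
    using assms[of "k mod p"] p_gt_0 unfolding splits_at_def by auto
  have Xk: "Z k = \<kappa> * A (Suc s) (k div p) + \<pi> * Z' (k div p)"
    using Z(3)[of "k div p"] by simp
  show ?thesis unfolding Xk
    by (intro add_R mult_R of_nat_R Z admissible_R[OF admissible_hyp] admissible_R[OF Z(2)])
qed

end

section \<open>Brackets of truncated power series\<close>

definition fps_part :: "nat \<Rightarrow> nat \<Rightarrow> 'a::zero fps \<Rightarrow> 'a fps"
  where "fps_part q \<rho> f = Abs_fps (\<lambda>i. fps_nth f (\<rho> + q * i))"

definition bracket :: "nat \<Rightarrow> 'a::comm_ring_1 fps \<Rightarrow> 'a fps \<Rightarrow> 'a fps"
  where "bracket N f g = fps_cutoff N f * g - f * fps_cutoff N g"

lemma fps_nth_compose_X_power: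
  fixes f :: "'a::idom fps"
  assumes "q > 0"
  shows "fps_nth (f oo fps_X ^ q) k = (if q dvd k then fps_nth f (k div q) else 0)"
proof -
  have "fps_nth (f oo fps_X ^ q) k = (\<Sum>i=0..k. fps_nth f i * (if k = q * i then 1 else 0))"
    by (simp add: fps_compose_nth power_mult[symmetric])
  also have "\<dots> = (\<Sum>i\<in>{i\<in>{0..k}. k = q * i}. fps_nth f i)"
    by (rule sum.mono_neutral_cong_right) auto
  also have "{i\<in>{0..k}. k = q * i} = (if q dvd k then {k div q} else {})"
    using assms by auto
  finally show ?thesis by simp
qed

lemma fps_part_sum:
  fixes f :: "'a::idom fps"
  assumes "q > 0"
  shows "f = (\<Sum>\<rho><q. fps_X ^ \<rho> * (fps_part q \<rho> f oo fps_X ^ q))"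
proof (rule fps_ext)
  fix k
  have "fps_nth (\<Sum>\<rho><q. fps_X ^ \<rho> * (fps_part q \<rho> f oo fps_X ^ q)) k
      = (\<Sum>\<rho><q. if \<rho> = k mod q then fps_nth f k else 0)"
    unfolding fps_sum_nth
  proof (rule sum.cong[OF refl])
    fix \<rho> assume "\<rho> \<in> {..<q}"
    then have \<rho>: "\<rho> < q" by simp
    show "fps_nth (fps_X ^ \<rho> * (fps_part q \<rho> f oo fps_X ^ q)) k = (if \<rho> = k mod q then fps_nth f k else 0)"
    proof (cases "\<rho> \<le> k \<and> q dvd k - \<rho>")
      case True
      then have eq: "\<rho> + q * ((k - \<rho>) div q) = k" by simp
      then have "k mod q = (\<rho> + q * ((k - \<rho>) div q)) mod q" by simp
      also have "\<dots> = \<rho>" using \<rho> by simp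
      finally show ?thesis using True eq
        by (simp add: fps_X_power_mult_nth fps_nth_compose_X_power[OF assms] fps_part_def)
    next
      case False
      have "\<rho> \<noteq> k mod q" using False by (auto simp: dvd_minus_mod)
      then show ?thesis using False
        by (auto simp: fps_X_power_mult_nth fps_nth_compose_X_power[OF assms])
    qed
  qed
  also have "\<dots> = fps_nth f k" using assms by simp
  finally show "fps_nth f k = fps_nth (\<Sum>\<rho><q. fps_X ^ \<rho> * (fps_part q \<rho> f oo fps_X ^ q)) k" ..
qed

lemma fps_part_cutoff:
  assumes "\<rho> < q"
  shows "fps_part q \<rho> (fps_cutoff (q * M) f) = fps_cutoff M (fps_part q \<rho> f)"
proof (rule fps_ext)
  fix i
  have "\<rho> + q * i < q * M \<longleftrightarrow> i < M"
  proof
    assume "i < M"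
    then have "q * Suc i \<le> q * M" by (intro mult_le_mono2) simp
    then show "\<rho> + q * i < q * M" using assms by simp
  next
    assume "\<rho> + q * i < q * M"
    then have "q * i < q * M" by linarith
    then show "i < M" by simp
  qed
  then show "fps_nth (fps_part q \<rho> (fps_cutoff (q * M) f)) i = fps_nth (fps_cutoff M (fps_part q \<rho> f)) i"
    by (simp add: fps_part_def)
qed

text \<open>Truncation at a multiple of \<open>q\<close> commutes with decomposing a series into its parts modulo \<open>q\<close>, so the
  bracket decomposes bilinearly.\<close>

lemma bracket_parts:
  fixes f g :: "'a::idom fps"
  assumes q: "q > 0"
  shows "bracket (q * M) f g = (\<Sum>\<rho><q. \<Sum>\<tau><q. fps_X ^ (\<rho> + \<tau>) *
    (bracket M (fps_part q \<rho> f) (fps_part q \<tau> g) oo fps_X ^ q))"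
proof -
  let ?S = "\<lambda>h. h oo fps_X ^ q :: 'a fps"
  have X0: "fps_nth (fps_X ^ q :: 'a fps) 0 = 0" using q by simp
  have cut: "fps_cutoff (q * M) h = (\<Sum>\<rho><q. fps_X ^ \<rho> * ?S (fps_cutoff M (fps_part q \<rho> h)))" for h :: "'a fps"
    by (subst fps_part_sum[OF q]) (simp add: fps_part_cutoff)
  have "bracket (q * M) f g =
      (\<Sum>\<rho><q. fps_X ^ \<rho> * ?S (fps_cutoff M (fps_part q \<rho> f))) * (\<Sum>\<tau><q. fps_X ^ \<tau> * ?S (fps_part q \<tau> g))
    - (\<Sum>\<rho><q. fps_X ^ \<rho> * ?S (fps_part q \<rho> f)) * (\<Sum>\<tau><q. fps_X ^ \<tau> * ?S (fps_cutoff M (fps_part q \<tau> g)))"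
    unfolding bracket_def cut using fps_part_sum[OF q, of f] fps_part_sum[OF q, of g] by simp
  also have "\<dots> = (\<Sum>\<rho><q. \<Sum>\<tau><q. fps_X ^ (\<rho> + \<tau>) *
      (?S (fps_cutoff M (fps_part q \<rho> f)) * ?S (fps_part q \<tau> g)
       - ?S (fps_part q \<rho> f) * ?S (fps_cutoff M (fps_part q \<tau> g))))"
    unfolding sum_product sum_subtractf[symmetric]
    by (intro sum.cong refl) (simp add: power_add algebra_simps)
  also have "\<dots> = (\<Sum>\<rho><q. \<Sum>\<tau><q. fps_X ^ (\<rho> + \<tau>) *
      ?S (bracket M (fps_part q \<rho> f) (fps_part q \<tau> g)))"
    unfolding bracket_def fps_compose_sub_distrib by (simp only: fps_compose_mult_distrib[OF X0])
  finally show ?thesis .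
qed

lemma fps_cutoff_const_mult: "fps_cutoff N (fps_const c * f) = fps_const c * fps_cutoff N (f :: 'a::comm_ring_1 fps)"
  by (rule fps_ext) simp

text \<open>The term \<open>\<kappa> \<mu> bracket M h h\<close> is missing because it is 0; hence the common factor \<open>c\<close>.\<close>

lemma bracket_bilinear:
  "bracket M (fps_const \<kappa> * h + fps_const c * u) (fps_const \<mu> * h + fps_const c * v)
   = fps_const c * (fps_const \<kappa> * bracket M h v + fps_const \<mu> * bracket M u h + fps_const c * bracket M u v)"
  unfolding bracket_def fps_cutoff_add fps_cutoff_const_mult by (simp add: algebra_simps)

context padic_field
begin

definition I_fps :: "nat \<Rightarrow> 'k fps set" where "I_fps n = {f. \<forall>k. fps_nth f k \<in> I n}"

lemma I_fps_add: "f \<in> I_fps n \<Longrightarrow> g \<in> I_fps n \<Longrightarrow> f + g \<in> I_fps n"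
  by (auto simp: I_fps_def intro: I_add)
lemma I_fps_diff: "f \<in> I_fps n \<Longrightarrow> g \<in> I_fps n \<Longrightarrow> f - g \<in> I_fps n"
  by (auto simp: I_fps_def intro: I_diff)
lemma I_fps_sum: "(\<And>i. i \<in> A \<Longrightarrow> f i \<in> I_fps n) \<Longrightarrow> sum f A \<in> I_fps n"
  by (auto simp: I_fps_def fps_sum_nth intro: I_sum)
lemma I_fps_mult: "f \<in> I_fps m \<Longrightarrow> g \<in> I_fps n \<Longrightarrow> f * g \<in> I_fps (m + n)"
  by (auto simp: I_fps_def fps_mult_nth intro!: I_sum I_mult)
lemma I_fps_const_mult: "c \<in> R \<Longrightarrow> f \<in> I_fps n \<Longrightarrow> fps_const c * f \<in> I_fps n"
  by (auto simp: I_fps_def intro!: I_mult_left)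
lemma I_fps_p_mult: "f \<in> I_fps n \<Longrightarrow> fps_const \<pi> * f \<in> I_fps (Suc n)"
  by (simp add: I_fps_def p_mult_I)
lemma I_fps_X_power: "f \<in> I_fps n \<Longrightarrow> fps_X ^ m * f \<in> I_fps n"
  by (auto simp: I_fps_def fps_X_power_mult_nth I_zero)
lemma I_fps_stretch: "f \<in> I_fps n \<Longrightarrow> q > 0 \<Longrightarrow> f oo fps_X ^ q \<in> I_fps n"
  by (auto simp: I_fps_def fps_nth_compose_X_power I_zero)
lemma I_fps_cutoff: "f \<in> I_fps n \<Longrightarrow> fps_cutoff N f \<in> I_fps n"
  by (auto simp: I_fps_def I_zero)

lemma I_fps_inverse:
  assumes f: "f \<in> I_fps 0" "fps_nth f 0 = 1"
  shows "inverse f \<in> I_fps 0"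
proof -
  have "fps_nth (inverse f) k \<in> R" for k
  proof (induction k rule: less_induct)
    case (less k)
    show ?case
    proof (cases "k = 0")
      case True
      then show ?thesis using f by (simp add: one_R)
    next
      case False
      have "f * inverse f = 1" using f(2) by (intro inverse_mult_eq_1') simp
      then have "fps_nth (f * inverse f) k = 0" using False by simp
      then have "(\<Sum>i=0..k. fps_nth f i * fps_nth (inverse f) (k - i)) = 0" by (simp only: fps_mult_nth)
      then have "fps_nth (inverse f) k = - (\<Sum>i=Suc 0..k. fps_nth f i * fps_nth (inverse f) (k - i))"
        using f(2) by (simp add: sum.atLeast_Suc_atMost[of 0 k] eq_neg_iff_add_eq_0)
      also have "\<dots> \<in> I 0"
        using f(1) less by (intro I_uminus I_sum) (auto simp: I_0 I_fps_def intro!: mult_R)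
      finally show ?thesis by (simp add: I_0)
    qed
  qed
  then show ?thesis by (simp add: I_fps_def I_0)
qed

text \<open>Over \<open>R\<close> both denominators are invertible, so the difference of the two quotients is an integral
  multiple of the bracket.\<close>

lemma quotient_cutoff_cong:
  assumes f: "f \<in> I_fps 0" "fps_nth f 0 = 1" and N: "N > 0" and br: "bracket N f g \<in> I_fps n"
  shows "g / f - fps_cutoff N g / fps_cutoff N f \<in> I_fps n"
proof -
  let ?F = "fps_cutoff N f"
  have F: "?F \<in> I_fps 0" "fps_nth ?F 0 = 1" using f N by (auto simp: I_fps_cutoff)
  have inv: "f * inverse f = 1" "?F * inverse ?F = 1"
    using f F by (intro inverse_mult_eq_1'; simp)+
  have "g / f - fps_cutoff N g / ?F = g * inverse f - fps_cutoff N g * inverse ?F"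
    using f F by (simp add: fps_divide_unit)
  also have "\<dots> = g * inverse f * (?F * inverse ?F) - fps_cutoff N g * inverse ?F * (f * inverse f)"
    by (simp only: inv mult_1_right)
  also have "\<dots> = bracket N f g * (inverse f * inverse ?F)"
    by (simp add: bracket_def algebra_simps)
  also have "\<dots> \<in> I_fps (n + (0 + 0))"
    by (intro I_fps_mult br I_fps_inverse f F)
  finally show ?thesis by simp
qed

end

context digit_chain
begin

abbreviation A_fps :: "nat \<Rightarrow> 'k fps" where "A_fps s \<equiv> Abs_fps (A s)"

lemma splits_part:
  assumes "splits_at s \<rho> Z"
  obtains \<kappa> Z' where "\<kappa> \<in> R" "admissible (Suc s) Z'"
    "fps_part p \<rho> (Abs_fps Z) = fps_const \<kappa> * A_fps (Suc s) + fps_const \<pi> * Abs_fps Z'"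
  using assms unfolding splits_at_def by (auto simp: fps_eq_iff fps_part_def)

text \<open>One Dwork step gains one power of \<open>p\<close>. For \<open>n = 0\<close> the statement is integrality.\<close>

theorem bracket_congruence:
  assumes "\<And>\<rho>. \<rho> < p \<Longrightarrow> splits_at s \<rho> Z" "\<And>\<rho>. \<rho> < p \<Longrightarrow> splits_at s \<rho> Y"
  shows "bracket (p ^ n) (Abs_fps Z) (Abs_fps Y) \<in> I_fps n"
  using assms
proof (induction n arbitrary: s Z Y)
  case 0
  then have "Abs_fps Z \<in> I_fps 0" "Abs_fps Y \<in> I_fps 0"
    using splits_R[of s] by (auto simp: I_fps_def I_0)
  then show ?case unfolding bracket_def
    using I_fps_mult[of _ 0 _ 0] by (auto intro!: I_fps_diff I_fps_cutoff)
next
  case (Suc n)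
  have IH: "bracket (p ^ n) (Abs_fps U) (Abs_fps V) \<in> I_fps n"
    if "admissible (Suc s) U" "admissible (Suc s) V" for U V
    using that by (intro Suc.IH[of "Suc s"] admissible_splits)
  show ?case unfolding power_Suc bracket_parts[OF p_gt_0]
  proof (intro I_fps_sum I_fps_X_power I_fps_stretch[OF _ p_gt_0])
    fix \<rho> \<tau> assume "\<rho> \<in> {..<p}" "\<tau> \<in> {..<p}"
    then have \<rho>: "\<rho> < p" and \<tau>: "\<tau> < p" by auto
    obtain \<kappa> U where U: "\<kappa> \<in> R" "admissible (Suc s) U"
      "fps_part p \<rho> (Abs_fps Z) = fps_const \<kappa> * A_fps (Suc s) + fps_const \<pi> * Abs_fps U"
      using Suc.prems(1)[OF \<rho>] by (rule splits_part)
    obtain \<mu> V where V: "\<mu> \<in> R" "admissible (Suc s) V"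
      "fps_part p \<tau> (Abs_fps Y) = fps_const \<mu> * A_fps (Suc s) + fps_const \<pi> * Abs_fps V"
      using Suc.prems(2)[OF \<tau>] by (rule splits_part)
    show "bracket (p ^ n) (fps_part p \<rho> (Abs_fps Z)) (fps_part p \<tau> (Abs_fps Y)) \<in> I_fps (Suc n)"
      unfolding U(3) V(3) bracket_bilinear
      by (intro I_fps_p_mult I_fps_add I_fps_const_mult U V of_nat_R IH admissible_hyp)
  qed
qed

end

section \<open>Morita's Gamma function on natural numbers\<close>

context odd_padic_field
begin

text \<open>Inversion permutes the residues prime to \<open>p\<close>, so their product squares to 1.\<close>

lemma prime_to_part_square:
  assumes "r \<ge> 1"
  shows "[(\<Prod>{x. x < p ^ r \<and> \<not> p dvd x}) * (\<Prod>{x. x < p ^ r \<and> \<not> p dvd x}) = 1] (mod p ^ r)"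
proof -
  define T where "T = {x. x < p ^ r \<and> \<not> p dvd x}"
  have fin: "finite T" by (simp add: T_def)
  have cop: "coprime x (p ^ r)" if "x \<in> T" for x
    using that prime_p by (auto simp: T_def coprime_commute prime_imp_coprime)
  have "\<exists>y\<in>T. [x * y = 1] (mod p ^ r)" if x: "x \<in> T" for x
  proof -
    obtain y where y: "[x * y = 1] (mod p ^ r)" using cong_solve_coprime_nat[OF cop[OF x]] by auto
    have "[x * (y mod p ^ r) = 1] (mod p ^ r)" using y by (simp add: cong_def mod_mult_right_eq)
    moreover from this have "y mod p ^ r \<in> T"
    proof -
      have "\<not> p dvd y mod p ^ r"
      proof
        assume "p dvd y mod p ^ r"
        then have "p dvd x * (y mod p ^ r)" by simp
        moreover have "[x * (y mod p ^ r) = 1] (mod p)"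
          using \<open>[x * (y mod p ^ r) = 1] (mod p ^ r)\<close> assms
          by (rule_tac cong_dvd_modulus_nat) (auto simp: dvd_power)
        ultimately have "p dvd 1" using cong_dvd_iff by blast
        then show False using p_gt_1 by simp
      qed
      then show ?thesis using p_gt_0 by (simp add: T_def)
    qed
    ultimately show ?thesis by blast
  qed
  then obtain iv where iv: "\<And>x. x \<in> T \<Longrightarrow> iv x \<in> T" "\<And>x. x \<in> T \<Longrightarrow> [x * iv x = 1] (mod p ^ r)"
    by metis
  have inj: "inj_on iv T"
  proof (rule inj_onI)
    fix x y assume xy: "x \<in> T" "y \<in> T" "iv x = iv y"
    have "[x * iv x = y * iv x] (mod p ^ r)"
      using iv(2)[OF xy(1)] iv(2)[OF xy(2)] xy(3) by (metis cong_trans cong_sym)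
    then have "[x = y] (mod p ^ r)"
      using cong_mult_rcancel_nat[OF cop[OF iv(1)[OF xy(1)]]] by simp
    then show "x = y" using xy by (simp add: T_def cong_def)
  qed
  have "iv ` T = T" using endo_inj_surj[OF fin _ inj] iv(1) by auto
  then have "\<Prod>T = (\<Prod>x\<in>T. iv x)" using prod.reindex[OF inj, of "\<lambda>x. x"] by simp
  then have "\<Prod>T * \<Prod>T = (\<Prod>x\<in>T. x * iv x)" by (simp add: prod.distrib)
  moreover have "[(\<Prod>x\<in>T. x * iv x) = (\<Prod>x\<in>T. 1)] (mod p ^ r)"
    by (rule cong_prod) (use iv(2) in auto)
  ultimately show ?thesis by (simp add: T_def)
qed

definition fact_p :: "nat \<Rightarrow> 'k" where "fact_p n = coprime_poch 0 0 n"

lemma residue_0: "residue 0 0" using p_gt_0 by (simp add: residue_def zero_R I_zero)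

lemma fact_p_unit: "unit (fact_p n)" unfolding fact_p_def by (rule coprime_poch_unit[OF residue_0])

lemma fact_p_Suc: "fact_p (Suc n) = fact_p n * (if p dvd n then 1 else of_nat n)"
  by (simp add: fact_p_def coprime_poch_Suc dvd_eq_mod_eq_0)

lemma fact_p_0 [simp]: "fact_p 0 = 1" by (simp add: fact_p_def coprime_poch_def)

lemma fact_p_eq: "fact_p n = of_nat (\<Prod>{x. x < n \<and> \<not> p dvd x})"
proof (induction n)
  case (Suc n)
  have "{x. x < Suc n \<and> \<not> p dvd x} = (if p dvd n then {x. x < n \<and> \<not> p dvd x}
      else insert n {x. x < n \<and> \<not> p dvd x})" by (auto simp: less_Suc_eq)
  then show ?case by (simp add: fact_p_Suc Suc mult.commute)
qed simp

text \<open>Wilson's theorem for each of the \<open>j\<close> blocks of length \<open>p\<close>.\<close>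

lemma fact_p_mult_p: "fact_p (p * j) - (- 1) ^ j \<in> I 1"
proof (induction j)
  case (Suc j)
  have "window 0 0 p (0 + p * j) + 1 \<in> I 1"
  proof -
    obtain h where h: "smooth h" "\<And>i. window 0 0 p (0 + p * i) = base_window i + \<pi> * h i"
      using window_smooth[OF residue_0] by blast
    have b: "base_window j - base_window 0 \<in> I 1"
      using lip_cong[OF smooth_lip[OF smooth_base_window], of j 0 0] by simp
    have "(\<Prod>s<p. if s = 0 then 1 else (of_nat s :: 'k)) = (\<Prod>s\<in>{1..p-1}. of_nat s)"
      by (rule prod.mono_neutral_cong_right) (use p_gt_0 in auto)
    then have f: "base_window 0 = of_nat (fact (p - 1))" by (simp add: base_window_def fact_prod cong: if_cong)
    have "[fact (p - 1) = (- 1 :: int)] (mod int p)" using prime_p by (rule wilson_theorem)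
    then have "of_int (fact (p - 1) + 1) \<in> I 1"
      unfolding of_int_I by (simp add: cong_iff_dvd_diff)
    moreover have "of_int (fact (p - 1) + 1) = (of_nat (fact (p - 1)) + 1 :: 'k)"
    proof -
      have "(fact (p - 1) :: int) = int (fact (p - 1))" by simp
      then show ?thesis by (simp only: of_int_add of_int_1 of_int_of_nat_eq)
    qed
    ultimately have w: "base_window 0 + 1 \<in> I 1" by (simp only: f)
    have "\<pi> * h j \<in> I 1" using p_mult_I[of "h j" 0] smooth_R[OF h(1)] by (simp add: I_0)
    from I_add[OF I_add[OF b w] this] show ?thesis unfolding h(2) by (simp add: algebra_simps)
  qed
  then have w: "window 0 0 p (p * j) - (- 1) \<in> I 1" by simp
  have e: "p * Suc j = p * j + p" by simp
  have "fact_p (p * Suc j) = fact_p (p * j) * window 0 0 p (p * j)"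
    unfolding fact_p_def e by (simp only: coprime_poch_add window_def)
  moreover have "fact_p (p * j) * window 0 0 p (p * j) - (- 1) ^ j * (- 1) \<in> I 1"
    by (intro cong_mult_I Suc w) (auto intro!: unit_R window_unit residue_0 power_R uminus_R one_R)
  ultimately show ?case by simp
qed (simp add: I_zero)

lemma two_unit: "unit 2"
proof -
  have "\<not> p dvd 2" using p_gt_2 by (auto dest: dvd_imp_le)
  then show ?thesis using unit_of_nat[of 2] by simp
qed

text \<open>A square root of 1 modulo \<open>p ^ r\<close> that is \<open>-1\<close> modulo \<open>p\<close> is \<open>-1\<close> modulo \<open>p ^ r\<close>: the other factor
  of \<open>W\<^sup>2 - 1\<close> is \<open>-2\<close> modulo \<open>p\<close>, hence a unit.\<close>

lemma wilson_prime_power: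
  assumes "r \<ge> 1" shows "fact_p (p ^ r) + 1 \<in> I r"
proof -
  let ?W = "fact_p (p ^ r)"
  have "?W * ?W - of_nat 1 \<in> I r"
    using prime_to_part_square[OF assms] unfolding fact_p_eq of_nat_mult[symmetric] of_nat_diff_I .
  then have 1: "(?W - 1) * (?W + 1) \<in> I r" by (simp add: algebra_simps)
  have "p ^ r = p * p ^ (r - 1)" using assms by (cases r) auto
  then have "?W - (- 1) ^ (p ^ (r - 1)) \<in> I 1" using fact_p_mult_p[of "p ^ (r - 1)"] by simp
  then have "?W + 1 \<in> I 1" using p_odd by simp
  then have "(-2) - (?W - 1) \<in> I (Suc 0)" using I_uminus[of "?W + 1" 1] by (simp add: algebra_simps)
  then have "unit (?W - 1)" by (rule unit_cong[OF unit_uminus[OF two_unit]])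
  then show ?thesis using 1 by (simp add: unit_mult_I)
qed

text \<open>Morita's Gamma function at natural arguments; it extends to the \<open>p\<close>-adic integers by \<open>lip_Gam\<close>.\<close>

definition Gam :: "nat \<Rightarrow> 'k" where "Gam n = (- 1) ^ n * fact_p n"

lemma Gam_unit: "unit (Gam n)"
  unfolding Gam_def by (intro unit_mult unit_power unit_uminus unit_1 fact_p_unit)

lemma Gam_0 [simp]: "Gam 0 = 1" by (simp add: Gam_def)

lemma Gam_Suc: "Gam (Suc n) = - (if p dvd n then 1 else of_nat n) * Gam n"
  by (simp add: Gam_def fact_p_Suc)

text \<open>For \<open>n = 0\<close> this is \<open>wilson_prime_power\<close>, and \<open>p ^ r\<close> is odd. The step uses that the factors of the
  functional equation at \<open>n\<close> and \<open>n + p ^ r\<close> agree modulo \<open>p ^ r\<close>.\<close>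

lemma Gam_add_prime_power: "Gam (n + p ^ r) - Gam n \<in> I r"
proof (cases "r = 0")
  case True
  then show ?thesis using Gam_unit[THEN unit_R] by (simp add: I_0 diff_R)
next
  case False
  show ?thesis
  proof (induction n)
    case 0
    have "- (fact_p (p ^ r) + 1) \<in> I r" using wilson_prime_power[of r] False by (intro I_uminus) simp
    then show ?case using p_odd by (simp add: Gam_def)
  next
    case (Suc n)
    have d: "p dvd n + p ^ r \<longleftrightarrow> p dvd n" using False by (simp add: dvd_add_left_iff dvd_power)
    let ?h = "\<lambda>n. if p dvd n then 1 else (of_nat n :: 'k)"
    have "?h (n + p ^ r) - ?h n \<in> I r"
      using d p_power_I[of r] by (simp add: I_zero)
    then have "- ?h (n + p ^ r) - - ?h n \<in> I r" using I_uminus by fastforce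
    then have "- ?h (n + p ^ r) * Gam (n + p ^ r) - - ?h n * Gam n \<in> I r"
      by (intro cong_mult_I Suc) (auto intro!: unit_R Gam_unit uminus_R one_R of_nat_R)
    then show ?case unfolding add_Suc Gam_Suc .
  qed
qed

lemma lip_Gam: "lip 0 Gam"
proof (rule lipI)
  show "Gam i \<in> R" for i by (rule unit_R[OF Gam_unit])
  fix r x y assume "p ^ r dvd x"
  then obtain t where t: "x = p ^ r * t" ..
  have "Gam (y + p ^ r * t) - Gam y \<in> I r"
  proof (induction t)
    case (Suc t)
    have "y + p ^ r * Suc t = y + p ^ r * t + p ^ r" by simp
    then show ?case using I_trans[OF Gam_add_prime_power Suc] by (simp only:)
  qed (simp add: I_zero)
  then show "Gam (y + x) - Gam y \<in> I (r + 0)" by (simp add: t)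
qed

text \<open>The reflection formula \<open>\<Gamma>(- k) \<Gamma>(1 + k) = \<plusminus> 1\<close>, with \<open>- k\<close> replaced by the natural number \<open>P - k\<close>. By
  the functional equation the product changes sign from \<open>k\<close> to \<open>k + 1\<close> unless \<open>p\<close> divides \<open>k + 1\<close>, and
  the exponent counts the numbers up to \<open>k\<close> that are prime to \<open>p\<close>.\<close>

lemma Gam_reflection:
  assumes P: "p ^ r dvd P" and r: "r \<ge> 1" and k: "k < P"
  shows "Gam (P - k) * Gam (Suc k) + (- 1) ^ (k - k div p) \<in> I r"
  using k
proof (induction k)
  case 0
  have "Gam P - Gam 0 \<in> I r" using lip_cong[OF lip_Gam, of P 0 r] P by (simp add: cong_0_iff)
  moreover have "Gam (Suc 0) = -1" by (simp add: Gam_Suc)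
  ultimately show ?case using I_uminus[of "Gam P - 1" r] by simp
next
  case (Suc k)
  define h where "h n = (if p dvd n then 1 else (of_nat n :: 'k))" for n
  have hunit: "unit (h n)" for n unfolding h_def by (simp add: unit_1 unit_of_nat)
  let ?m = "P - Suc k"
  have pP: "p dvd P" using P r by (auto intro: dvd_trans[OF dvd_power])
  have d: "p dvd ?m \<longleftrightarrow> p dvd Suc k" using pP Suc.prems dvd_diff_nat
    by (metis diff_diff_cancel less_imp_le)
  have m: "P - k = Suc ?m" using Suc.prems by simp
  have G1: "Gam (P - k) = - h ?m * Gam ?m" unfolding m Gam_Suc h_def ..
  have G2: "Gam (Suc (Suc k)) = - h (Suc k) * Gam (Suc k)" unfolding Gam_Suc[of "Suc k"] h_def ..
  define e where "e = (if p dvd Suc k then 1 else -1 :: 'k)"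
  have eR: "e \<in> R" by (auto simp: e_def intro: one_R uminus_R)
  have he: "h (Suc k) - e * h ?m \<in> I r"
  proof (cases "p dvd Suc k")
    case True
    then show ?thesis using d by (simp add: h_def e_def I_zero)
  next
    case False
    have "of_nat (Suc k) + of_nat ?m = (of_nat P :: 'k)" unfolding of_nat_add[symmetric] using Suc.prems by simp
    then show ?thesis using False d P by (simp add: h_def e_def of_nat_I del: of_nat_Suc)
  qed
  have sgn: "(- 1) ^ (Suc k - Suc k div p) = e * (- 1) ^ (k - k div p)"
  proof (cases "p dvd Suc k")
    case True
    then have "Suc k div p = Suc (k div p)" by (simp add: div_Suc dvd_eq_mod_eq_0)
    then show ?thesis using True by (simp add: e_def)
  next
    case False
    then have "Suc k div p = k div p" by (simp add: div_Suc dvd_eq_mod_eq_0)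
    moreover have "k div p \<le> k" by simp
    ultimately show ?thesis using False by (simp add: e_def Suc_diff_le)
  qed
  let ?g = "Gam ?m * Gam (Suc k)"
  have "Gam (P - k) * Gam (Suc k) + (- 1) ^ (k - k div p) \<in> I r" using Suc by simp
  then have 1: "e * (- h ?m * ?g + (- 1) ^ (k - k div p)) \<in> I r"
    unfolding G1 by (intro I_mult_left eR) (simp add: mult.assoc)
  have 2: "(h (Suc k) - e * h ?m) * ?g \<in> I r"
    by (intro I_mult_right he unit_R unit_mult Gam_unit)
  have "Gam ?m * Gam (Suc (Suc k)) + (- 1) ^ (Suc k - Suc k div p)
      = e * (- h ?m * ?g + (- 1) ^ (k - k div p)) - (h (Suc k) - e * h ?m) * ?g"
    unfolding G2 sgn by (simp add: algebra_simps)
  then show ?case using I_diff[OF 1 2] by simp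
qed

text \<open>The functional equation, iterated: \<open>coprime_poch x l k = (- 1) ^ k \<Gamma>(x + k) / \<Gamma>(x)\<close>, with \<open>x\<close>
  replaced by a natural number \<open>n\<close> close to it.\<close>

lemma coprime_poch_Gam:
  assumes x: "residue x l" and n: "of_nat n - x \<in> I r" and r: "r \<ge> 1"
  shows "coprime_poch x l k - (- 1) ^ k * (Gam (n + k) / Gam n) \<in> I r"
proof -
  have xR: "x \<in> R" and l: "l < p" using x by (auto simp: residue_def)
  have c: "coprime_poch x l k - coprime_poch (of_nat n) l k \<in> I r"
    unfolding coprime_poch_def
  proof (rule cong_prod_I)
    fix y show "(if y mod p = l then 1 else x + of_nat y) - (if y mod p = l then 1 else of_nat n + of_nat y) \<in> I r"
      using I_sym[OF n] by (simp add: I_zero)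
  qed (auto intro: one_R add_R of_nat_R xR)
  have "of_nat n - x \<in> I 1" using n r by (rule I_anti_mono[rotated])
  moreover have "x + of_nat l \<in> I 1" using x by (simp add: residue_def)
  ultimately have "(of_nat n - x) + (x + of_nat l) \<in> I 1" by (rule I_add)
  then have "of_nat (n + l) \<in> I 1" by simp
  then have nl: "[n + l = 0] (mod p)" unfolding of_nat_I by (simp add: cong_0_iff)
  have m: "(n + y) mod p = 0 \<longleftrightarrow> y mod p = l" for y
  proof -
    have "(n + y) mod p = 0 \<longleftrightarrow> [n + y = n + l] (mod p)"
      using nl by (simp add: cong_def)
    also have "\<dots> \<longleftrightarrow> [y = l] (mod p)" by (rule cong_add_lcancel_nat)
    finally show ?thesis using l by (simp add: cong_def)
  qed
  have "fact_p (n + k) = fact_p n * coprime_poch (of_nat n) l k"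
    unfolding fact_p_def coprime_poch_add m coprime_poch_def[of "of_nat n"] by (simp cong: if_cong)
  then have "coprime_poch (of_nat n) l k = (- 1) ^ k * (Gam (n + k) / Gam n)"
    using unit_nonzero[OF fact_p_unit[of n]] by (simp add: Gam_def power_add)
  then show ?thesis using c by simp
qed

end

section \<open>Difference quotients at a p-adic point\<close>

context odd_padic_field
begin

lemma nonzero_decompose:
  assumes "x \<in> R" "x \<noteq> 0"
  obtains v u where "unit u" "x = \<pi> ^ v * u"
proof -
  have "\<exists>n. x \<notin> I n"
  proof (rule ccontr)
    assume "\<not> ?thesis"
    then have "x = 0" using eqI_cong[of x 0] by simp
    then show False using assms by simp
  qed
  then obtain n where n: "x \<notin> I n" "\<And>m. m < n \<Longrightarrow> x \<in> I m"
    using exists_least_iff[of "\<lambda>n. x \<notin> I n"] by auto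
  have "n \<noteq> 0" using n(1) assms(1) I_0 by (cases "n = 0") simp_all
  then obtain v where v: "n = Suc v" by (cases n) auto
  have x: "x = \<pi> ^ v * (x / \<pi> ^ v)" using p_nonzero by simp
  have "x / \<pi> ^ v \<in> I 0" using n(2)[of v] by (simp add: v I_def)
  moreover have "x / \<pi> ^ v \<notin> I 1"
    using n(1) x p_power_mult_I[of v "x / \<pi> ^ v" 1] by (simp add: v)
  ultimately show thesis using that[of "x / \<pi> ^ v" v] x by (simp add: unit_def I_0)
qed

lemma quotient_continuous:
  assumes N: "N \<in> R" and \<delta>: "\<delta> \<in> R" "\<delta> \<noteq> 0"
  shows "\<exists>L. \<forall>N' \<delta>'. N' - N \<in> I L \<longrightarrow> \<delta>' - \<delta> \<in> I L \<longrightarrow> N' / \<delta>' - N / \<delta> \<in> I t"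
proof -
  obtain v u where u: "unit u" "\<delta> = \<pi> ^ v * u" using nonzero_decompose[OF \<delta>] .
  \<comment> \<open>The denominators contribute \<open>p ^ (2 v)\<close>; the last \<open>1\<close> keeps the new denominator a unit times \<open>p ^ v\<close>.\<close>
  define L where "L = (v + v) + Suc t"
  have "N' / \<delta>' - N / \<delta> \<in> I t" if NN: "N' - N \<in> I L" and DD: "\<delta>' - \<delta> \<in> I L" for N' \<delta>'
  proof -
    define u' where "u' = \<delta>' / \<pi> ^ v"
    have d': "\<delta>' = \<pi> ^ v * u'" using p_nonzero by (simp add: u'_def)
    have "\<pi> ^ v * (u' - u) \<in> I (v + Suc (v + t))" using DD by (simp add: u d' L_def algebra_simps)
    then have "u - u' \<in> I (Suc (v + t))" unfolding p_power_mult_I by (rule I_sym)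
    then have u': "unit u'" by (rule unit_cong[OF u(1)])
    have num: "(N' - N) * \<delta> - N * (\<delta>' - \<delta>) \<in> I L"
      by (rule I_diff[OF I_mult_right[OF NN \<delta>(1)] I_mult_left[OF N DD]])
    have "\<delta>' \<noteq> 0" using unit_nonzero[OF u'] p_nonzero by (simp add: d')
    then have "N' / \<delta>' - N / \<delta> = ((N' - N) * \<delta> - N * (\<delta>' - \<delta>)) / (\<delta>' * \<delta>)"
      using \<delta>(2) by (simp add: field_simps)
    also have "\<delta>' * \<delta> = \<pi> ^ (v + v) * (u' * u)" by (simp add: u d' power_add mult_ac)
    also have "((N' - N) * \<delta> - N * (\<delta>' - \<delta>)) / \<dots>
        = (((N' - N) * \<delta> - N * (\<delta>' - \<delta>)) / \<pi> ^ (v + v)) / (u' * u)" by simp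
    also have "\<dots> \<in> I (Suc t)"
    proof (rule divide_unit_I)
      have "\<pi> ^ (v + v) * (((N' - N) * \<delta> - N * (\<delta>' - \<delta>)) / \<pi> ^ (v + v)) \<in> I ((v + v) + Suc t)"
        using num p_nonzero by (simp add: L_def)
      then show "((N' - N) * \<delta> - N * (\<delta>' - \<delta>)) / \<pi> ^ (v + v) \<in> I (Suc t)"
        unfolding p_power_mult_I .
    qed (use u u' in \<open>auto intro: unit_mult\<close>)
    finally show ?thesis using I_anti_mono[of t "Suc t"] by simp
  qed
  then show ?thesis by blast
qed

text \<open>\<open>smooth_secant\<close> for a base point \<open>- z\<close> that is only a limit of natural numbers \<open>M\<close>, with \<open>y\<close> the limit
  value of \<open>f\<close> there. The difference quotient at \<open>i\<close> is approximated by the one between \<open>M\<close> and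
  \<open>i + p ^ L (M + 1)\<close>: the shift is negligible, and it takes the argument beyond \<open>M\<close>, as a forward
  expansion at \<open>M\<close> needs. Using one \<open>M\<close> for two arguments reduces the claim to \<open>smooth_secant\<close>.\<close>

lemma smooth_secant_at_limit:
  assumes f: "smooth f" and z: "z \<in> R" "\<And>i. z + of_nat i \<noteq> 0"
    and approx: "\<And>n. \<exists>M. z + of_nat M \<in> I n"
    and lim: "\<And>n M. z + of_nat M \<in> I n \<Longrightarrow> f M - y \<in> I n"
    and y: "y \<in> R"
  shows "lip 1 (\<lambda>i. (y - f i) / (\<pi> * (z + of_nat i)))"
proof -
  define h where "h i = (y - f i) / (\<pi> * (z + of_nat i))" for i
  define s where "s M e = (f (M + Suc e) - f M) / (\<pi> * of_nat (Suc e))" for M e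
  have s: "lip 1 (s M)" for M unfolding s_def[abs_def] by (rule smooth_secant[OF f])
  have near: "\<exists>L0. \<forall>L\<ge>L0. \<forall>M e. z + of_nat M \<in> I L \<longrightarrow> M + Suc e = i + p ^ L * Suc M \<longrightarrow>
      - s M e - h i \<in> I t" for i t
  proof -
    have "\<exists>L. \<forall>N' \<delta>'. N' - (y - f i) \<in> I L \<longrightarrow> \<delta>' - \<pi> * (z + of_nat i) \<in> I L
        \<longrightarrow> N' / \<delta>' - (y - f i) / (\<pi> * (z + of_nat i)) \<in> I t"
      using z p_nonzero
      by (intro quotient_continuous diff_R y smooth_R[OF f] mult_R of_nat_R add_R) auto
    then obtain L0 where L0: "\<And>N' \<delta>'. N' - (y - f i) \<in> I L0 \<Longrightarrow> \<delta>' - \<pi> * (z + of_nat i) \<in> I L0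
        \<Longrightarrow> N' / \<delta>' - (y - f i) / (\<pi> * (z + of_nat i)) \<in> I t" by blast
    have "- s M e - h i \<in> I t" if L: "L \<ge> L0" and M: "z + of_nat M \<in> I L"
      and e: "M + Suc e = i + p ^ L * Suc M" for L M e
    proof -
      have "[i + p ^ L * Suc M = i] (mod p ^ L)" unfolding cong_def by (rule mod_mult_self2)
      then have "f (M + Suc e) - f i \<in> I (L + 1)"
        unfolding e by (rule lip_cong[OF smooth_lip[OF f]])
      then have "f (M + Suc e) - f i \<in> I L" using I_anti_mono[of L "L + 1"] by simp
      from I_diff[OF lim[OF M] this]
      have 1: "(f M - f (M + Suc e)) - (y - f i) \<in> I L" by (simp only: algebra_simps)
      have sum: "of_nat M + of_nat (Suc e) = (of_nat i + of_nat (p ^ L * Suc M) :: 'k)"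
        using arg_cong[OF e, of "of_nat :: nat \<Rightarrow> 'k"] by (simp only: of_nat_add)
      have "u - (z + v) = w - (z + x)" if "x + u = v + w" for u v w x :: 'k
        using that by (simp add: algebra_simps)
      from this[OF sum] have "of_nat (Suc e) - (z + of_nat i) = of_nat (p ^ L * Suc M) - (z + of_nat M)" .
      moreover have "of_nat (p ^ L * Suc M) \<in> I L" unfolding of_nat_I by simp
      ultimately have "of_nat (Suc e) - (z + of_nat i) \<in> I L"
        using M by (simp only:) (rule I_diff)
      then have "\<pi> * (of_nat (Suc e) - (z + of_nat i)) \<in> I L" by (rule I_mult_left[OF of_nat_R])
      then have 2: "\<pi> * of_nat (Suc e) - \<pi> * (z + of_nat i) \<in> I L" by (simp only: right_diff_distrib)
      have "(u - v) / w = - ((v - u) / w)" for u v w :: 'k by (simp add: minus_divide_left)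
      then have "(f M - f (M + Suc e)) / (\<pi> * of_nat (Suc e)) = - s M e" unfolding s_def .
      then show ?thesis using L0[OF I_anti_mono[OF L 1] I_anti_mono[OF L 2]] by (simp only: h_def)
    qed
    then show ?thesis by blast
  qed
  have close: "\<exists>M e e'. - s M e - h i \<in> I t \<and> - s M e' - h j \<in> I t \<and> M + Suc e + j = M + Suc e' + i" for i j t
  proof -
    obtain Li where Li: "\<And>L M e. L \<ge> Li \<Longrightarrow> z + of_nat M \<in> I L \<Longrightarrow> M + Suc e = i + p ^ L * Suc M
        \<Longrightarrow> - s M e - h i \<in> I t" using near[of i t] by blast
    obtain Lj where Lj: "\<And>L M e. L \<ge> Lj \<Longrightarrow> z + of_nat M \<in> I L \<Longrightarrow> M + Suc e = j + p ^ L * Suc M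
        \<Longrightarrow> - s M e - h j \<in> I t" using near[of j t] by blast
    define L where "L = max Li Lj"
    obtain M where M: "z + of_nat M \<in> I L" using approx by blast
    have "1 * Suc M \<le> p ^ L * Suc M" using p_gt_0 by (intro mult_le_mono1) simp
    then obtain x where x: "p ^ L * Suc M = Suc M + x" by (metis le_add_diff_inverse mult_1)
    have "- s M (i + x) - h i \<in> I t" by (rule Li[of L]) (use M x in \<open>auto simp: L_def\<close>)
    moreover have "- s M (j + x) - h j \<in> I t" by (rule Lj[of L]) (use M x in \<open>auto simp: L_def\<close>)
    ultimately show ?thesis by (intro exI[of _ M] exI[of _ "i + x"] exI[of _ "j + x"]) simp
  qed
  have "h i \<in> R" for i
  proof -
    obtain M e where "- s M e - h i \<in> I 0" using close[of i 0 i] by blast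
    then show ?thesis using diff_R[of "- s M e" "- s M e - h i"] uminus_R[OF lip_R[OF s, of M e]] by (simp add: I_0)
  qed
  moreover have "h i - h j \<in> I (r + 1)" if ij: "[i = j] (mod p ^ r)" for i j r
  proof -
    obtain M e e' where e: "- s M e - h i \<in> I (r + 1)" "- s M e' - h j \<in> I (r + 1)" "M + Suc e + j = M + Suc e' + i"
      using close[of i "r + 1" j] by blast
    have "[e + j = e' + j] (mod p ^ r)"
    proof -
      have "e + j = e' + i" using e(3) by linarith
      moreover have "[e' + i = e' + j] (mod p ^ r)" using ij by (simp only: cong_add_lcancel_nat)
      ultimately show ?thesis by simp
    qed
    then have "[e = e'] (mod p ^ r)" by (simp add: cong_add_rcancel_nat)
    then have "s M e - s M e' \<in> I (r + 1)" by (rule lip_cong[OF s])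
    from I_diff[OF I_diff[OF e(2,1)] this] show ?thesis by simp
  qed
  ultimately show ?thesis unfolding lip_def h_def by blast
qed

end

context digit_chain
begin

text \<open>The value of \<open>\<gamma>\<close> at the point \<open>k = l + p M\<close> near \<open>- al s\<close>. By \<open>coprime_poch_Gam\<close> it is
  \<open>- \<Gamma>(a + k)\<^sup>2 \<Gamma>(2a) / (\<Gamma>(a)\<^sup>2 \<Gamma>(2a + k) \<Gamma>(1 + k))\<close>. As \<open>k\<close> tends to \<open>- a\<close>, the first factor tends to 1 and
  \<open>\<Gamma>(2a + k)\<close> to \<open>\<Gamma>(a)\<close>, while \<open>\<Gamma>(a) \<Gamma>(1 + k)\<close> tends to \<open>- (- 1) ^ l\<close> by reflection.\<close>

lemma unit_ratio_limit:
  assumes g1: "\<And>r n. of_nat n - al s \<in> I r \<Longrightarrow> Gam n - g1 \<in> I r"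
    and g2: "\<And>r n. of_nat n - 2 * al s \<in> I r \<Longrightarrow> Gam n - g2 \<in> I r"
    and M: "al (Suc s) + of_nat M \<in> I n"
  shows "\<gamma> s (dig s + p * M) - (- 1) ^ dig s * (g2 / (g1 * g1)) \<in> I n" and "unit g1" and "unit g2"
proof -
  define L where "L = Suc n"
  define k where "k = dig s + p * M"
  have L1: "L \<ge> 1" by (simp add: L_def)
  have "al s + of_nat k = (al s + of_nat (dig s)) + \<pi> * of_nat M" by (simp add: k_def)
  also have "\<dots> = \<pi> * (al (Suc s) + of_nat M)" unfolding al_Suc by (simp add: distrib_left)
  finally have "al s + of_nat k = \<pi> * (al (Suc s) + of_nat M)" .
  then have ak: "al s + of_nat k \<in> I L" using M by (simp add: L_def p_mult_I)
  \<comment> \<open>A multiple of \<open>p ^ L\<close> exceeding \<open>k\<close>, so that \<open>P - k\<close> is a natural number close to \<open>al s\<close>.\<close>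
  define P where "P = p ^ L * Suc k"
  have "1 * Suc k \<le> p ^ L * Suc k" using p_gt_0 by (intro mult_le_mono1) simp
  then have kP: "k < P" by (simp add: P_def)
  have PL: "p ^ L dvd P" by (simp add: P_def)
  define m where "m = P - k"
  have mk: "m + k = P" using kP by (simp add: m_def)
  have m1: "of_nat m - al s \<in> I L"
  proof -
    have "of_nat m + of_nat k = (of_nat P :: 'k)" by (simp only: mk of_nat_add[symmetric])
    then have e: "of_nat m - al s = of_nat P - (al s + of_nat k)" by (simp add: algebra_simps)
    show ?thesis unfolding e by (rule I_diff[OF _ ak]) (use PL in \<open>simp only: of_nat_I\<close>)
  qed
  have m2: "of_nat (2 * m) - 2 * al s \<in> I L"
    using I_add[OF m1 m1] by (simp add: algebra_simps)
  have G1: "Gam m - g1 \<in> I L" by (rule g1[OF m1])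
  have G2: "Gam (2 * m) - g2 \<in> I L" by (rule g2[OF m2])
  show ug1: "unit g1" using unit_cong[OF Gam_unit G1[unfolded L_def]] .
  show ug2: "unit g2" using unit_cong[OF Gam_unit G2[unfolded L_def]] .
  have Ua: "coprime_poch (al s) (dig s) k - (- 1) ^ k * (Gam P / Gam m) \<in> I L"
    using coprime_poch_Gam[OF residue_al m1 L1, of k] by (simp only: mk)
  have U2: "coprime_poch (2 * al s) (2 * dig s) k - (- 1) ^ k * (Gam (m + P) / Gam (2 * m)) \<in> I L"
  proof -
    have "2 * m + k = m + P" using mk by simp
    then show ?thesis using coprime_poch_Gam[OF residue_al2 m2 L1, of k] by (simp only:)
  qed
  have U1: "coprime_poch 1 (p - 1) k - (- 1) ^ k * (Gam (1 + k) / Gam 1) \<in> I L"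
    using coprime_poch_Gam[OF residue_1 _ L1, of 1 k] by (simp add: I_zero)
  have GP: "Gam P - 1 \<in> I L" using lip_cong[OF lip_Gam, of P 0 L] PL by (simp add: cong_0_iff)
  have GmP: "Gam (m + P) - g1 \<in> I L"
  proof -
    have "[m + P = m] (mod p ^ L)" unfolding P_def cong_def by (rule mod_mult_self2)
    then have "Gam (m + P) - Gam m \<in> I (L + 0)" by (rule lip_cong[OF lip_Gam])
    then show ?thesis using I_trans[OF _ G1] by simp
  qed
  \<comment> \<open>\<open>k - M = l + (p - 1) M\<close>, and \<open>p - 1\<close> is even.\<close>
  have sgn: "(- 1 :: 'k) ^ (k - k div p) = (- 1) ^ dig s"
  proof -
    have "k div p = M" using dig_less[of s] p_gt_0 by (simp add: k_def)
    moreover have "p * M = (p - 1) * M + M" using p_gt_0 by (cases p) auto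
    ultimately have "k - k div p = dig s + (p - 1) * M" by (simp add: k_def)
    then show ?thesis using p_odd by (simp add: power_add power_mult)
  qed
  have refl: "Gam m * Gam (Suc k) - - ((- 1) ^ dig s) \<in> I L"
    using Gam_reflection[OF PL L1 kP] by (simp add: sgn m_def)
  define \<eta> :: 'k where "\<eta> = (- 1) ^ k"
  define \<theta> :: 'k where "\<theta> = (- 1) ^ dig s"
  have \<eta>: "unit \<eta>" "\<eta> * \<eta> = 1" and \<theta>: "unit \<theta>" "\<theta> * \<theta> = 1"
    unfolding \<eta>_def \<theta>_def
    by (intro unit_power unit_uminus unit_1, simp flip: power_mult_distrib)+
  note units = Gam_unit ug1 ug2 unit_mult unit_divide \<eta>(1) \<theta>(1) unit_uminus unit_1 unit_power
  have Uk: "Gam (Suc k) - - (\<theta> / g1) \<in> I L"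
  proof -
    have "(Gam m * Gam (Suc k)) / Gam m - - \<theta> / g1 \<in> I L"
      using refl G1 by (intro cong_divide_I units unit_R) (simp_all add: \<theta>_def)
    then show ?thesis using unit_nonzero[OF Gam_unit[of m]] by simp
  qed
  have 1: "coprime_poch (al s) (dig s) k - \<eta> * (1 / g1) \<in> I L"
  proof (rule I_trans[OF Ua[folded \<eta>_def]])
    show "\<eta> * (Gam P / Gam m) - \<eta> * (1 / g1) \<in> I L"
      using GP G1 by (intro cong_mult_I cong_divide_I) (auto simp: I_zero intro!: unit_R units)
  qed
  have 2: "coprime_poch (2 * al s) (2 * dig s) k - \<eta> * (g1 / g2) \<in> I L"
  proof (rule I_trans[OF U2[folded \<eta>_def]])
    show "\<eta> * (Gam (m + P) / Gam (2 * m)) - \<eta> * (g1 / g2) \<in> I L"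
      using GmP G2 by (intro cong_mult_I cong_divide_I) (auto simp: I_zero intro!: unit_R units)
  qed
  have 3: "coprime_poch 1 (p - 1) k - \<eta> * (\<theta> / g1) \<in> I L"
  proof (rule I_trans[OF U1[folded \<eta>_def]])
    have "Gam 1 = -1" using Gam_Suc[of 0] by simp
    then have e: "Gam (1 + k) / Gam 1 - \<theta> / g1 = - (Gam (Suc k) - - (\<theta> / g1))" by simp
    have "Gam (1 + k) / Gam 1 - \<theta> / g1 \<in> I L" unfolding e by (rule I_uminus[OF Uk])
    then show "\<eta> * (Gam (1 + k) / Gam 1) - \<eta> * (\<theta> / g1) \<in> I L"
      by (intro cong_mult_I) (auto simp: I_zero intro!: unit_R units)
  qed
  have "\<gamma> s k - (\<eta> * (1 / g1))^2 / (\<eta> * (\<theta> / g1) * (\<eta> * (g1 / g2))) \<in> I L"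
    unfolding unit_ratio_def power2_eq_square
    by (intro cong_divide_I cong_mult_I 1 2 3 unit_mult coprime_poch_unit residue_al residue_1 residue_al2 units)
       (auto intro!: unit_R units coprime_poch_unit residue_al residue_1 residue_al2)
  also have "(\<eta> * (1 / g1))^2 / (\<eta> * (\<theta> / g1) * (\<eta> * (g1 / g2))) = \<theta> * (g2 / (g1 * g1))"
  proof -
    have "\<theta> \<noteq> 0" "\<eta> \<noteq> 0" "g1 \<noteq> 0" "g2 \<noteq> 0" using \<eta>(1) \<theta>(1) ug1 ug2 unit_nonzero by auto
    then have "(\<eta> * (1 / g1))^2 / (\<eta> * (\<theta> / g1) * (\<eta> * (g1 / g2))) = (1 / \<theta>) * (g2 / (g1 * g1))"
      by (simp add: power2_eq_square)
    moreover have "1 / \<theta> = \<theta>" using \<theta>(2) \<open>\<theta> \<noteq> 0\<close> by (simp add: divide_eq_eq)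
    ultimately show ?thesis by simp
  qed
  finally have "\<gamma> s k - \<theta> * (g2 / (g1 * g1)) \<in> I L" .
  then show "\<gamma> s (dig s + p * M) - (- 1) ^ dig s * (g2 / (g1 * g1)) \<in> I n"
    using I_anti_mono[of n L] by (simp add: L_def k_def \<theta>_def)
qed

end

section \<open>The congruence for series of logarithmic type\<close>

context odd_padic_field
begin

lemma smooth_power:
  assumes c: "c - 1 \<in> I 1"
  shows "smooth (\<lambda>m. c ^ m)"
proof (rule smooth_recursion[where u = "\<lambda>_. (c - 1) / \<pi>"])
  have "c \<in> R" using add_R[OF I_R[OF c] one_R] by simp
  then show "c ^ i \<in> R" for i by (rule power_R)
  show "c ^ Suc i = c ^ i * (1 + \<pi> * ((c - 1) / \<pi>))" for i using p_nonzero by simp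
  show "smooth (\<lambda>_. (c - 1) / \<pi>)" using c by (intro smooth_const) (simp add: I_def)
qed

end

context digit_chain
begin

text \<open>Here \<open>g1\<close> and \<open>g2\<close> play the role of \<open>\<Gamma>(a)\<close> and \<open>\<Gamma>(2a)\<close>, and \<open>q\<close> that of \<open>c ^ a'\<close>. In the residue class of \<open>l\<close>
  the function \<open>f i = \<epsilon> c ^ (a' + i) / \<gamma> (l + p i)\<close> is smooth, and it tends to 1 at \<open>- a'\<close> because \<open>\<epsilon>\<close> is the
  limit of \<open>\<gamma>\<close> there.\<close>

theorem log_type_congruence:
  fixes s
  defines "l \<equiv> dig s"
  assumes g1: "\<And>r n. of_nat n - al s \<in> I r \<Longrightarrow> Gam n - g1 \<in> I r"
    and g2: "\<And>r n. of_nat n - 2 * al s \<in> I r \<Longrightarrow> Gam n - g2 \<in> I r"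
    and c: "c - 1 \<in> I 1"
    and q: "\<And>r n. of_nat n - al (Suc s) \<in> I r \<Longrightarrow> c ^ n - q \<in> I r"
    and \<epsilon>: "\<epsilon> = (- 1) ^ l * (g2 / (g1 * g1))"
    and B: "\<And>k. B k = (A s k - \<epsilon> * q * (if l \<le> k \<and> p dvd k - l
      then A (Suc s) ((k - l) div p) * c ^ ((k - l) div p) else 0)) / (of_nat k + al s)"
  shows "bracket (p ^ n) (A_fps s) (Abs_fps B) \<in> I_fps n"
proof (rule bracket_congruence)
  fix \<rho> assume \<rho>: "\<rho> < p"
  show "splits_at s \<rho> (A s)" by (rule admissible_splits[OF admissible_hyp \<rho>])
  have two: "smooth (\<lambda>i. (2 * al s + of_nat \<rho>) + \<pi> * of_nat i)"
    by (intro smooth_linear add_R al2_R of_nat_R)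
  have ne2: "2 * al s + of_nat (\<rho> + p * i) \<noteq> 0" for i by (rule al2_nonzero)
  have l: "l < p" using dig_less[of s] by (simp add: l_def)
  show "splits_at s \<rho> B"
  proof (cases "\<rho> = l")
    case False
    \<comment> \<open>The numerator cancels the denominator built into \<open>splits_at_hyp_times\<close>.\<close>
    define \<psi> where "\<psi> i = ((2 * al s + of_nat \<rho>) + \<pi> * of_nat i) / ((al s + of_nat \<rho>) + \<pi> * of_nat i)" for i
    have d: "(al s + of_nat \<rho>) + \<pi> * of_nat i = al s + of_nat (\<rho> + p * i)" for i by simp
    have u: "unit (al s + of_nat (\<rho> + p * i))" for i
      by (rule residue_unit[OF residue_al]) (use False \<rho> in \<open>simp add: l_def\<close>)
    show ?thesis
    proof (rule splits_at_hyp_times[OF \<rho>])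
      show "lip 1 \<psi>" unfolding \<psi>_def[abs_def]
        by (intro lip_divide smooth_lip two smooth_linear add_R al_R of_nat_R) (simp only: d u)
      fix i
      have n: "\<not> (l \<le> \<rho> + p * i \<and> p dvd \<rho> + p * i - l)"
      proof
        assume "l \<le> \<rho> + p * i \<and> p dvd \<rho> + p * i - l"
        then have "[\<rho> + p * i = l] (mod p)" by (simp add: cong_altdef_nat)
        then show False using False \<rho> l by (simp add: cong_def)
      qed
      have "B (\<rho> + p * i) = A s (\<rho> + p * i) / (al s + of_nat (\<rho> + p * i))"
        unfolding B if_not_P[OF n] by (simp add: add.commute)
      moreover have "\<psi> i = (2 * al s + of_nat (\<rho> + p * i)) / (al s + of_nat (\<rho> + p * i))"
        by (simp add: \<psi>_def add.assoc)
      ultimately show "B (\<rho> + p * i) = A s (\<rho> + p * i) * \<psi> i / (2 * al s + of_nat (\<rho> + p * i))"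
        using ne2[of i] by (simp del: of_nat_add)
    qed
  next
    case True
    obtain M0 where "al (Suc s) + of_nat M0 \<in> I 0" using al_approx by blast
    have ur: "\<gamma> s (l + p * M) - \<epsilon> \<in> I r" "unit g1" "unit g2"
      if "al (Suc s) + of_nat M \<in> I r" for M r
      unfolding \<epsilon> l_def using unit_ratio_limit[of s g1 g2 M r] g1 g2 that by blast+
    have ug: "unit g1" "unit g2" using ur(2,3)[OF \<open>al (Suc s) + of_nat M0 \<in> I 0\<close>] by auto
    have u\<epsilon>: "unit \<epsilon>" unfolding \<epsilon> by (intro unit_mult unit_power unit_uminus unit_1 unit_divide ug)
    have cR: "c \<in> R" using add_R[OF I_R[OF c] one_R] by simp
    have qR: "q \<in> R"
    proof -
      have "c ^ 0 - q \<in> I 0" by (rule q) (simp add: I_0 uminus_R al_R)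
      then show ?thesis using diff_R[OF one_R, of "1 - q"] by (simp add: I_0)
    qed
    define f where "f m = \<epsilon> * q * c ^ m * inverse (\<gamma> s (l + p * m))" for m
    have f: "smooth f" unfolding f_def[abs_def]
      by (intro smooth_mult smooth_const smooth_inverse smooth_power c qR unit_R[OF u\<epsilon>] smooth_\<gamma> unit_\<gamma>)
    have f1: "f M - 1 \<in> I r" if M: "al (Suc s) + of_nat M \<in> I r" for M r
    proof -
      have g: "\<gamma> s (l + p * M) - \<epsilon> \<in> I r" by (rule ur(1)[OF M])
      have "1 * Suc M \<le> p ^ r * Suc M" using p_gt_0 by (intro mult_le_mono1) simp
      then obtain N where N: "M + N = p ^ r * Suc M" by (metis le_add_diff_inverse le_trans mult_1 le_SucI order.refl)
      have "of_nat M + of_nat N = (of_nat (p ^ r * Suc M) :: 'k)" by (simp only: N of_nat_add[symmetric])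
      then have "of_nat N - al (Suc s) = of_nat (p ^ r * Suc M) - (al (Suc s) + of_nat M)"
        by (simp only: diff_eq_eq) (simp add: algebra_simps)
      also have "\<dots> \<in> I r" by (rule I_diff[OF _ M]) (simp only: of_nat_I dvd_triv_left)
      finally have "c ^ N - q \<in> I r" by (rule q)
      then have "c ^ M * (c ^ N - q) \<in> I r" by (rule I_mult_left[OF power_R[OF cR]])
      moreover have "c ^ (M + N) - c ^ 0 \<in> I r"
        by (rule I_anti_mono[OF _ lip_cong[OF smooth_lip[OF smooth_power[OF c]]], of r r]) (simp_all add: N cong_0_iff)
      ultimately have "(c ^ (M + N) - c ^ 0) - c ^ M * (c ^ N - q) \<in> I r" by (rule I_diff[rotated])
      then have "q * c ^ M - 1 \<in> I r" by (simp add: power_add algebra_simps)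
      then have "\<epsilon> * (q * c ^ M) / \<gamma> s (l + p * M) - \<epsilon> * 1 / \<epsilon> \<in> I r"
        using g mult_R[OF qR power_R[OF cR, of M]] unit_R[OF u\<epsilon>] u\<epsilon> unit_\<gamma>[of s]
        by (intro cong_divide_I cong_mult_I) (simp_all add: I_zero)
      then show ?thesis using unit_nonzero[OF u\<epsilon>] by (simp add: f_def divide_inverse mult_ac)
    qed
    define h where "h i = (1 - f i) / (\<pi> * (al (Suc s) + of_nat i))" for i
    have h: "lip 1 h" unfolding h_def[abs_def]
      by (rule smooth_secant_at_limit[OF f al_R al_nonzero al_approx f1 one_R])
    show ?thesis
    proof (rule splits_at_hyp_times[OF \<rho>])
      show "lip 1 (\<lambda>i. ((2 * al s + of_nat \<rho>) + \<pi> * of_nat i) * h i)"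
        by (intro lip_mult smooth_lip[OF two] h)
      fix i
      have e: "of_nat (l + p * i) + al s = \<pi> * (al (Suc s) + of_nat i)"
      proof -
        have "of_nat (l + p * i) + al s = (al s + of_nat (dig s)) + \<pi> * of_nat i" by (simp add: l_def)
        then show ?thesis unfolding al_Suc by (simp add: distrib_left)
      qed
      have Al: "A s (l + p * i) = \<gamma> s (l + p * i) * A (Suc s) i"
        unfolding l_def by (subst hyp_split[OF dig_less al_Suc]) (use l in \<open>auto simp: l_def\<close>)
      have "B (l + p * i) = (A s (l + p * i) - \<epsilon> * q * (A (Suc s) i * c ^ i)) / (\<pi> * (al (Suc s) + of_nat i))"
        unfolding B e using p_gt_0 by simp
      also have "A s (l + p * i) - \<epsilon> * q * (A (Suc s) i * c ^ i) = A s (l + p * i) * (1 - f i)"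
        unfolding Al f_def using unit_nonzero[OF unit_\<gamma>[of s "l + p * i"]] by (simp add: field_simps)
      finally have "B (l + p * i) = A s (l + p * i) * h i" by (simp add: h_def)
      moreover have "(2 * al s + of_nat \<rho>) + \<pi> * of_nat i = 2 * al s + of_nat (l + p * i)" using True by simp
      ultimately show "B (\<rho> + p * i) = A s (\<rho> + p * i) * (((2 * al s + of_nat \<rho>) + \<pi> * of_nat i) * h i)
          / (2 * al s + of_nat (\<rho> + p * i))"
        using ne2[of i] True by (simp only:) simp
    qed
  qed
qed

end

section \<open>Witt vectors over a perfect field\<close>

text \<open>Ghost components determine Witt components modulo \<open>p\<close>, as soon as the \<open>n\<close>-th one is known modulo
  \<open>p ^ (n + 1)\<close>.\<close>

lemma ghost_cong_imp:
  fixes x y :: "nat \<Rightarrow> 'v zpoly"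
  assumes p: "prime p" and g: "\<And>n. of_nat p ^ Suc n dvd ghost p n x - ghost p n y"
  shows "of_nat p dvd x n - y n"
proof (induction n rule: less_induct)
  case (less n)
  have p0: "p > 0" using p by (simp add: prime_gt_0_nat)
  have "of_nat p ^ Suc n dvd (\<Sum>i<n. of_nat p ^ i * (x i ^ p ^ (n - i) - y i ^ p ^ (n - i)))"
  proof (rule dvd_sum)
    fix i assume i: "i \<in> {..<n}"
    then have "of_nat p ^ Suc (n - i) dvd x i ^ p ^ (n - i) - y i ^ p ^ (n - i)"
      by (intro dvd_power_diff less) simp
    then have "of_nat p ^ i * of_nat p ^ Suc (n - i) dvd of_nat p ^ i * (x i ^ p ^ (n - i) - y i ^ p ^ (n - i))"
      by (intro mult_dvd_mono dvd_refl)
    moreover have "i + Suc (n - i) = Suc n" using i by simp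
    ultimately show "of_nat p ^ Suc n dvd of_nat p ^ i * (x i ^ p ^ (n - i) - y i ^ p ^ (n - i))"
      by (simp only: power_add[symmetric])
  qed
  from dvd_diff[OF g[of n] this]
  have "of_nat p ^ Suc n dvd of_nat p ^ n * (x n - y n)"
    by (simp add: ghost_def lessThan_Suc_atMost[symmetric] algebra_simps sum_subtractf)
  then show ?case using p0 by (rule zpoly_dvd_cancel)
qed

text \<open>The multiple \<open>k x\<close> as an iterated Witt sum, over an arbitrary ring: identities are proved over
  integer polynomials and specialised from there.\<close>

primrec wtimes :: "nat \<Rightarrow> nat \<Rightarrow> (nat \<Rightarrow> 'a::comm_ring_1) \<Rightarrow> nat \<Rightarrow> 'a" where
  "wtimes p 0 x = (\<lambda>_. 0)"
| "wtimes p (Suc k) x = wadd p x (wtimes p k x)"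

lemma ghost_wtimes: "prime p \<Longrightarrow> ghost p n (wtimes p k x) = of_nat k * ghost p n x"
  by (induction k) (simp_all add: ghost_0 ghost_wadd prime_gt_0_nat algebra_simps)

lemma wtimes_hom:
  assumes "comm_ring_hom h"
  shows "wtimes p k (\<lambda>i. h (x i)) = (\<lambda>i. h (wtimes p k x i))"
proof (induction k)
  case 0
  interpret comm_ring_hom h by fact
  show ?case by simp
qed (simp add: wadd_hom[OF assms])

text \<open>Frobenius followed by Verschiebung.\<close>

definition frob_shift :: "nat \<Rightarrow> (nat \<Rightarrow> 'a::comm_ring_1) \<Rightarrow> nat \<Rightarrow> 'a" where
  "frob_shift p x n = (case n of 0 \<Rightarrow> 0 | Suc m \<Rightarrow> x m ^ p)"

lemma ghost_frob_shift:
  assumes "prime p"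
  shows "of_nat p * ghost p n x - ghost p n (frob_shift p x) = of_nat p ^ Suc n * x n"
proof (cases n)
  case 0
  then show ?thesis using assms by (simp add: ghost_def frob_shift_def prime_gt_0_nat)
next
  case (Suc m)
  have "ghost p n (frob_shift p x) = (\<Sum>i\<le>m. of_nat p ^ Suc i * (x i ^ p) ^ p ^ (m - i))"
    unfolding ghost_def Suc by (subst sum.atMost_Suc_shift) (use assms in \<open>simp add: frob_shift_def power_0_left prime_gt_0_nat\<close>)
  also have "\<dots> = (\<Sum>i\<le>m. of_nat p * (of_nat p ^ i * x i ^ p ^ (n - i)))"
    by (intro sum.cong) (auto simp: Suc Suc_diff_le mult_ac simp flip: power_mult)
  finally show ?thesis
    by (simp add: ghost_def Suc sum_distrib_left distrib_left mult.assoc)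
qed

text \<open>In characteristic \<open>p\<close>, multiplication by \<open>p\<close> is Frobenius followed by Verschiebung, since over the
  integer polynomials the ghost components of the two agree to the order needed in \<open>ghost_cong_imp\<close>.\<close>

lemma wtimes_p:
  fixes x :: "nat \<Rightarrow> 'a::comm_ring_1"
  assumes p: "prime p" "of_nat p = (0 :: 'a)"
  shows "wtimes p p x = frob_shift p x"
proof
  fix n
  obtain u where u: "x = (\<lambda>i. zquot (u i))" by (rule zquot_lift)
  interpret h: comm_ring_hom "zquot :: 'a zpoly \<Rightarrow> 'a" by (rule zquot_homs)
  have "of_nat p dvd wtimes p p u n - frob_shift p u n"
    by (rule ghost_cong_imp[OF p(1)]) (simp only: ghost_wtimes[OF p(1)] ghost_frob_shift[OF p(1)] dvd_triv_left)
  then obtain q where q: "wtimes p p u n - frob_shift p u n = of_nat p * q" ..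
  have "zquot (wtimes p p u n - frob_shift p u n) = 0"
    unfolding q by (simp add: h.hom_of_nat p(2))
  then have "zquot (wtimes p p u n) = zquot (frob_shift p u n)"
    by (simp only: h.hom_minus right_minus_eq)
  moreover have "zquot (frob_shift p u n) = frob_shift p x n"
    by (auto simp: frob_shift_def u h.hom_power split: nat.splits)
  moreover have "wtimes p p x n = zquot (wtimes p p u n)"
    unfolding u wtimes_hom[OF zquot_homs] ..
  ultimately show "wtimes p p x n = frob_shift p x n" by simp
qed

text \<open>Over the integer polynomials, the ghost components up to the \<open>i\<close>-th are determined by the Witt
  components up to the \<open>i\<close>-th, and conversely.\<close>

lemma wadd_truncate:
  fixes x x' y :: "nat \<Rightarrow> 'a::comm_ring_1"
  assumes p: "prime p" and eq: "\<And>i. i < n \<Longrightarrow> x i = x' i" and "i < n"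
  shows "wadd p x y i = wadd p x' y i"
proof -
  define u where "u i = zvar (x i)" for i
  define u' where "u' i = zvar (x' i)" for i
  define v where "v i = zvar (y i)" for i
  have lift: "x = (\<lambda>i. zquot (u i))" "x' = (\<lambda>i. zquot (u' i))" "y = (\<lambda>i. zquot (v i))"
    by (auto simp: u_def u'_def v_def)
  have uu: "u i = u' i" if "i < n" for i using eq[OF that] by (simp add: u_def u'_def)
  have "wadd p u v i = wadd p u' v i" if "i < n" for i
    using that
  proof (induction i rule: less_induct)
    case (less i)
    have "ghost p i u = ghost p i u'" unfolding ghost_def
      by (intro sum.cong) (use less.prems uu in auto)
    then have "ghost p i (wadd p u v) = ghost p i (wadd p u' v)" by (simp add: ghost_wadd[OF p])
    moreover have "(\<Sum>j<i. of_nat p ^ j * wadd p u v j ^ (p ^ (i - j)))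
        = (\<Sum>j<i. of_nat p ^ j * wadd p u' v j ^ (p ^ (i - j)))"
      using less by (intro sum.cong) auto
    ultimately have "of_nat (p ^ i) * wadd p u v i = of_nat (p ^ i) * wadd p u' v i"
      by (simp add: ghost_def lessThan_Suc_atMost[symmetric])
    then show ?case using p zpoly_mult_cancel[of "p ^ i"] by (simp add: prime_gt_0_nat)
  qed
  then have "zquot (wadd p u v i) = zquot (wadd p u' v i)" using assms(3) by simp
  then show ?thesis
    unfolding lift wadd_hom[OF zquot_homs] .
qed

lemma witt_nth_of_nat_mult: "witt_nth (of_nat n * x) = wtimes CHAR('k) n (witt_nth (x :: 'k::comm_ring_prime_char witt))"
  by (induction n) (simp_all add: zero_witt.rep_eq distrib_right plus_witt.rep_eq)

lemma witt_nth_p_mult: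
  "witt_nth (of_nat CHAR('k) * x) = frob_shift CHAR('k) (witt_nth (x :: 'k::comm_ring_prime_char witt))"
  unfolding witt_nth_of_nat_mult by (rule wtimes_p) simp_all

lemma witt_nth_p_power_mult:
  "witt_nth (of_nat CHAR('k) ^ n * x) i = (if i < n then 0 else witt_nth (x :: 'k::comm_ring_prime_char witt) (i - n) ^ CHAR('k) ^ n)"
proof (induction n arbitrary: i)
  case (Suc n)
  have "witt_nth (of_nat CHAR('k) ^ Suc n * x) i = frob_shift CHAR('k) (witt_nth (of_nat CHAR('k) ^ n * x)) i"
    by (simp add: mult.assoc witt_nth_p_mult)
  then show ?case
    unfolding frob_shift_def Suc
    by (auto simp: power_mult[symmetric] mult.commute[of "CHAR('k) ^ n"] power_0_left prime_gt_0_nat split: nat.splits)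
qed simp

lemma witt_nth_diff_0_iff:
  "(\<forall>i<n. witt_nth (x - y :: 'k::comm_ring_prime_char witt) i = 0) \<longleftrightarrow> (\<forall>i<n. witt_nth x i = witt_nth y i)"
proof -
  have p: "prime CHAR('k)" by simp
  have tr: "witt_nth (u + w) i = witt_nth (v + w) i"
    if "\<And>i. i < n \<Longrightarrow> witt_nth u i = witt_nth v i" "i < n" for u v w :: "'k witt" and i
    unfolding plus_witt.rep_eq by (rule wadd_truncate[OF p that])
  show ?thesis
  proof
    assume "\<forall>i<n. witt_nth (x - y) i = 0"
    then have "witt_nth (x - y) i = witt_nth 0 i" if "i < n" for i using that by (simp add: zero_witt.rep_eq)
    from tr[OF this, of _ y] show "\<forall>i<n. witt_nth x i = witt_nth y i" by simp
  next
    assume "\<forall>i<n. witt_nth x i = witt_nth y i"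
    then have "witt_nth (x + - y) i = witt_nth (y + - y) i" if "i < n" for i using that by (intro tr) auto
    then show "\<forall>i<n. witt_nth (x - y) i = 0" by (simp add: zero_witt.rep_eq)
  qed
qed

lemma witt_nth_mult_0: "witt_nth (x * y :: 'k::comm_ring_prime_char witt) 0 = witt_nth x 0 * witt_nth y 0"
  using ghost_wmult[of "CHAR('k)" 0 "witt_nth x" "witt_nth y"] by (simp add: ghost_def times_witt.rep_eq)

text \<open>Multiplication by \<open>p ^ n\<close> shifts by \<open>n\<close> places and raises components to the power \<open>p ^ n\<close>; over an
  algebraically closed field that power map is onto.\<close>

lemma p_power_dvd_iff:
  fixes x :: "'p::prime_card W"
  shows "of_nat CARD('p) ^ n dvd x \<longleftrightarrow> (\<forall>i<n. witt_nth x i = 0)"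
proof
  assume "of_nat CARD('p) ^ n dvd x"
  then obtain y where "x = of_nat CARD('p) ^ n * y" ..
  then show "\<forall>i<n. witt_nth x i = 0"
    using witt_nth_p_power_mult[where 'k = "'p mod_ring alg_closure", of n y] by simp
next
  assume 0: "\<forall>i<n. witt_nth x i = 0"
  have "\<forall>i. \<exists>r. r ^ (CARD('p) ^ n) = witt_nth x (i + n)"
    by (intro allI nth_root_exists) simp
  then obtain r where r: "\<And>i. r i ^ (CARD('p) ^ n) = witt_nth x (i + n)" by metis
  have "witt_nth x i = witt_nth (of_nat CARD('p) ^ n * Abs_witt r) i" for i
    using witt_nth_p_power_mult[where 'k = "'p mod_ring alg_closure", of n "Abs_witt r" i] 0 r[of "i - n"]
    by (simp add: Abs_witt_inverse)
  then have "x = of_nat CARD('p) ^ n * Abs_witt r"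
    by (metis witt_nth_inject ext)
  then show "of_nat CARD('p) ^ n dvd x" by simp
qed

lemma p_power_dvd_diff_iff:
  fixes x y :: "'p::prime_card W"
  shows "of_nat CARD('p) ^ n dvd x - y \<longleftrightarrow> (\<forall>i<n. witt_nth x i = witt_nth y i)"
  unfolding p_power_dvd_iff by (rule witt_nth_diff_0_iff)

lemma p_nonzero_W: "of_nat CARD('p) \<noteq> (0 :: 'p::prime_card W)"
proof
  assume "of_nat CARD('p) = (0 :: 'p W)"
  then have "of_nat CARD('p) ^ 2 dvd (of_nat CARD('p) :: 'p W)" by simp
  moreover have "witt_nth (of_nat CARD('p) * (1 :: 'p W)) 1 = 1"
    using witt_nth_p_mult[where 'k = "'p mod_ring alg_closure", of 1]
    by (simp add: frob_shift_def one_witt.rep_eq wone_def)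
  ultimately show False using p_power_dvd_iff[of 2 "of_nat CARD('p) :: 'p W"] by simp
qed

lemma eq_0_W:
  fixes x :: "'p::prime_card W"
  assumes "\<And>n. of_nat CARD('p) ^ n dvd x"
  shows "x = 0"
proof -
  have "witt_nth x i = witt_nth 0 i" for i
    using assms[of "Suc i"] unfolding p_power_dvd_iff by (simp add: zero_witt.rep_eq)
  then show ?thesis by (metis witt_nth_inject ext)
qed

text \<open>Components stabilise, by \<open>p_power_dvd_diff_iff\<close>.\<close>

lemma complete_W:
  fixes v :: "nat \<Rightarrow> 'p::prime_card W"
  assumes "\<And>n. of_nat CARD('p) ^ n dvd v (Suc n) - v n"
  shows "\<exists>L. \<forall>n. of_nat CARD('p) ^ n dvd v n - L"
proof (intro exI allI)
  fix n
  define L where "L = Abs_witt (\<lambda>i. witt_nth (v (Suc i)) i)"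
  have stab: "witt_nth (v (Suc i + k)) i = witt_nth (v (Suc i)) i" for i k
  proof (induction k)
    case (Suc k)
    have "witt_nth (v (Suc (Suc i + k))) i = witt_nth (v (Suc i + k)) i"
      using assms[of "Suc i + k"] unfolding p_power_dvd_diff_iff by simp
    then show ?case using Suc by simp
  qed simp
  have "witt_nth (v n) i = witt_nth L i" if "i < n" for i
    using stab[of i "n - Suc i"] that by (simp add: L_def Abs_witt_inverse)
  then show "of_nat CARD('p) ^ n dvd v n - Abs_witt (\<lambda>i. witt_nth (v (Suc i)) i)"
    unfolding p_power_dvd_diff_iff L_def by blast
qed

text \<open>The 0-th component is a ring homomorphism onto the residue field, so \<open>x\<close> has an inverse modulo \<open>p\<close>;
  a geometric series corrects it.\<close>

lemma unit_W:
  fixes x :: "'p::prime_card W"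
  assumes "\<not> of_nat CARD('p) dvd x"
  shows "\<exists>y. x * y = 1"
proof -
  have x0: "witt_nth x 0 \<noteq> 0" using assms p_power_dvd_iff[of 1 x] by simp
  define y0 :: "'p W" where "y0 = Abs_witt (\<lambda>_. inverse (witt_nth x 0))"
  have "witt_nth (x * y0) 0 = 1" using x0 by (simp add: witt_nth_mult_0 y0_def Abs_witt_inverse)
  then have "of_nat CARD('p) ^ 1 dvd 1 - x * y0"
    unfolding p_power_dvd_diff_iff by (simp add: one_witt.rep_eq wone_def)
  then obtain t where t: "1 - x * y0 = of_nat CARD('p) * t" by auto
  define z where "z = of_nat CARD('p) * t"
  have "of_nat CARD('p) ^ n dvd (\<Sum>i<Suc n. z ^ i) - (\<Sum>i<n. z ^ i)" for n
    by (simp add: z_def power_mult_distrib)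
  then obtain L where L: "\<And>n. of_nat CARD('p) ^ n dvd (\<Sum>i<n. z ^ i) - L"
    using complete_W[of "\<lambda>n. \<Sum>i<n. z ^ i"] by blast
  have "of_nat CARD('p) ^ n dvd (1 - z) * L - 1" for n
  proof -
    have "(1 - z) * L - 1 = - (1 - z) * ((\<Sum>i<n. z ^ i) - L) + ((1 - z) * (\<Sum>i<n. z ^ i) - 1)"
      by (simp add: algebra_simps)
    also have "(1 - z) * (\<Sum>i<n. z ^ i) = 1 - z ^ n" by (rule one_diff_power_eq[symmetric])
    also have "of_nat CARD('p) ^ n dvd - (1 - z) * ((\<Sum>i<n. z ^ i) - L) + (1 - z ^ n - 1)"
      by (intro dvd_add dvd_mult L) (simp add: z_def power_mult_distrib)
    finally show ?thesis .
  qed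
  then have "(1 - z) * L = 1" using eq_0_W[of "(1 - z) * L - 1"] by simp
  moreover have "1 - z = x * y0" using t by (simp add: z_def algebra_simps)
  ultimately have "x * (y0 * L) = 1" by (simp add: mult.assoc)
  then show ?thesis by blast
qed

lemma to_fract_of_nat: "to_fract (of_nat n) = of_nat n"
  by (induction n) simp_all

lemma to_fract_power: "to_fract (x ^ n) = to_fract x ^ n"
  by (induction n) simp_all

lemma p_nonzero_K: "of_nat CARD('p) \<noteq> (0 :: 'p::prime_card K)"
  using p_nonzero_W[where 'p = 'p] by (metis to_fract_of_nat to_fract_eq_0_iff)

lemma pow_ideal_0: "pow_ideal 0 = range (to_fract :: 'p::prime_card W \<Rightarrow> _)"
  by (simp add: pow_ideal_def)

lemma divide_pow_ideal: "x / of_nat CARD('p) ^ n \<in> pow_ideal 0 \<longleftrightarrow> x \<in> (pow_ideal n :: 'p::prime_card K set)"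
  using p_nonzero_K[where 'p = 'p] by (auto simp: pow_ideal_def field_simps image_iff)

lemma to_fract_pow_ideal: "to_fract x \<in> pow_ideal n \<longleftrightarrow> of_nat CARD('p) ^ n dvd (x :: 'p::prime_card W)"
  by (auto simp: pow_ideal_def dvd_def image_iff to_fract_power[symmetric] to_fract_of_nat[symmetric]
      simp flip: to_fract_mult)

text \<open>In the completeness axiom only the differences of the sequence are known to lie in \<open>W\<close>; subtracting
  the first term brings the sequence itself into \<open>W\<close>.\<close>

interpretation W: padic_field "CARD('p)" "pow_ideal 0 :: 'p::prime_card K set"
proof
  show "normalization_semidom_class.prime CARD('p)" by (rule prime_card)
  show "of_nat CARD('p) \<noteq> (0 :: 'p K)" by (rule p_nonzero_K)
  show "1 \<in> (pow_ideal 0 :: 'p K set)" unfolding pow_ideal_0 by (rule range_eqI[of _ _ 1]) simp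
next
  fix x y :: "'p K" assume "x \<in> pow_ideal 0" "y \<in> pow_ideal 0"
  then obtain u v where "x = to_fract u" "y = to_fract v" by (auto simp: pow_ideal_0)
  then have "x - y = to_fract (u - v)" "x * y = to_fract (u * v)" by simp_all
  then show "x - y \<in> pow_ideal 0" "x * y \<in> pow_ideal 0" by (auto simp: pow_ideal_0 simp del: to_fract_diff to_fract_mult)
next
  fix x :: "'p K" assume x: "x \<in> pow_ideal 0" "x / of_nat CARD('p) \<notin> pow_ideal 0"
  then obtain u where u: "x = to_fract u" by (auto simp: pow_ideal_0)
  have "\<not> of_nat CARD('p) dvd u"
    using x(2) divide_pow_ideal[of x 1] to_fract_pow_ideal[of u 1] by (simp add: u)
  then obtain v where v: "u * v = 1" using unit_W by blast
  have "x * to_fract v = 1" using arg_cong[OF v, of to_fract] by (simp add: u)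
  then have "inverse x = to_fract v" by (rule inverse_unique)
  then show "inverse x \<in> pow_ideal 0" by (simp add: pow_ideal_0)
next
  fix x :: "'p K" assume x: "\<And>n. x / of_nat CARD('p) ^ n \<in> pow_ideal 0"
  obtain u where u: "x = to_fract u" using x[of 0] by (auto simp: pow_ideal_0)
  have "of_nat CARD('p) ^ n dvd u" for n using x[of n] by (simp add: divide_pow_ideal to_fract_pow_ideal u)
  then show "x = 0" using eq_0_W[of u] by (simp add: u)
next
  fix w :: "nat \<Rightarrow> 'p K" assume "\<And>n. (w (Suc n) - w n) / of_nat CARD('p) ^ n \<in> pow_ideal 0"
  then have "\<And>n. w (Suc n) - w n \<in> pow_ideal n" unfolding divide_pow_ideal .
  then have "\<forall>n. \<exists>t. w (Suc n) - w n = to_fract (of_nat CARD('p) ^ n * t)"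
    unfolding pow_ideal_def by (auto simp: image_iff to_fract_power to_fract_of_nat)
  then obtain t where t: "\<And>n. w (Suc n) - w n = to_fract (of_nat CARD('p) ^ n * t n)" by metis
  define v where "v n = (\<Sum>i<n. of_nat CARD('p) ^ i * t i)" for n
  have w: "w n = w 0 + to_fract (v n)" for n
  proof (induction n)
    case (Suc n)
    have "w (Suc n) = w n + to_fract (of_nat CARD('p) ^ n * t n)" using t[of n] by (simp add: algebra_simps)
    then show ?case using Suc by (simp add: v_def)
  qed (simp add: v_def)
  obtain L where L: "\<And>n. of_nat CARD('p) ^ n dvd v n - L"
    using complete_W[of v] by (auto simp: v_def)
  have "(w n - (w 0 + to_fract L)) / of_nat CARD('p) ^ n \<in> pow_ideal 0" for n
    using L[of n] unfolding divide_pow_ideal by (subst w) (simp add: to_fract_pow_ideal[symmetric])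
  then show "\<exists>L. \<forall>n. (w n - L) / of_nat CARD('p) ^ n \<in> pow_ideal 0" by blast
qed

lemma I_eq [simp]: "W.I n = pow_ideal n"
  by (auto simp: W.I_def divide_pow_ideal)

section \<open>Digits and limits of p-adic integers\<close>

context padic_field
begin

text \<open>Lipschitz functions on the natural numbers extend to their closure.\<close>

lemma lip_limit:
  assumes f: "lip 0 f" and N: "\<And>n. \<exists>M. of_nat M - z \<in> I n"
  shows "\<exists>L. \<forall>r n. of_nat n - z \<in> I r \<longrightarrow> f n - L \<in> I r"
proof -
  obtain M where M: "\<And>n. of_nat (M n) - z \<in> I n" using N by metis
  have c: "f m - f n \<in> I r" if "of_nat m - z \<in> I r" "of_nat n - z \<in> I r" for m n r
  proof -
    have "(of_nat m - z) - (of_nat n - z) \<in> I r" using that by (rule I_diff)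
    then have "[m = n] (mod p ^ r)" using of_nat_diff_I by simp
    then show ?thesis using lip_cong[OF f] by simp
  qed
  have "(f (M (Suc n)) - f (M n)) / \<pi> ^ n \<in> R" for n
    using c[OF I_anti_mono[OF _ M[of "Suc n"]] M[of n]] by (simp add: I_def)
  then obtain L where L: "\<And>n. f (M n) - L \<in> I n"
    using complete[of "\<lambda>n. f (M n)"] by (auto simp: I_def)
  have "f n - L \<in> I r" if "of_nat n - z \<in> I r" for r n
    using I_add[OF c[OF that M] L[of r]] by simp
  then show ?thesis by blast
qed

end

lemma Zp_R: "x \<in> Zp \<Longrightarrow> x \<in> pow_ideal 0" by (simp add: Zp_def)

lemma Zp_approx:
  assumes "x \<in> (Zp :: 'p::prime_card K set)"
  shows "\<exists>M. of_nat M - x \<in> pow_ideal n"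
proof -
  obtain j :: int where j: "x - of_int j \<in> pow_ideal n" using assms by (auto simp: Zp_def)
  define M where "M = nat (j mod int CARD('p) ^ n)"
  have "int M = j mod int CARD('p) ^ n" by (simp add: M_def)
  then have "int CARD('p) ^ n dvd int M - j" by (simp add: mod_eq_dvd_iff[symmetric])
  then have "(of_int (int M - j) :: 'p K) \<in> pow_ideal n" using W.of_int_I[of "int M - j" n, where 'p = 'p] by simp
  then have "(of_nat M - of_int j) - (x - of_int j) \<in> pow_ideal n"
    using j W.I_diff[of "of_nat M - of_int j" n "x - of_int j"] by simp
  then show ?thesis by auto
qed

lemma Zp_add:
  assumes "x \<in> Zp" "y \<in> Zp" shows "x + y \<in> (Zp :: 'p::prime_card K set)"
  unfolding Zp_def
proof (intro CollectI conjI allI)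
  show "x + y \<in> pow_ideal 0" using assms by (intro W.add_R Zp_R)
  fix n
  obtain i j :: int where "x - of_int i \<in> pow_ideal n" "y - of_int j \<in> pow_ideal n"
    using assms unfolding Zp_def by blast
  then have "x + y - of_int (i + j) \<in> pow_ideal n"
    using W.I_add[of "x - of_int i" n "y - of_int j"] by (simp add: algebra_simps)
  then show "\<exists>j::int. x + y - of_int j \<in> pow_ideal n" by blast
qed

lemma neg_residue_unique:
  assumes "l < CARD('p)" "\<alpha> + of_nat l \<in> pow_ideal 1"
  shows "neg_residue (\<alpha> :: 'p::prime_card K) = l"
  unfolding neg_residue_def
proof (rule the_equality)
  fix m assume m: "m < CARD('p) \<and> \<alpha> + of_nat m \<in> pow_ideal 1"
  then have "(\<alpha> + of_nat m) - (\<alpha> + of_nat l) \<in> pow_ideal 1"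
    using assms W.I_diff[of "\<alpha> + of_nat m" 1 "\<alpha> + of_nat l"] by simp
  then have "[m = l] (mod CARD('p))" using W.of_nat_diff_I[of m l 1, where 'p = 'p] by simp
  then show "m = l" using m assms by (simp add: cong_def)
qed (use assms in blast)

lemma neg_residue:
  assumes "x \<in> (Zp :: 'p::prime_card K set)"
  shows "neg_residue x < CARD('p)" "x + of_nat (neg_residue x) \<in> pow_ideal 1"
proof -
  obtain M where M: "of_nat M - x \<in> pow_ideal 1" using Zp_approx[OF assms] by blast
  define l where "l = (M * (CARD('p) - 1)) mod CARD('p)"
  have l: "l < CARD('p)" by (simp add: l_def prime_gt_0_nat)
  have "M + M * (CARD('p) - 1) = M * CARD('p)"
    using W.p_gt_0[where 'p = 'p] by (cases "CARD('p)") auto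
  then have "(M + l) mod CARD('p) = (M * CARD('p)) mod CARD('p)"
    unfolding l_def by (simp add: mod_add_right_eq)
  also have "\<dots> = 0" by simp
  finally have "CARD('p) ^ 1 dvd M + l" by auto
  then have "(of_nat (M + l) :: 'p K) \<in> pow_ideal 1" using W.of_nat_I[of "M + l" 1, where 'p = 'p] by simp
  then have "of_nat (M + l) - (of_nat M - x) \<in> pow_ideal 1"
    using M W.I_diff[of "of_nat (M + l)" 1 "of_nat M - x"] by simp
  then have "x + of_nat l \<in> pow_ideal 1" by (simp add: algebra_simps)
  then show "neg_residue x < CARD('p)" "x + of_nat (neg_residue x) \<in> pow_ideal 1"
    using neg_residue_unique[OF l] l by simp_all
qed

lemma dwork_prime_eq: "x + of_nat (neg_residue x) = of_nat CARD('p) * dwork_prime (x :: 'p::prime_card K)"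
  using p_nonzero_K[where 'p = 'p] by (simp add: dwork_prime_def)

lemma dwork_prime_Zp:
  assumes "x \<in> (Zp :: 'p::prime_card K set)"
  shows "dwork_prime x \<in> Zp"
  unfolding Zp_def
proof (intro CollectI conjI allI)
  let ?l = "neg_residue x"
  have "of_nat CARD('p) * dwork_prime x \<in> pow_ideal (Suc 0)"
    using neg_residue(2)[OF assms] by (simp add: dwork_prime_eq)
  then show "dwork_prime x \<in> pow_ideal 0"
    using W.p_mult_I[of "dwork_prime x" 0] by simp
  fix n
  obtain j :: int where j: "x - of_int j \<in> pow_ideal (Suc n)" using assms by (auto simp: Zp_def)
  have "x - of_int j \<in> pow_ideal 1" using W.I_anti_mono[of 1 "Suc n" "x - of_int j"] j by simp
  then have "(x + of_nat ?l) - (x - of_int j) \<in> pow_ideal 1"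
    using neg_residue(2)[OF assms] W.I_diff[of "x + of_nat ?l" 1 "x - of_int j"] by simp
  then have "of_int (j + int ?l) \<in> (pow_ideal 1 :: 'p K set)" by (simp add: algebra_simps)
  then have "int CARD('p) ^ 1 dvd j + int ?l" using W.of_int_I[of "j + int ?l" 1, where 'p = 'p] by simp
  then obtain q where q: "j + int ?l = int CARD('p) * q" by auto
  have "of_int j + of_nat ?l = (of_nat CARD('p) * of_int q :: 'p K)"
    using arg_cong[OF q, of "of_int :: int \<Rightarrow> 'p K"] by simp
  then have "x - of_int j = (x + of_nat ?l) - of_nat CARD('p) * of_int q" by (simp add: algebra_simps)
  then have "x - of_int j = of_nat CARD('p) * (dwork_prime x - of_int q)"
    unfolding dwork_prime_eq by (simp add: algebra_simps)
  then have "dwork_prime x - of_int q \<in> pow_ideal n" using j W.p_mult_I[of "dwork_prime x - of_int q" n] by simp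
  then show "\<exists>j::int. dwork_prime x - of_int j \<in> pow_ideal n" by blast
qed

definition dwork_iter :: "'p::prime_card K \<Rightarrow> nat \<Rightarrow> 'p K" where
  "dwork_iter x s = (dwork_prime ^^ s) x"

lemma dwork_iter_0 [simp]: "dwork_iter x 0 = x"
  and dwork_iter_Suc [simp]: "dwork_iter x (Suc s) = dwork_prime (dwork_iter x s)"
  by (simp_all add: dwork_iter_def)

lemma dwork_iter_Zp: "x \<in> Zp \<Longrightarrow> dwork_iter x s \<in> Zp"
  by (induction s) (auto intro: dwork_prime_Zp)

definition is_neg_digits :: "'p::prime_card K \<Rightarrow> (nat \<Rightarrow> nat) \<Rightarrow> bool" where
  "is_neg_digits \<alpha> d \<longleftrightarrow> (\<forall>i. d i < CARD('p)) \<and>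
     (\<forall>m. \<alpha> + (\<Sum>i<m. of_nat (d i) * of_nat CARD('p) ^ i) \<in> pow_ideal m)"

text \<open>This is also applied to the doubled digits \<open>2 d\<^sub>i\<close> of \<open>a\<close>, before they are known to be less than \<open>p\<close>;
  hence only a congruence.\<close>

lemma digit_cancel:
  assumes "(\<Sum>i<m. of_nat (d i) * of_nat CARD('p) ^ i) = (\<Sum>i<m. of_nat (e i) * of_nat CARD('p) ^ i :: 'p::prime_card K)"
    and "\<alpha> + (\<Sum>i<Suc m. of_nat (d i) * of_nat CARD('p) ^ i) \<in> pow_ideal (Suc m)"
    and "\<alpha> + (\<Sum>i<Suc m. of_nat (e i) * of_nat CARD('p) ^ i) \<in> (pow_ideal (Suc m) :: 'p K set)"
  shows "[d m = e m] (mod CARD('p))"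
proof -
  let ?D = "\<alpha> + (\<Sum>i<Suc m. of_nat (d i) * of_nat CARD('p) ^ i)"
  let ?E = "\<alpha> + (\<Sum>i<Suc m. of_nat (e i) * of_nat CARD('p) ^ i)"
  have "of_nat CARD('p) ^ m * (of_nat (d m) - of_nat (e m)) = ?D - ?E"
    using assms(1) by (simp add: algebra_simps)
  also have "\<dots> \<in> pow_ideal (Suc m)"
    using assms(2,3) W.I_diff[of ?D "Suc m" ?E] by (simp del: sum.lessThan_Suc)
  finally have "of_nat CARD('p) ^ m * (of_nat (d m) - of_nat (e m)) \<in> (pow_ideal (m + 1) :: 'p K set)" by simp
  then have "(of_nat (d m) - of_nat (e m) :: 'p K) \<in> pow_ideal 1"
    using W.p_power_mult_I[of m "of_nat (d m) - of_nat (e m) :: 'p K" 1] by simp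
  then show ?thesis using W.of_nat_diff_I[of "d m" "e m" 1, where 'p = 'p] by simp
qed

lemma is_neg_digits_unique:
  assumes "is_neg_digits \<alpha> d" "is_neg_digits \<alpha> e"
  shows "d = e"
proof
  fix m show "d m = e m"
  proof (induction m rule: less_induct)
    case (less m)
    have "[d m = e m] (mod CARD('a))"
      by (rule digit_cancel[where m = m and d = d and e = e and \<alpha> = \<alpha>]) (use assms less in \<open>auto simp: is_neg_digits_def simp del: sum.lessThan_Suc\<close>)
    then show ?case using assms by (simp add: is_neg_digits_def cong_def)
  qed
qed

text \<open>The digits are the residues of the iterated Dwork primes, because \<open>x\<close> plus the first \<open>m\<close> terms equals
  \<open>p ^ m\<close> times the \<open>m\<close>-th Dwork prime.\<close>

lemma is_neg_digits_dwork:
  assumes x: "x \<in> (Zp :: 'p::prime_card K set)"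
  shows "is_neg_digits x (\<lambda>i. neg_residue (dwork_iter x i))"
  unfolding is_neg_digits_def
proof (intro conjI allI)
  show "neg_residue (dwork_iter x i) < CARD('p)" for i by (rule neg_residue[OF dwork_iter_Zp[OF x]])
  fix m
  have "x + (\<Sum>i<m. of_nat (neg_residue (dwork_iter x i)) * of_nat CARD('p) ^ i) = of_nat CARD('p) ^ m * dwork_iter x m"
  proof (induction m)
    case (Suc m)
    have "x + (\<Sum>i<Suc m. of_nat (neg_residue (dwork_iter x i)) * of_nat CARD('p) ^ i)
        = (x + (\<Sum>i<m. of_nat (neg_residue (dwork_iter x i)) * of_nat CARD('p) ^ i))
          + of_nat CARD('p) ^ m * of_nat (neg_residue (dwork_iter x m))" by (simp add: algebra_simps)
    also have "\<dots> = of_nat CARD('p) ^ m * (dwork_iter x m + of_nat (neg_residue (dwork_iter x m)))"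
      unfolding Suc by (simp add: distrib_left)
    also have "\<dots> = of_nat CARD('p) ^ Suc m * dwork_iter x (Suc m)"
      unfolding dwork_prime_eq by (simp add: mult_ac)
    finally show ?case .
  qed simp
  moreover have "of_nat CARD('p) ^ m * dwork_iter x m \<in> pow_ideal m"
    using W.p_power_mult_I[of m "dwork_iter x m" 0] Zp_R[OF dwork_iter_Zp[OF x]] by simp
  ultimately show "x + (\<Sum>i<m. of_nat (neg_residue (dwork_iter x i)) * of_nat CARD('p) ^ i) \<in> pow_ideal m"
    by simp
qed

lemma neg_digit_eq:
  assumes "x \<in> (Zp :: 'p::prime_card K set)"
  shows "neg_digit x = (\<lambda>i. neg_residue (dwork_iter x i))"
  unfolding neg_digit_def is_neg_digits_def[symmetric]
  by (rule the_equality, rule is_neg_digits_dwork[OF assms])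
     (rule is_neg_digits_unique[OF _ is_neg_digits_dwork[OF assms]])

lemma is_neg_digits_neg_digit: "x \<in> Zp \<Longrightarrow> is_neg_digits x (neg_digit x)"
  by (simp add: neg_digit_eq is_neg_digits_dwork)

text \<open>Inductively there is no carry: \<open>2 d\<^sub>i\<close> is congruent to the digit \<open>e\<^sub>i\<close> of \<open>2 a\<close>, and \<open>d\<^sub>i < e\<^sub>i < p\<close>
  forces \<open>|2 d\<^sub>i - e\<^sub>i| < p\<close>.\<close>

lemma neg_digit_double:
  assumes a: "a \<in> (Zp :: 'p::prime_card K set)" and less: "\<And>i. neg_digit a i < neg_digit (2 * a) i"
  shows "neg_digit (2 * a) i = 2 * neg_digit a i"
proof (induction i rule: less_induct)
  case (less i)
  have a2: "2 * a \<in> Zp" using Zp_add[OF a a] by (simp only: mult_2)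
  note D = is_neg_digits_neg_digit[OF a, unfolded is_neg_digits_def]
  note E = is_neg_digits_neg_digit[OF a2, unfolded is_neg_digits_def]
  let ?S = "a + (\<Sum>i<Suc i. of_nat (neg_digit a i) * of_nat CARD('p) ^ i)"
  have "?S + ?S \<in> pow_ideal (Suc i)" using D W.I_add[of ?S "Suc i" ?S] by (simp del: sum.lessThan_Suc)
  also have "?S + ?S = 2 * a + (\<Sum>i<Suc i. of_nat (2 * neg_digit a i) * of_nat CARD('p) ^ i)"
  proof -
    have "(\<Sum>i<Suc i. of_nat (2 * neg_digit a i) * of_nat CARD('p) ^ i)
        = (\<Sum>i<Suc i. of_nat (neg_digit a i) * of_nat CARD('p) ^ i + of_nat (neg_digit a i) * of_nat CARD('p) ^ i :: 'p K)"
      by (simp only: mult_2 of_nat_add distrib_right)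
    then show ?thesis by (simp only: sum.distrib mult_2 add_ac)
  qed
  finally have "[2 * neg_digit a i = neg_digit (2 * a) i] (mod CARD('p))"
    by (intro digit_cancel[where m = i and d = "\<lambda>i. 2 * neg_digit a i" and e = "neg_digit (2 * a)" and \<alpha> = "2 * a"])
       (use less E in \<open>auto simp del: sum.lessThan_Suc\<close>)
  then obtain k where k: "int (2 * neg_digit a i) - int (neg_digit (2 * a) i) = int CARD('p) * k"
    unfolding cong_int_iff[symmetric] cong_iff_dvd_diff dvd_def by blast
  have b: "neg_digit (2 * a) i < CARD('p)" "neg_digit a i < neg_digit (2 * a) i" using E assms(2) by auto
  then have "\<bar>int CARD('p) * k\<bar> < int CARD('p) * 1" unfolding k[symmetric] by linarith
  then have "k = 0" unfolding abs_mult by (simp add: zero_less_card_finite)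
  then show ?case using k by simp
qed

text \<open>Natural numbers come arbitrarily close to \<open>z\<close>, so the limit is unique.\<close>

lemma padic_lim_eqI:
  assumes z: "z \<in> (Zp :: 'p::prime_card K set)"
    and f: "\<And>r n. of_nat n - z \<in> pow_ideal r \<Longrightarrow> f n - L \<in> pow_ideal r"
  shows "padic_lim f z = L"
  unfolding padic_lim_def
proof (rule the_equality)
  show "\<forall>m. \<exists>r. \<forall>n. of_nat n - z \<in> pow_ideal r \<longrightarrow> f n - L \<in> pow_ideal m" using f by blast
  fix L' assume L': "\<forall>m. \<exists>r. \<forall>n. of_nat n - z \<in> pow_ideal r \<longrightarrow> f n - L' \<in> pow_ideal m"
  have "L' - L \<in> W.I m" for m
  proof -
    obtain r where r: "\<And>n. of_nat n - z \<in> pow_ideal r \<Longrightarrow> f n - L' \<in> pow_ideal m" using L' by blast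
    obtain N where N: "of_nat N - z \<in> pow_ideal (max m r)" using Zp_approx[OF z] by blast
    then have "of_nat N - z \<in> pow_ideal m" "of_nat N - z \<in> pow_ideal r"
      using W.I_anti_mono[of _ "max m r" "of_nat N - z"] by simp_all
    then have "f N - L \<in> pow_ideal m" "f N - L' \<in> pow_ideal m" using f r by auto
    then show ?thesis using W.I_diff[of "f N - L" m "f N - L'"] by simp
  qed
  then show "L' = L" by (rule W.eqI_cong)
qed

section \<open>Frobenius fixes rational coefficients\<close>

lemma witt_frob_1: "witt_frob 1 = (1 :: 'k::comm_ring_prime_char witt)"
  by transfer (auto simp: wone_def fun_eq_iff power_0_left prime_gt_0_nat)

lemma witt_frob_0: "witt_frob 0 = (0 :: 'k::comm_ring_prime_char witt)"
  by transfer (auto simp: fun_eq_iff power_0_left prime_gt_0_nat)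

lemma witt_frob_of_nat: "witt_frob (of_nat n) = (of_nat n :: 'k::comm_ring_prime_char witt)"
  by (induction n) (simp_all add: witt_frob_0 witt_frob_1 witt_frob_add)

lemma witt_frob_of_int: "witt_frob (of_int n) = (of_int n :: 'k::comm_ring_prime_char witt)"
proof (cases n)
  case (neg m)
  have "witt_frob (of_int n) + witt_frob (of_nat (Suc m)) = witt_frob (of_int n + of_nat (Suc m))"
    by (simp only: witt_frob_add)
  also have "\<dots> = 0" by (simp add: neg witt_frob_0)
  finally show ?thesis by (simp add: neg witt_frob_of_nat eq_neg_iff_add_eq_0 del: of_nat_Suc)
qed (simp add: witt_frob_of_nat)

text \<open>The prime field, in any characteristic; whence the condition on the denominator.\<close>

definition rational :: "'a::field \<Rightarrow> bool" where
  "rational x \<longleftrightarrow> (\<exists>m n :: int. of_int n \<noteq> (0 :: 'a) \<and> x = of_int m / of_int n)"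

lemma rationalI: "of_int n \<noteq> (0 :: 'a::field) \<Longrightarrow> x = of_int m / of_int n \<Longrightarrow> rational (x :: 'a)"
  unfolding rational_def by (intro exI conjI)

lemma rationalE:
  assumes "rational (x :: 'a::field)"
  obtains m n where "of_int n \<noteq> (0 :: 'a)" "x = of_int m / of_int n"
  using assms unfolding rational_def by (elim exE conjE) (rule that)

lemma rational_of_nat: "rational (of_nat n)"
  by (rule rationalI[of 1 _ "int n"]) simp_all

lemma rational_mult:
  assumes "rational x" "rational y" shows "rational (x * y)"
proof (rule rationalE[OF assms(1)], rule rationalE[OF assms(2)])
  fix m n m' n' assume "of_int n \<noteq> (0 :: 'a)" and x: "x = of_int m / of_int n"
    and "of_int n' \<noteq> (0 :: 'a)" and y: "y = of_int m' / of_int n'"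
  then have "of_int (n * n') \<noteq> (0 :: 'a)" "x * y = of_int (m * m') / of_int (n * n')"
    unfolding x y by simp_all
  then show ?thesis by (rule rationalI)
qed

lemma rational_add:
  assumes "rational x" "rational y" shows "rational (x + y)"
proof (rule rationalE[OF assms(1)], rule rationalE[OF assms(2)])
  fix m n m' n' assume "of_int n \<noteq> (0 :: 'a)" and x: "x = of_int m / of_int n"
    and "of_int n' \<noteq> (0 :: 'a)" and y: "y = of_int m' / of_int n'"
  then have "of_int (n * n') \<noteq> (0 :: 'a)" "x + y = of_int (m * n' + m' * n) / of_int (n * n')"
    unfolding x y by (simp_all add: add_frac_eq)
  then show ?thesis by (rule rationalI)
qed

lemma rational_divide:
  assumes "rational x" "rational y" shows "rational (x / y)"
proof (rule rationalE[OF assms(1)], rule rationalE[OF assms(2)])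
  fix m n m' n' assume n: "of_int n \<noteq> (0 :: 'a)" and x: "x = of_int m / of_int n"
    and n': "of_int n' \<noteq> (0 :: 'a)" and y: "y = of_int m' / of_int n'"
  show ?thesis
  proof (cases "of_int m' = (0 :: 'a)")
    case True
    then show ?thesis using rational_of_nat[of 0] by (simp add: y)
  next
    case False
    then have "of_int (n * m') \<noteq> (0 :: 'a)" "x / y = of_int (m * n') / of_int (n * m')"
      unfolding x y using n by simp_all
    then show ?thesis by (rule rationalI)
  qed
qed

lemma rational_pochhammer: "rational x \<Longrightarrow> rational (pochhammer x n)"
  by (induction n) (use rational_of_nat[of 1] in \<open>auto simp: pochhammer_Suc intro!: rational_mult rational_add rational_of_nat\<close>)

lemma rational_hyp_coeff: "rational a \<Longrightarrow> rational (hyp_coeff a n)"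
  unfolding hyp_coeff_def using rational_of_nat[of 1] rational_of_nat[of 2]
  by (auto intro!: rational_divide rational_mult rational_pochhammer)

lemma to_fract_of_int: "to_fract (of_int n) = of_int n"
  by (cases n rule: int_cases2) (simp_all add: to_fract_of_nat)

lemma fract_frob_rational:
  assumes "rational x" shows "fract_frob x = (x :: 'k::idom_prime_char witt fract)"
proof -
  obtain m n :: int where mn: "of_int n \<noteq> (0 :: 'k witt fract)" "x = of_int m / of_int n"
    using assms by (auto simp: rational_def)
  have n0: "of_int n \<noteq> (0 :: 'k witt)" using mn(1) by (metis to_fract_of_int to_fract_0)
  have x: "x = Fraction_Field.Fract (of_int m) (of_int n)"
    by (simp add: mn(2) Fract_conv_to_fract to_fract_of_int)
  show ?thesis unfolding x fract_frob_Fract[OF n0] witt_frob_of_int ..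
qed

section \<open>The congruence\<close>

lemma hypergeom_eq: "hypergeom a a (2 * a) = Abs_fps (hyp_coeff a)"
  by (simp add: hypergeom_def hyp_coeff_def fps_eq_iff)

lemma (in odd_padic_field) Gam_eq: "Gam n = (-1) ^ n * of_nat (\<Prod>i | 0 < i \<and> i < n \<and> \<not> p dvd i. i)"
proof -
  have "{x. x < n \<and> \<not> p dvd x} = {i. 0 < i \<and> i < n \<and> \<not> p dvd i}" by (auto intro: gr0I)
  then show ?thesis by (simp add: Gam_def fact_p_eq)
qed

theorem theorem1p1:
  fixes a c :: "'p::prime_card K" and n :: nat
  assumes "CARD('p) \<ge> 3"
    and "a \<in> Zp"
    and "\<exists>N::int. N \<ge> 2 \<and> \<not> int CARD('p) dvd N \<and> (\<exists>m::int. of_int N * a = of_int m)"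
    and "\<forall>i. neg_digit a i < neg_digit (2 * a) i"
    and "c - 1 \<in> pow_ideal 1"
    and "n \<ge> 1"
  shows "fps_pcong n (F_hat c a)
    (fps_cutoff (CARD('p) ^ n) (G_hat c a) / fps_cutoff (CARD('p) ^ n) (hypergeom a a (2 * a)))"
proof -
  interpret odd: odd_padic_field "CARD('p)" "pow_ideal 0 :: 'p K set"
    by unfold_locales (use assms(1) in simp)
  have a2: "2 * a \<in> Zp" using Zp_add[OF assms(2,2)] by (simp only: mult_2)
  define dig where "dig = neg_digit a"
  have dig: "dig = (\<lambda>s. neg_residue (dwork_iter a s))" unfolding dig_def by (rule neg_digit_eq[OF assms(2)])
  have dig2: "neg_digit (2 * a) s = 2 * dig s" for s
    unfolding dig_def using assms(4) by (intro neg_digit_double assms(2)) blast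
  have "\<And>i. neg_digit (2 * a) i < CARD('p)"
    using is_neg_digits_neg_digit[OF a2] by (simp add: is_neg_digits_def)
  then have dig_less: "2 * dig s < CARD('p)" for s by (simp add: dig2)
  have dig_pos: "0 < dig s" for s using assms(4) dig2[of s] unfolding dig_def by (metis less_add_same_cancel1 mult_2)
  interpret ch: digit_chain "CARD('p)" "pow_ideal 0 :: 'p K set" "dwork_iter a" dig
  proof
    show "dwork_iter a s \<in> pow_ideal 0" for s by (intro Zp_R dwork_iter_Zp assms(2))
    show "dwork_iter a s + of_nat (dig s) = of_nat CARD('p) * dwork_iter a (Suc s)" for s
      unfolding dig by (simp add: dwork_prime_eq)
  qed (rule dig_pos dig_less)+
  define l where "l = dig 0"
  have l: "neg_residue a = l" by (simp add: l_def dig)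
  define a' where "a' = dwork_prime a"
  have a'_Zp: "a' \<in> Zp" unfolding a'_def by (rule dwork_prime_Zp[OF assms(2)])
  have "neg_residue (2 * a) = 2 * l"
    using fun_cong[OF neg_digit_eq[OF a2], of 0] dig2[of 0] by (simp add: l_def)
  then have a2': "dwork_prime (2 * a) = 2 * a'"
    by (simp add: dwork_prime_def a'_def l algebra_simps)
  have limG: "\<exists>L. \<forall>r n. of_nat n - z \<in> pow_ideal r \<longrightarrow> odd.Gam n - L \<in> pow_ideal r" if "z \<in> Zp" for z :: "'p K"
    using W.lip_limit[OF odd.lip_Gam, of z] Zp_approx[OF that] by simp
  obtain g1 where g1: "\<And>r n. of_nat n - a \<in> pow_ideal r \<Longrightarrow> odd.Gam n - g1 \<in> pow_ideal r"
    using limG[OF assms(2)] by blast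
  obtain g2 where g2: "\<And>r n. of_nat n - 2 * a \<in> pow_ideal r \<Longrightarrow> odd.Gam n - g2 \<in> pow_ideal r"
    using limG[OF a2] by blast
  have c: "c - 1 \<in> W.I 1" using assms(5) by simp
  have "W.lip 0 (\<lambda>m. c ^ m)"
    using W.lip_mono[OF W.smooth_lip[OF odd.smooth_power[OF c]], of 0] by simp
  from W.lip_limit[OF this, of a'] obtain q
    where q: "\<And>r n. of_nat n - a' \<in> pow_ideal r \<Longrightarrow> c ^ n - q \<in> pow_ideal r"
    using Zp_approx[OF a'_Zp] by auto
  have "morita_Gamma a = g1" "morita_Gamma (2 * a) = g2"
    unfolding morita_Gamma_def odd.Gam_eq[symmetric]
    by (rule padic_lim_eqI[OF assms(2) g1], assumption) (rule padic_lim_eqI[OF a2 g2], assumption)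
  then have Beta: "padic_Beta a a = g1 * g1 / g2" unfolding padic_Beta_def by (simp flip: mult_2)
  have power: "padic_power c a' = q"
    unfolding padic_power_def by (rule padic_lim_eqI[OF a'_Zp q])
  define \<epsilon> where "\<epsilon> = (- 1) ^ l * (g2 / (g1 * g1))"
  define B where "B k = (hyp_coeff a k - \<epsilon> * q * (if l \<le> k \<and> CARD('p) dvd k - l
      then hyp_coeff a' ((k - l) div CARD('p)) * c ^ ((k - l) div CARD('p)) else 0)) / (of_nat k + a)" for k
  have "rational a"
  proof -
    obtain N m :: int where N: "\<not> int CARD('p) dvd N" "of_int N * a = of_int m" using assms(3) by blast
    have "(of_int N :: 'p K) \<noteq> 0"
      using N(1) W.of_int_I[of N 1, where 'p = 'p] W.I_zero[of 1, where 'p = 'p] by auto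
    then show ?thesis using N(2) by (intro rationalI[of N _ m]) (simp_all add: field_simps)
  qed
  then have "rational a'" unfolding a'_def dwork_prime_def
    by (intro rational_divide rational_add rational_of_nat)
  then have frob: "fract_frob (hyp_coeff a' k) = hyp_coeff a' k" for k by (intro fract_frob_rational rational_hyp_coeff)
  \<comment> \<open>The coefficients of the hypergeometric series at \<open>a'\<close> are rational, so that \<open>F\<close> fixes them.\<close>
  have G: "G_hat c a = Abs_fps B"
  proof (rule fps_ext)
    fix k
    have s: "fps_nth (sigma c (Abs_fps (hyp_coeff a'))) j
        = (if CARD('p) dvd j then hyp_coeff a' (j div CARD('p)) * c ^ (j div CARD('p)) else 0)" for j
      by (simp add: sigma_def frob)
    show "fps_nth (G_hat c a) k = fps_nth (Abs_fps B) k"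
      unfolding G_hat_def twisted_integral_def sigma_twist_def a2' a'_def[symmetric] hypergeom_eq Beta power l
      by (simp add: B_def \<epsilon>_def mult.assoc fps_X_power_mult_nth s)
  qed
  have "bracket (CARD('p) ^ n) (ch.A_fps 0) (Abs_fps B) \<in> W.I_fps n"
  proof (rule ch.log_type_congruence[where ?g1.0 = g1 and ?g2.0 = g2 and c = c and q = q and \<epsilon> = \<epsilon>])
    fix k
    show "B k = (ch.A 0 k - \<epsilon> * q * (if dig 0 \<le> k \<and> CARD('p) dvd k - dig 0
      then ch.A (Suc 0) ((k - dig 0) div CARD('p)) * c ^ ((k - dig 0) div CARD('p)) else 0)) / (of_nat k + dwork_iter a 0)"
      by (simp add: B_def l_def a'_def)
  qed (use g1 g2 q c in \<open>auto simp: \<epsilon>_def l_def a'_def\<close>)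
  moreover have "ch.A_fps 0 \<in> W.I_fps 0"
    using ch.admissible_R[OF ch.admissible_hyp, of 0] by (simp add: W.I_fps_def)
  ultimately have "Abs_fps B / Abs_fps (hyp_coeff a)
      - fps_cutoff (CARD('p) ^ n) (Abs_fps B) / fps_cutoff (CARD('p) ^ n) (Abs_fps (hyp_coeff a)) \<in> W.I_fps n"
    using W.p_gt_0[where 'p = 'p] by (intro W.quotient_cutoff_cong) simp_all
  then show ?thesis
    unfolding fps_pcong_def F_hat_def G hypergeom_eq by (simp add: W.I_fps_def)
qed

end
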